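(* For every convex body $K\subset\mathbb{R}^4$, $$I_{1,-4}(K)\ge I_{2,-4}(K)^{1/2}.$$
   Context: A convex body is a compact convex set with non-empty interior. $G_{n,k}$ denotes the Grassmannian of $k$-dimensional linear subspaces of $\mathbb{R}^n$ with its rotation-invariant probability measure $dF$. $P_F$ is orthogonal projection onto $F$, and $\mathrm{vol}_k$ is $k$-dimensional volume. For a convex body $K\subset\mathbb{R}^n$, $B_K$ is the Euclidean ball centered at the origin with $\mathrm{vol}_n(B_K)=\mathrm{vol}_n(K)$. For $p\neq0$ and $1\le k\le n$, define $$I_{k,p}(K)=\left(\frac{\int_{G_{n,k}}\mathrm{vol}_k(P_FK)^p\,dF}{\int_{G_{n,k}}\mathrm{vol}_k(P_FB_K)^p\,dF}\right)^{1/p}.$$ Here $n=4$ and $p=-4$. *)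

theory Defs
  imports "HOL-Analysis.Analysis"
begin

definition convex_body :: "'a::euclidean_space set \<Rightarrow> bool" where
  "convex_body K \<longleftrightarrow> compact K \<and> convex K \<and> interior K \<noteq> {}"

definition orth_proj :: "'a::euclidean_space set \<Rightarrow> 'a \<Rightarrow> 'a" where
  "orth_proj F x = (THE y. y \<in> F \<and> (\<forall>z\<in>F. orthogonal (x - y) z))"

definition grassmannian :: "nat \<Rightarrow> (real^'n) set set" where
  "grassmannian k = {F. subspace F \<and> dim F = k}"

text \<open>The topology of the Grassmannian is the one induced by identifying a subspace with the
  matrix of the orthogonal projection onto it; this is its Borel \<open>\<sigma>\<close>-algebra.\<close>

definition grassmannian_borel :: "nat \<Rightarrow> (real^'n) set measure" where
  "grassmannian_borel k = vimage_algebra (grassmannian k) (\<lambda>F. matrix (orth_proj F)) borel"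

definition rotation_invariant_prob :: "nat \<Rightarrow> (real^'n) set measure \<Rightarrow> bool" where
  "rotation_invariant_prob k \<mu> \<longleftrightarrow>
     sets \<mu> = sets (grassmannian_borel k) \<and> emeasure \<mu> (space \<mu>) = 1 \<and>
     (\<forall>Q. rotation_matrix Q \<longrightarrow> distr \<mu> \<mu> (\<lambda>F. (\<lambda>x. Q *v x) ` F) = \<mu>)"

text \<open>For \<open>k \<le> n\<close> there is exactly one such measure, because \<open>SO(n)\<close> is compact and acts
  transitively on the Grassmannian.\<close>

definition grassmannian_measure :: "nat \<Rightarrow> (real^'n) set measure" where
  "grassmannian_measure k = (THE \<mu>. rotation_invariant_prob k \<mu>)"

definition orthonormal_basis_of :: "'a::euclidean_space set \<Rightarrow> 'a set \<Rightarrow> bool" where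
  "orthonormal_basis_of F B \<longleftrightarrow> pairwise orthogonal B \<and> (\<forall>b\<in>B. norm b = 1) \<and> span B = F"

text \<open>Lebesgue measure on a subspace \<open>F\<close>, as a Borel measure on the ambient space carried by \<open>F\<close>.
  As in the definition of \<^const>\<open>lborel\<close>, it is the image of a product measure under
  orthonormal coordinates; the result does not depend on the chosen basis.\<close>

definition lborel_subspace :: "'a::euclidean_space set \<Rightarrow> 'a measure" where
  "lborel_subspace F =
     (let B = (SOME B. orthonormal_basis_of F B)
      in distr (\<Pi>\<^sub>M b\<in>B. lborel :: real measure) borel (\<lambda>f. \<Sum>b\<in>B. f b *\<^sub>R b))"

definition proj_vol :: "'a::euclidean_space set \<Rightarrow> 'a set \<Rightarrow> real" where
  "proj_vol F K = measure (lborel_subspace F) (orth_proj F ` K)"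

definition volume_ball :: "'a::euclidean_space set \<Rightarrow> 'a set" where
  "volume_ball K =
     cball 0 (THE r. 0 \<le> r \<and> measure lborel (cball (0::'a) r) = measure lborel K)"

text \<open>The functional \<open>I\<^bsub>k,p\<^esub>(K)\<close>, meaningful for \<open>p \<noteq> 0\<close> and \<open>1 \<le> k \<le> n\<close>.\<close>

definition proj_mean :: "nat \<Rightarrow> real \<Rightarrow> (real^'n) set \<Rightarrow> real" where
  "proj_mean k p K =
     ((\<integral>F. proj_vol F K powr p \<partial>grassmannian_measure k) /
      (\<integral>F. proj_vol F (volume_ball K) powr p \<partial>grassmannian_measure k)) powr (1 / p)"

end

theory Submission
  imports Defs
begin

text \<open>For \<open>p = -4\<close> the scale factors drop out and, with \<open>w\<close> the width function of \<open>K\<close> and averages over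
  the two Grassmannians, the claim reads
  \<open>E[vol\<^sub>2(P\<^sub>F K)\<^sup>-\<^sup>4] \<ge> 256/\<pi>\<^sup>4 E[w\<^sup>-\<^sup>4]\<^sup>2\<close>.
  Let \<open>D = {y. w(y) \<le> 1}\<close>, the polar of the difference body. By homogeneity \<open>vol\<^sub>4(D)\<close> is a multiple of
  \<open>E[w\<^sup>-\<^sup>4]\<close>, and a Blaschke--Petkantschin argument (averaging over random orthonormal frames) shows that
  \<open>vol\<^sub>4(D)\<^sup>2\<close> is a multiple of \<open>E[det J\<^sub>F]\<close>, where \<open>J\<^sub>F\<close> is the inertia matrix of \<open>D \<inter> F\<close>. In dimension four
  the weight in that formula is the square of a determinant, which is why the inertia matrix appears. It
  remains to prove, for a planar convex body \<open>L = P\<^sub>F K\<close>, that \<open>vol\<^sub>2(L)\<^sup>4 det J\<^sub>F\<close> is largest for a disc.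
  Since \<open>D \<inter> F\<close> is the polar of \<open>L - L\<close> within \<open>F\<close>, for a fixed direction \<open>v\<close> the lengths of the sections of
  \<open>D \<inter> F\<close> and the widths of the sets of chords of \<open>L\<close> parallel to \<open>v\<close> are in duality; the
  Prekopa--Leindler inequality in logarithmic coordinates then bounds the product of \<open>v\<^sup>T J\<^sub>F v\<close> and the
  first radial moment of the covariogram of \<open>L\<close> along \<open>v\<close>. The integral of the covariogram is
  \<open>vol\<^sub>2(L)\<^sup>2\<close>, so comparing it radially with the indicator of an ellipse \<open>{v. v\<^sup>T J\<^sub>F v \<le> c}\<close> gives the bound.\<close>

section \<open>The Prekopa--Leindler inequality on the line\<close>

text \<open>The exponent is minus the dimension, which is why E[w^-4] can be read as a volume.
  Nothing is lost when K is a ball: if L is a disc of radius rho, the section of D is a disc of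
  radius 1/(2 rho), and evaluating both sides there gives the constants pi^2/128, pi^6/4096 and
  pi^4/256. A difficulty is that the two means live on different Grassmannians, whose measures are
  specified only by invariance. Both are pushed forward from one Haar measure on SO(4), seen as the
  law of a random frame: its first vector spans the line, its first two vectors span the plane. The
  Haar measure is the law of x -> a x conj(b) for two independent random unit quaternions a and b.
  Multiplication by a fixed unit quaternion is itself a rotation of four-space, so invariance on
  both sides comes down to rotation invariance of Lebesgue measure. Averages over rotations are kept
  as extended nonnegative integrals, so that Fubini asks only for measurability; integrability over
  rotations is settled at the end.\<close>

lemma compact_approx_lborel_real:
  fixes A :: "real set"
  assumes A: "A \<in> sets borel" and x: "x < emeasure lborel A"
  shows "\<exists>K. compact K \<and> K \<subseteq> A \<and> x < emeasure lborel K"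
proof -
  \<comment> \<open>Truncation makes the measure finite, which the subtraction of the part outside
    \<open>T\<close> demands; the strict bound by \<open>x\<close> survives for large
    \<open>n\<close> even when \<open>A\<close> has infinite measure.\<close>
  let ?A = "\<lambda>n::nat. A \<inter> {- real n..real n}"
  have U: "(\<Union>n. ?A n) = A"
  proof (intro equalityI subsetI)
    fix y assume "y \<in> A"
    obtain n where "\<bar>y\<bar> \<le> real n" using real_arch_simple by blast
    then show "y \<in> (\<Union>n. ?A n)" using \<open>y \<in> A\<close> by (auto intro!: exI[of _ n])
  qed auto
  have "(SUP n. emeasure lborel (?A n)) = emeasure lborel (\<Union>n. ?A n)"
    using A by (intro SUP_emeasure_incseq) (auto simp: incseq_def)
  with x U have "x < (SUP n. emeasure lborel (?A n))" by simp
  then obtain n where n: "x < emeasure lborel (?A n)" by (auto simp only: less_SUP_iff)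
  have fin: "emeasure lborel (?A n) < \<infinity>"
    using emeasure_mono[of "?A n" "{- real n..real n}" lborel] by (auto intro: le_less_trans)
  obtain xr where xr: "x = ennreal xr" "0 \<le> xr" using n fin by (cases x) auto
  obtain ar where ar: "emeasure lborel (?A n) = ennreal ar" "0 \<le> ar"
    using fin by (cases "emeasure lborel (?A n)") auto
  have lt: "xr < ar" using n xr ar by (simp add: ennreal_less_iff)
  have "?A n \<in> sets lebesgue" using A by auto
  then obtain T where T: "closed T" "T \<subseteq> ?A n" "emeasure lebesgue (?A n - T) < ennreal (ar - xr)"
    using lt by (elim sets_lebesgue_inner_closed[where e = "ar - xr"]) auto
  have bT: "T \<in> sets borel" using T by auto
  have cT: "compact T"
    using T by (auto simp: compact_eq_bounded_closed intro: bounded_subset[of "{- real n..real n}"])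
  have "emeasure lborel (?A n) = emeasure lborel T + emeasure lborel (?A n - T)"
    using T A bT by (subst plus_emeasure) (auto intro!: arg_cong[where f="emeasure lborel"])
  moreover have "emeasure lborel (?A n - T) < ennreal (ar - xr)"
    using T(3) A bT by simp
  ultimately have "x < emeasure lborel T"
    using ar xr lt
    by (cases "emeasure lborel T"; cases "emeasure lborel (?A n - T)")
       (auto simp: ennreal_less_iff ennreal_plus[symmetric] simp del: ennreal_plus)
  then show ?thesis using T cT by auto
qed

text \<open>Pair every point of \<open>A\<close> with the minimum \<open>b\<close> of
  \<open>B\<close>, and the maximum \<open>a\<close> of \<open>A\<close> with every point of
  \<open>B\<close>. This puts half-size copies of \<open>A\<close> and \<open>B\<close> into
  \<open>C\<close>, one to the left and one to the right of \<open>(a + b) / 2\<close>. They share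
  only that point, so after its removal their measures add.\<close>

lemma brunn_minkowski_compact_real:
  fixes A B C :: "real set"
  assumes "compact A" "compact B" "A \<noteq> {}" "B \<noteq> {}" "C \<in> sets borel"
    and mid: "\<And>a b. a \<in> A \<Longrightarrow> b \<in> B \<Longrightarrow> (a + b) / 2 \<in> C"
  shows "emeasure lborel A + emeasure lborel B \<le> 2 * emeasure lborel C"
proof -
  obtain a where a: "a \<in> A" "\<And>x. x \<in> A \<Longrightarrow> x \<le> a"
    using compact_attains_sup[OF \<open>compact A\<close> \<open>A \<noteq> {}\<close>] by auto
  obtain b where b: "b \<in> B" "\<And>x. x \<in> B \<Longrightarrow> b \<le> x"
    using compact_attains_inf[OF \<open>compact B\<close> \<open>B \<noteq> {}\<close>] by auto
  define A' where "A' = (\<lambda>x. b/2 + (1/2) * x) ` A - {(a + b) / 2}"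
  define B' where "B' = (\<lambda>x. a/2 + (1/2) * x) ` B"
  have scale: "emeasure lborel ((\<lambda>x. t + (1/2) * x) ` S) = emeasure lborel S / 2"
    if "compact S" for S :: "real set" and t
  proof -
    have im[measurable]: "(\<lambda>x. t + (1/2) * x) ` S \<in> sets borel"
      using that by (intro borel_compact compact_continuous_image continuous_intros)
    have [measurable]: "S \<in> sets borel" using that by (rule borel_compact)
    have "emeasure lborel ((\<lambda>x. t + (1/2) * x) ` S) =
      (\<integral>\<^sup>+x. indicator ((\<lambda>x. t + (1/2) * x) ` S) x \<partial>lborel)"
      using im by (subst nn_integral_indicator) simp_all
    also have "\<dots> = ennreal \<bar>1/2\<bar> * (\<integral>\<^sup>+x. indicator ((\<lambda>x. t + (1/2) * x) ` S) (t + (1/2) * x) \<partial>lborel)"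
      by (rule nn_integral_real_affine, rule borel_measurable_indicator, rule im, simp)
    also have "(\<integral>\<^sup>+x. indicator ((\<lambda>x. t + (1/2) * x) ` S) (t + (1/2) * x) \<partial>lborel) =
       (\<integral>\<^sup>+x. indicator S x \<partial>lborel)"
      by (intro nn_integral_cong) (auto split: split_indicator)
    also have "ennreal \<bar>1/2\<bar> = inverse 2"
      using inverse_ennreal[of 2] by (simp add: inverse_eq_divide)
    finally show ?thesis using im \<open>S \<in> sets borel\<close>
      by (simp add: divide_ennreal_def mult.commute del: times_divide_eq_left)
  qed
  have cA: "compact ((\<lambda>x. b/2 + (1/2) * x) ` A)" "compact B'"
    unfolding B'_def using assms by (auto intro!: compact_continuous_image continuous_intros)
  have "A' \<union> B' \<subseteq> C"
    unfolding A'_def B'_def using mid[OF _ b(1)] mid[OF a(1)] by (auto simp: field_simps)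
  moreover have "A' \<inter> B' = {}"
    unfolding A'_def B'_def using a b by (force simp: field_simps)
  moreover have sb: "A' \<in> sets borel" "B' \<in> sets borel"
    using borel_compact[OF cA(1)] borel_compact[OF cA(2)] by (auto simp: A'_def)
  ultimately have "emeasure lborel A' + emeasure lborel B' \<le> emeasure lborel C"
    using \<open>C \<in> sets borel\<close> by (subst plus_emeasure) (auto intro!: emeasure_mono)
  moreover have "emeasure lborel A' = emeasure lborel A / 2"
    unfolding A'_def using borel_compact[OF cA(1)]
    by (subst emeasure_Diff_null_set) (use scale[OF assms(1), of "b/2"] in auto)
  moreover have "emeasure lborel B' = emeasure lborel B / 2"
    unfolding B'_def by (rule scale) fact
  ultimately have "2 * (emeasure lborel A / 2 + emeasure lborel B / 2) \<le> 2 * emeasure lborel C"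
    by (intro mult_left_mono) auto
  then show ?thesis by (simp add: distrib_left ennreal_times_divide ennreal_mult_divide_eq mult.commute[of 2])
qed

lemma brunn_minkowski_real:
  fixes A B C :: "real set"
  assumes "A \<in> sets borel" "B \<in> sets borel" "A \<noteq> {}" "B \<noteq> {}" "C \<in> sets borel"
    and mid: "\<And>a b. a \<in> A \<Longrightarrow> b \<in> B \<Longrightarrow> (a + b) / 2 \<in> C"
  shows "emeasure lborel A + emeasure lborel B \<le> 2 * emeasure lborel C"
proof -
  \<comment> \<open>A set of measure zero still needs a nonempty compact subset, because the compact
    case uses a point of each set; a singleton serves, with \<open>x = 0\<close>.\<close>
  have approx: "\<exists>K. compact K \<and> K \<noteq> {} \<and> K \<subseteq> S \<and> x \<le> emeasure lborel K"
    if S: "S \<in> sets borel" "S \<noteq> {}" and x: "x = 0 \<or> x < emeasure lborel S" for S :: "real set" and x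
  proof (cases "x < emeasure lborel S")
    case True
    from compact_approx_lborel_real[OF S(1) True] show ?thesis
      by (metis emeasure_empty not_less_zero order_less_imp_le)
  next
    case False
    then show ?thesis using S x by (metis compact_sing empty_subsetI ex_in_conv insert_not_empty insert_subset zero_le)
  qed
  \<comment> \<open>The summands are approximated from below one at a time. The alternatives
    \<open>x = 0\<close> and \<open>y = 0\<close> cover a summand that has nothing strictly below
    it.\<close>
  have dense: "X + Y \<le> Z" if "\<And>x y. x = 0 \<or> x < X \<Longrightarrow> y = 0 \<or> y < Y \<Longrightarrow> x + y \<le> Z"
    for X Y Z :: ennreal
  proof -
    have "X \<le> Z - y" if y: "y = 0 \<or> y < Y" for y
    proof (rule dense_le)
      fix x assume "x < X"
      then have "x + y \<le> Z" using that \<open>\<And>x y. x = 0 \<or> x < X \<Longrightarrow> y = 0 \<or> y < Y \<Longrightarrow> x + y \<le> Z\<close> by blast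
      then have "(x + y) - y \<le> Z - y" by (intro ennreal_minus_mono) auto
      moreover have "y \<noteq> top" using y by auto
      ultimately show "x \<le> Z - y" by (simp add: ennreal_add_diff_cancel_right)
    qed
    moreover have "y \<le> Z" if y: "y = 0 \<or> y < Y" for y using \<open>\<And>x y. x = 0 \<or> x < X \<Longrightarrow> y = 0 \<or> y < Y \<Longrightarrow> x + y \<le> Z\<close>[of 0 y] y by auto
    ultimately have *: "X + y \<le> Z" if "y = 0 \<or> y < Y" for y
      using that by (metis add_right_mono diff_add_cancel_ennreal)
    have X: "X \<le> Z" using *[of 0] by simp
    show ?thesis
    proof (cases "X = top")
      case False
      have "Y \<le> Z - X"
      proof (rule dense_le)
        fix y assume "y < Y" then have "X + y \<le> Z" using * by blast
        then show "y \<le> Z - X" using False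
          by (metis add.commute ennreal_add_diff_cancel_right ennreal_minus_mono infinity_ennreal_def order_refl)
      qed
      then show ?thesis using X by (metis add.commute add_left_mono diff_add_cancel_ennreal)
    qed (use X in \<open>auto simp: top_unique\<close>)
  qed
  show ?thesis
  proof (rule dense)
    fix x y assume x: "x = 0 \<or> x < emeasure lborel A" and y: "y = 0 \<or> y < emeasure lborel B"
    obtain K where K: "compact K" "K \<noteq> {}" "K \<subseteq> A" "x \<le> emeasure lborel K"
      using approx[of A x] assms x by auto
    obtain L where L: "compact L" "L \<noteq> {}" "L \<subseteq> B" "y \<le> emeasure lborel L"
      using approx[of B y] assms y by auto
    have "x + y \<le> emeasure lborel K + emeasure lborel L" using K L by (intro add_mono)
    also have "\<dots> \<le> 2 * emeasure lborel C"
      using K L assms by (intro brunn_minkowski_compact_real) (auto intro!: mid)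
    finally show "x + y \<le> 2 * emeasure lborel C" .
  qed
qed

text \<open>Fubini on the region under the graph. The cap at 1 makes the levels range over one fixed
  interval, so that functions normalised to supremum 1 can be compared level by level.\<close>

lemma nn_integral_layer_cake:
  fixes f :: "real \<Rightarrow> real"
  assumes [measurable]: "f \<in> borel_measurable borel" and f: "\<And>x. 0 \<le> f x" "\<And>x. f x \<le> 1"
  shows "(\<integral>\<^sup>+x. ennreal (f x) \<partial>lborel) = (\<integral>\<^sup>+s. emeasure lborel {x. s < f x} * indicator {0<..<1} s \<partial>lborel)"
proof -
  have "ennreal (f x) = (\<integral>\<^sup>+s. indicator {0<..<1} s * indicator {s. s < f x} s \<partial>lborel)" for x
  proof -
    have "{0<..<1} \<inter> {s. s < f x} = {0<..<f x}" using f(2)[of x] by auto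
    then show ?thesis using f(1)[of x] by (simp add: indicator_inter_arith[symmetric])
  qed
  then have "(\<integral>\<^sup>+x. ennreal (f x) \<partial>lborel) =
    (\<integral>\<^sup>+x. (\<integral>\<^sup>+s. indicator {0<..<1} s * indicator {s. s < f x} s \<partial>lborel) \<partial>lborel)" by simp
  also have "\<dots> = (\<integral>\<^sup>+s. (\<integral>\<^sup>+x. indicator {0<..<1} s * indicator {s. s < f x} s \<partial>lborel) \<partial>lborel)"
    by (rule lborel_pair.Fubini') measurable
  also have "\<dots> = (\<integral>\<^sup>+s. emeasure lborel {x. s < f x} * indicator {0<..<1} s \<partial>lborel)"
  proof (intro nn_integral_cong)
    fix s :: real
    have eq: "indicator {s. s < f x} s = (indicator {x. s < f x} x :: ennreal)" for x
      by (simp split: split_indicator)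
    show "(\<integral>\<^sup>+x. indicator {0<..<1} s * indicator {s. s < f x} s \<partial>lborel) =
       emeasure lborel {x. s < f x} * indicator {0<..<1} s"
      unfolding eq by (subst nn_integral_cmult_indicator) (auto simp: mult.commute)
  qed
  finally show ?thesis .
qed


text \<open>After division by their suprema, \<open>f\<close> and \<open>g\<close> have nonempty
  superlevel sets at every level below 1, and midpoints of these sets lie in the superlevel set of
  the normalised \<open>k\<close>. One-dimensional Brunn-Minkowski at each level and the layer-cake
  formula bound the sum of the two integrals; the arithmetic-geometric mean inequality turns the sum
  into a product.\<close>

theorem prekopa_leindler_real:
  fixes f g k :: "real \<Rightarrow> real"
  assumes [measurable]: "f \<in> borel_measurable borel" "g \<in> borel_measurable borel" "k \<in> borel_measurable borel"
    and f: "\<And>x. 0 \<le> f x" "bdd_above (range f)" and g: "\<And>x. 0 \<le> g x" "bdd_above (range g)"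
    and k: "\<And>x. 0 \<le> k x"
    and fgk: "\<And>x y. f x * g y \<le> (k ((x + y) / 2))\<^sup>2"
  shows "(\<integral>\<^sup>+x. f x \<partial>lborel) * (\<integral>\<^sup>+x. g x \<partial>lborel) \<le> (\<integral>\<^sup>+x. k x \<partial>lborel)\<^sup>2"
proof -
  define F where "F = (SUP x. f x)"
  define G where "G = (SUP x. g x)"
  have fF: "f x \<le> F" for x unfolding F_def using f(2) by (auto intro: cSUP_upper)
  have gG: "g x \<le> G" for x unfolding G_def using g(2) by (auto intro: cSUP_upper)
  show ?thesis
  proof (cases "F > 0 \<and> G > 0")
    case False
    then have "(\<forall>x. f x = 0) \<or> (\<forall>x. g x = 0)"
      using fF gG f(1) g(1) by (metis antisym less_eq_real_def order_trans)
    then show ?thesis by auto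
  next
    case True
    define c where "c = sqrt (F * G)"
    have c: "c > 0" "c\<^sup>2 = F * G" using True by (auto simp: c_def)
    \<comment> \<open>\<open>c\<close> is the geometric mean of the two suprema, so dividing
      \<open>k\<close> by it matches the normalisation of \<open>f\<close> and \<open>g\<close>.
      Truncation at 1 only lowers the integral and leaves the superlevel sets below level 1
      unchanged.\<close>
    define k' where "k' x = min 1 (k x / c)" for x
    have [measurable]: "k' \<in> borel_measurable borel" unfolding k'_def by measurable
    let ?I = "\<lambda>h. \<integral>\<^sup>+x. ennreal (h x) \<partial>lborel"
    have If: "?I f = F * ?I (\<lambda>x. f x / F)"
      using True f by (subst nn_integral_cmult[symmetric]) (auto simp: ennreal_mult[symmetric])
    have Ig: "?I g = G * ?I (\<lambda>x. g x / G)"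
      using True g by (subst nn_integral_cmult[symmetric]) (auto simp: ennreal_mult[symmetric])
    have Ik: "c * ?I k' \<le> ?I k"
      using c k by (subst nn_integral_cmult[symmetric])
        (auto simp: ennreal_mult[symmetric] k'_def min_def field_simps intro!: nn_integral_mono ennreal_leI)
    have main: "?I (\<lambda>x. f x / F) + ?I (\<lambda>x. g x / G) \<le> 2 * ?I k'"
    proof -
      have "?I (\<lambda>x. f x / F) + ?I (\<lambda>x. g x / G) =
        (\<integral>\<^sup>+s. emeasure lborel {x. s < f x / F} * indicator {0<..<1} s \<partial>lborel) +
        (\<integral>\<^sup>+s. emeasure lborel {x. s < g x / G} * indicator {0<..<1} s \<partial>lborel)"
        using True f(1) g(1) fF gG by (subst (1 2) nn_integral_layer_cake) auto
      also have "\<dots> = (\<integral>\<^sup>+s. emeasure lborel {x. s < f x / F} * indicator {0<..<1} s +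
         emeasure lborel {x. s < g x / G} * indicator {0<..<1} s \<partial>lborel)"
        by (subst nn_integral_add) auto
      also have "\<dots> \<le> (\<integral>\<^sup>+s. 2 * (emeasure lborel {x. s < k' x} * indicator {0<..<1} s) \<partial>lborel)"
      proof (rule nn_integral_mono)
        fix s :: real
        show "emeasure lborel {x. s < f x / F} * indicator {0<..<1} s +
           emeasure lborel {x. s < g x / G} * indicator {0<..<1} s
          \<le> 2 * (emeasure lborel {x. s < k' x} * indicator {0<..<1} s)"
        proof (cases "s \<in> {0<..<1}")
          case s: True
          have ne: "{x. s < f x / F} \<noteq> {}" "{x. s < g x / G} \<noteq> {}"
          proof -
            have "s * F < F" "s * G < G" using s True by auto
            then show "{x. s < f x / F} \<noteq> {}" "{x. s < g x / G} \<noteq> {}"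
              using True unfolding F_def G_def
              by (auto simp: less_cSUP_iff f g pos_less_divide_eq mult.commute)
          qed
          have "emeasure lborel {x. s < f x / F} + emeasure lborel {x. s < g x / G}
            \<le> 2 * emeasure lborel {x. s < k' x}"
          proof (rule brunn_minkowski_real[OF _ _ ne])
            fix a b assume "a \<in> {x. s < f x / F}" "b \<in> {x. s < g x / G}"
            then have ab: "s * F < f a" "s * G < g b" using True by (auto simp: field_simps)
            have "(s * c)\<^sup>2 = (s * F) * (s * G)" using c by (simp add: power_mult_distrib power2_eq_square)
            also have "\<dots> < f a * g b"
            proof (intro mult_strict_mono)
              have "0 < s * F" "0 < s * G" using s True by auto
              then show "0 < f a" "0 \<le> s * G" using ab by linarith+
            qed fact+
            also have "\<dots> \<le> (k ((a + b) / 2))\<^sup>2" by (rule fgk)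
            finally have "s * c < k ((a + b) / 2)" using k power_less_imp_less_base by blast
            then show "(a + b) / 2 \<in> {x. s < k' x}" using c s by (auto simp: k'_def field_simps)
          qed measurable
          then show ?thesis using s by simp
        qed auto
      qed
      also have "\<dots> = 2 * ?I k'"
        using c k by (subst nn_integral_layer_cake) (auto simp: k'_def nn_integral_cmult)
      finally show ?thesis .
    qed
    have amgm: "a * b \<le> z\<^sup>2" if "a + b \<le> 2 * z" for a b z :: ennreal
    proof (cases "z = top")
      case True then show ?thesis by (simp add: power2_eq_square)
    next
      case False
      then obtain z' where z: "z = ennreal z'" "0 \<le> z'" by (cases z) auto
      have "2 * z < top" using z by (simp add: ennreal_mult_less_top)
      then have "a < top" "b < top" using that by (auto simp: top.not_eq_extremum[symmetric] top_unique)
      then obtain a' b' where ab: "a = ennreal a'" "0 \<le> a'" "b = ennreal b'" "0 \<le> b'"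
        by (metis enn2real_nonneg ennreal_enn2real)
      have le: "a' + b' \<le> 2 * z'" using that z ab
        by (simp add: ennreal_plus[symmetric] ennreal_mult[symmetric] ennreal_numeral[symmetric]
          del: ennreal_plus ennreal_numeral)
      have "4 * (a' * b') \<le> (a' + b')\<^sup>2" using sum_squares_bound[of a' b'] by (simp add: power2_sum)
      also have "\<dots> \<le> (2 * z')\<^sup>2" using le ab by (intro power_mono) auto
      finally have "a' * b' \<le> z'\<^sup>2" by (simp add: power_mult_distrib)
      then show ?thesis using z ab by (simp add: ennreal_mult[symmetric] ennreal_power ennreal_leI)
    qed
    have "?I f * ?I g = ennreal (F * G) * (?I (\<lambda>x. f x / F) * ?I (\<lambda>x. g x / G))"
      unfolding If Ig using True by (simp add: ennreal_mult mult_ac)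
    also have "\<dots> \<le> ennreal (F * G) * (?I k')\<^sup>2"
      by (intro mult_left_mono amgm main) auto
    also have "\<dots> = (c * ?I k')\<^sup>2"
      using c by (simp add: power_mult_distrib ennreal_power)
    also have "\<dots> \<le> (?I k)\<^sup>2" using Ik by (intro power_mono) auto
    finally show ?thesis .
  qed
qed

section \<open>Moments on the half-line in logarithmic coordinates\<close>

lemma nn_integral_exp_substitution:
  fixes f :: "real \<Rightarrow> ennreal"
  assumes [measurable]: "f \<in> borel_measurable borel"
  shows "(\<integral>\<^sup>+x. f x * indicator {0<..} x \<partial>lborel) = (\<integral>\<^sup>+t. f (exp t) * exp t \<partial>lborel)"
proof -
  \<comment> \<open>The shift by one keeps the interval nondegenerate also for
    \<open>n = 0\<close>.\<close>
  let ?n = "\<lambda>n::nat. real n + 1"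
  have fin: "(\<integral>\<^sup>+x. f x * indicator {exp (- ?n n)..exp (?n n)} x \<partial>lborel) =
     (\<integral>\<^sup>+t. f (exp t) * exp t * indicator {- ?n n..?n n} t \<partial>lborel)" for n
    by (rule nn_integral_substitution_aux) (auto intro!: derivative_eq_intros continuous_intros)
  have "(\<integral>\<^sup>+x. f x * indicator {0<..} x \<partial>lborel) =
    (\<integral>\<^sup>+x. (SUP n. f x * indicator {exp (- ?n n)..exp (?n n)} x) \<partial>lborel)"
  proof (intro nn_integral_cong)
    fix x :: real
    show "f x * indicator {0<..} x = (SUP n. f x * indicator {exp (- ?n n)..exp (?n n)} x)"
    proof (cases "x > 0")
      case True
      obtain m where m: "\<bar>ln x\<bar> \<le> real m" using real_arch_simple by blast
      have "x \<in> {exp (- ?n m)..exp (?n m)}" using m True by (auto simp: ln_ge_iff[symmetric] abs_le_iff)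
          (metis True abs_le_iff exp_le_cancel_iff exp_ln m minus_le_iff neg_le_iff_le order_trans less_add_one less_imp_le)+
      then have "f x * indicator {0<..} x \<le> (SUP n. f x * indicator {exp (- ?n n)..exp (?n n)} x)"
        using True by (intro SUP_upper2[of m]) auto
      moreover have "(SUP n. f x * indicator {exp (- ?n n)..exp (?n n)} x) \<le> f x * indicator {0<..} x"
        using True by (intro SUP_least) (auto split: split_indicator)
      ultimately show ?thesis by (rule antisym)
    next
      case False
      then have "x \<notin> {exp (- ?n n)..exp (?n n)}" for n
        by (auto simp: not_le intro: less_le_trans[OF _ less_imp_le] order.strict_trans1[of x 0])
      then show ?thesis using False by simp
    qed
  qed
  also have "\<dots> = (SUP n. \<integral>\<^sup>+x. f x * indicator {exp (- ?n n)..exp (?n n)} x \<partial>lborel)"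
  proof (rule nn_integral_monotone_convergence_SUP)
    have "{exp (- ?n m)..exp (?n m)} \<subseteq> {exp (- ?n n)..exp (?n n)}" if "m \<le> n" for m n
      using that by (intro atLeastatMost_subset_iff[THEN iffD2]) simp
    then show "incseq (\<lambda>n x. f x * indicator {exp (- ?n n)..exp (?n n)} x)"
      by (auto simp: incseq_def le_fun_def simp del: atLeastAtMost_iff atLeastatMost_subset_iff
          intro!: mult_left_mono indicator_leI)
  qed measurable
  also have "\<dots> = (SUP n. \<integral>\<^sup>+t. f (exp t) * exp t * indicator {- ?n n..?n n} t \<partial>lborel)"
    by (simp only: fin)
  also have "\<dots> = (\<integral>\<^sup>+t. (SUP n. f (exp t) * exp t * indicator {- ?n n..?n n} t) \<partial>lborel)"
    by (rule nn_integral_monotone_convergence_SUP[symmetric])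
       (auto simp: incseq_def le_fun_def split: split_indicator intro: order_trans)
  also have "\<dots> = (\<integral>\<^sup>+t. f (exp t) * exp t \<partial>lborel)"
  proof (intro nn_integral_cong antisym)
    fix t :: real
    show "(SUP n. f (exp t) * exp t * indicator {- ?n n..?n n} t) \<le> f (exp t) * exp t"
      by (intro SUP_least) (auto split: split_indicator)
    obtain m where m: "\<bar>t\<bar> \<le> real m" using real_arch_simple by blast
    then have "t \<in> {- ?n m..?n m}" by (auto simp: abs_le_iff)
    then show "f (exp t) * exp t \<le> (SUP n. f (exp t) * exp t * indicator {- ?n n..?n n} t)"
      by (intro SUP_upper2[of m]) auto
  qed
  finally show ?thesis .
qed

lemma has_integral_disc_moment:
  "((\<lambda>r::real. r\<^sup>2 * sqrt (1 - r\<^sup>2)) has_integral pi / 16) {0..1}"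
proof -
  \<comment> \<open>With \<open>r = sin t\<close> the integrand becomes sin^2 t cos^2 t = (1 - cos
    4t)/8, with primitive (t - (sin 4t)/4)/8; this is \<open>G\<close> written back in
    \<open>r\<close>. The square root is not differentiable at 1, so the derivative is taken in the
    interior only.\<close>
  define G where "G r = (arcsin r - r * sqrt (1 - r\<^sup>2) * (1 - 2 * r\<^sup>2)) / 8" for r :: real
  have "((\<lambda>r::real. r\<^sup>2 * sqrt (1 - r\<^sup>2)) has_integral (G 1 - G 0)) {0..1}"
  proof (rule fundamental_theorem_of_calculus_interior)
    show "continuous_on {0..1} G" unfolding G_def
      by (intro continuous_intros) auto
    fix r :: real assume r: "r \<in> {0<..<1}"
    then have pos: "1 - r\<^sup>2 > 0" by (simp add: power_less_one_iff)
    define s where "s = sqrt (1 - r\<^sup>2)"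
    have s: "s > 0" "s\<^sup>2 = 1 - r\<^sup>2" using pos by (auto simp: s_def)
    have "(G has_real_derivative r\<^sup>2 * sqrt (1 - r\<^sup>2)) (at r)"
      unfolding G_def
      apply (rule derivative_eq_intros refl | use r pos in \<open>simp; fail\<close>)+
      apply (fold s_def)
      using s(1) apply (simp add: field_simps)
      using s(2) apply algebra
      done
    then show "(G has_vector_derivative r\<^sup>2 * sqrt (1 - r\<^sup>2)) (at r)"
      by (simp add: has_real_derivative_iff_has_vector_derivative)
  qed simp
  then show ?thesis by (simp add: G_def)
qed

text \<open>The duality bounds \<open>d t * W l\<close> by \<open>2 * (1 - t * l)\<close>, which
  depends on the product \<open>t * l\<close> alone. In logarithmic coordinates this is a function
  of the midpoint, as Prekopa-Leindler wants. The constant is attained by the profiles of the unit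
  disc, sqrt(1 - 4 t^2) for \<open>d\<close> and sqrt(4 - l^2) for \<open>W\<close>, which become
  translates of one another up to a factor.\<close>

lemma moment_product_bound:
  fixes d W :: "real \<Rightarrow> real"
  assumes [measurable]: "d \<in> borel_measurable borel" "W \<in> borel_measurable borel"
    and nonneg: "\<And>t. 0 \<le> d t" "\<And>t. 0 \<le> W t"
    and dual: "\<And>t l. 0 < t \<Longrightarrow> 0 < l \<Longrightarrow> 0 < d t \<Longrightarrow> 0 < W l \<Longrightarrow> d t * W l + 2 * t * l \<le> 2"
  shows "(\<integral>\<^sup>+t. ennreal (t\<^sup>2 * d t) * indicator {0<..} t \<partial>lborel) *
     (\<integral>\<^sup>+l. ennreal (l\<^sup>2 * W l) * indicator {0<..} l \<partial>lborel) \<le> ennreal (pi\<^sup>2 / 128)"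
proof -
  let ?I = "\<lambda>d :: real \<Rightarrow> real. \<integral>\<^sup>+t. ennreal (t\<^sup>2 * d t) * indicator {0<..} t \<partial>lborel"
  \<comment> \<open>Two of the three powers of \<open>exp a\<close> are the moment weight, the third
    is the Jacobian of the substitution.\<close>
  define F where "F d a = exp a ^ 3 * d (exp a)" for d :: "real \<Rightarrow> real" and a
  have subst: "?I d = (\<integral>\<^sup>+a. ennreal (F d a) \<partial>lborel)"
    if [measurable]: "d \<in> borel_measurable borel" and "\<And>t. 0 \<le> d t" for d
    using that(2) unfolding F_def
    by (subst nn_integral_exp_substitution)
       (auto simp: ennreal_mult[symmetric] power2_eq_square power3_eq_cube mult_ac intro!: nn_integral_cong)
  \<comment> \<open>A single point \<open>l\<close> where \<open>W\<close> is positive bounds,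
    through the duality, both the values of \<open>d\<close> and the positive \<open>t\<close> at
    which \<open>d\<close> is positive.\<close>
  have bdd: "bdd_above (range (F d))"
    if nn: "\<And>t. 0 \<le> d t" and l: "0 < l" "0 < W l"
    and dual: "\<And>t. 0 < t \<Longrightarrow> 0 < d t \<Longrightarrow> d t * W l + 2 * t * l \<le> 2" for d W :: "real \<Rightarrow> real" and l
  proof (rule bdd_aboveI2)
    fix a
    show "F d a \<le> (1 / l) ^ 3 * (2 / W l)"
    proof (cases "d (exp a) > 0")
      case True
      have *: "d (exp a) * W l + 2 * exp a * l \<le> 2" using dual[OF _ True] by simp
      have "0 \<le> d (exp a) * W l" "0 \<le> 2 * exp a * l" using l nn by auto
      then have "d (exp a) * W l \<le> 2" "exp a * l \<le> 1" using * by linarith+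
      then show ?thesis unfolding F_def using l nn by (intro mult_mono power_mono) (auto simp: field_simps)
    next
      case False
      then have "d (exp a) = 0" using nn[of "exp a"] by simp
      then show ?thesis using l by (simp add: F_def)
    qed
  qed
  \<comment> \<open>With \<open>r\<^sup>2 = t * l\<close>, the square of \<open>k0 r\<close> is the
    bound \<open>2 * (1 - t * l)\<close> times the moment weights \<open>(t * l)\<^sup>2\<close>.
    The maximum with 0 reflects that \<open>d t * W l\<close> vanishes once \<open>t * l\<close>
    exceeds 1.\<close>
  define k0 where "k0 r = r\<^sup>2 * sqrt (2 * max 0 (1 - r\<^sup>2))" for r :: real
  define k where "k c = exp c * k0 (exp c)" for c :: real
  have [measurable]: "k0 \<in> borel_measurable borel" unfolding k0_def by measurable
  have [measurable]: "k \<in> borel_measurable borel" unfolding k_def by measurable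
  have "(\<integral>\<^sup>+c. ennreal (k c) \<partial>lborel) = (\<integral>\<^sup>+r. ennreal (k0 r) * indicator {0<..} r \<partial>lborel)"
    unfolding k_def by (subst nn_integral_exp_substitution)
      (auto simp: ennreal_mult[symmetric] k0_def mult_ac intro!: nn_integral_cong)
  also have "\<dots> = (\<integral>\<^sup>+r. ennreal (sqrt 2) * ennreal (indicator {0..1} r * (r\<^sup>2 * sqrt (1 - r\<^sup>2))) \<partial>lborel)"
  proof (intro nn_integral_cong)
    fix r :: real
    consider "r < 0" | "r = 0" | "0 < r" "r \<le> 1" | "1 < r" by linarith
    then show "ennreal (k0 r) * indicator {0<..} r =
      ennreal (sqrt 2) * ennreal (indicator {0..1} r * (r\<^sup>2 * sqrt (1 - r\<^sup>2)))"
    proof cases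
      case 3
      then have "r\<^sup>2 \<le> 1" by (simp add: power_le_one)
      moreover have "sqrt (2 * (1 - r\<^sup>2)) = sqrt 2 * sqrt (1 - r\<^sup>2)" by (rule real_sqrt_mult)
      ultimately show ?thesis using 3 by (simp add: k0_def ennreal_mult[symmetric] mult_ac)
    next
      case 4
      then have "1 < r\<^sup>2" by (simp add: one_less_power)
      then show ?thesis using 4 by (simp add: k0_def)
    qed auto
  qed
  also have "\<dots> = ennreal (sqrt 2) * ennreal (pi / 16)"
  proof (subst nn_integral_cmult)
    have "(\<integral>\<^sup>+r. ennreal (indicator {0..1} r * (r\<^sup>2 * sqrt (1 - r\<^sup>2))) \<partial>lborel) = ennreal (pi / 16)"
      by (rule nn_integral_has_integral_lebesgue[OF _ has_integral_disc_moment]) (auto simp: power_le_one)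
    then show "ennreal (sqrt 2) * (\<integral>\<^sup>+r. ennreal (indicator {0..1} r * (r\<^sup>2 * sqrt (1 - r\<^sup>2))) \<partial>lborel)
      = ennreal (sqrt 2) * ennreal (pi / 16)" by simp
  qed measurable
  finally have Ik: "(\<integral>\<^sup>+c. ennreal (k c) \<partial>lborel) = ennreal (sqrt 2 * (pi / 16))"
    by (simp add: ennreal_mult[symmetric])
  show ?thesis
  proof (cases "(\<exists>t>0. d t > 0) \<and> (\<exists>l>0. W l > 0)")
    case False
    then have "(\<forall>t>0. d t = 0) \<or> (\<forall>l>0. W l = 0)" using nonneg by (metis less_eq_real_def)
    moreover have "?I h = 0" if "\<forall>t>0. h t = 0" for h
    proof -
      have "?I h = (\<integral>\<^sup>+(t::real). 0 \<partial>lborel)" by (rule nn_integral_cong) (use that in \<open>auto split: split_indicator\<close>)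
      then show ?thesis by simp
    qed
    ultimately have "?I d = 0 \<or> ?I W = 0" by blast
    then show ?thesis by auto
  next
    case True
    then obtain t0 l0 where tl: "0 < t0" "0 < d t0" "0 < l0" "0 < W l0" by blast
    have "(\<integral>\<^sup>+a. ennreal (F d a) \<partial>lborel) * (\<integral>\<^sup>+a. ennreal (F W a) \<partial>lborel) \<le> (\<integral>\<^sup>+c. ennreal (k c) \<partial>lborel)\<^sup>2"
    proof (rule prekopa_leindler_real)
      show "F d \<in> borel_measurable borel" "F W \<in> borel_measurable borel" unfolding F_def by measurable
      show "bdd_above (range (F d))" by (rule bdd[of d l0 W]) (use nonneg tl dual in auto)
      show "bdd_above (range (F W))" by (rule bdd[of W t0 d]) (use nonneg tl dual[of t0] in \<open>auto simp: mult_ac\<close>)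
      show "0 \<le> F d a" "0 \<le> F W a" "0 \<le> k a" for a using nonneg by (auto simp: F_def k_def k0_def)
      fix a b :: real
      define c where "c = (a + b) / 2"
      have ab: "exp a * exp b = (exp c)\<^sup>2" by (simp add: c_def exp_add[symmetric] power2_eq_square)
      have k2: "(k c)\<^sup>2 = (exp a * exp b) ^ 3 * (2 * max 0 (1 - exp a * exp b))"
        unfolding ab k_def k0_def by (simp add: power_mult_distrib power2_eq_square power3_eq_cube mult_ac)
      have "F d a * F W b = (exp a * exp b) ^ 3 * (d (exp a) * W (exp b))"
        by (simp add: F_def power_mult_distrib)
      also have "\<dots> \<le> (exp a * exp b) ^ 3 * (2 * max 0 (1 - exp a * exp b))"
      proof (intro mult_left_mono)
        show "d (exp a) * W (exp b) \<le> 2 * max 0 (1 - exp a * exp b)"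
        proof (cases "0 < d (exp a) \<and> 0 < W (exp b)")
          case True
          then show ?thesis using dual[of "exp a" "exp b"] by (simp add: max_def algebra_simps)
        next
          case False
          then have "d (exp a) = 0 \<or> W (exp b) = 0" using nonneg by (metis less_eq_real_def)
          then show ?thesis by auto
        qed
      qed simp
      also have "\<dots> = (k ((a + b) / 2))\<^sup>2" using k2 by (simp add: c_def)
      finally show "F d a * F W b \<le> (k ((a + b) / 2))\<^sup>2" .
    qed measurable
    then have "?I d * ?I W \<le> (ennreal (sqrt 2 * (pi / 16)))\<^sup>2"
      using subst[of d] subst[of W] nonneg Ik by simp
    also have "\<dots> = ennreal (pi\<^sup>2 / 128)" by (simp add: ennreal_power power_mult_distrib power_divide)
    finally show ?thesis .
  qed
qed

section \<open>Radial comparison in the plane\<close>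

lemma nn_integral_scale_prod:
  fixes f :: "real \<times> real \<Rightarrow> ennreal"
  assumes [measurable]: "f \<in> borel_measurable borel" and c: "c > 0"
  shows "(\<integral>\<^sup>+v. f v \<partial>lborel) = ennreal (c\<^sup>2) * (\<integral>\<^sup>+v. f (c *\<^sub>R v) \<partial>lborel)"
  using c by (subst lborel_affine[of c 0])
    (auto simp: nn_integral_density nn_integral_distr nn_integral_cmult power2_eq_square)

text \<open>Polar coordinates without a measure on the circle: the rays are averaged over base
  points \<open>v\<close> outside the unit disc with weight |v|^-3. Replacing \<open>v\<close> by
  \<open>v / l\<close> moves the weight to a function of \<open>l\<close>, namely l^2/|v|^3 on the
  interval from 0 to |v|, whose integral is 1/3 for every nonzero \<open>v\<close>. Since the weight
  is nonnegative, a comparison of first moments on each ray passes to the full integrals.\<close>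

lemma radial_integral_representation:
  fixes g :: "real \<times> real \<Rightarrow> ennreal"
  assumes [measurable]: "g \<in> borel_measurable borel"
  shows "(\<integral>\<^sup>+v. ennreal (indicator {1..} (norm v) / norm v ^ 3) *
      (\<integral>\<^sup>+l. ennreal l * g (l *\<^sub>R v) * indicator {0<..} l \<partial>lborel) \<partial>lborel)
     = ennreal (1/3) * (\<integral>\<^sup>+v. g v \<partial>lborel)"
proof -
  let ?e = "\<lambda>v::real\<times>real. ennreal (indicator {1..} (norm v) / norm v ^ 3)"
  have "(\<integral>\<^sup>+v. ?e v * (\<integral>\<^sup>+l. ennreal l * g (l *\<^sub>R v) * indicator {0<..} l \<partial>lborel) \<partial>lborel) =
    (\<integral>\<^sup>+v. (\<integral>\<^sup>+l. ?e v * (ennreal l * g (l *\<^sub>R v) * indicator {0<..} l) \<partial>lborel) \<partial>lborel)"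
    by (intro nn_integral_cong nn_integral_cmult[symmetric]) measurable
  also have "\<dots> = (\<integral>\<^sup>+l. (\<integral>\<^sup>+v. ?e v * (ennreal l * g (l *\<^sub>R v) * indicator {0<..} l) \<partial>lborel) \<partial>lborel)"
    by (rule lborel_pair.Fubini') measurable
  also have "\<dots> = (\<integral>\<^sup>+l. (\<integral>\<^sup>+v. ?e (v /\<^sub>R l) * (ennreal (1 / l) * g v * indicator {0<..} l) \<partial>lborel) \<partial>lborel)"
  proof (rule nn_integral_cong)
    fix l :: real
    show "(\<integral>\<^sup>+v. ?e v * (ennreal l * g (l *\<^sub>R v) * indicator {0<..} l) \<partial>lborel) =
      (\<integral>\<^sup>+v. ?e (v /\<^sub>R l) * (ennreal (1 / l) * g v * indicator {0<..} l) \<partial>lborel)"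
    proof (cases "l > 0")
      case True
      have "(\<integral>\<^sup>+v. ?e (v /\<^sub>R l) * (ennreal (1 / l) * g v * indicator {0<..} l) \<partial>lborel) =
         ennreal (l\<^sup>2) * (\<integral>\<^sup>+v. ?e v * (ennreal (1 / l) * g (l *\<^sub>R v)) \<partial>lborel)"
        using True by (subst nn_integral_scale_prod[OF _ True]) auto
      also have "\<dots> = (\<integral>\<^sup>+v. ennreal (l\<^sup>2) * (?e v * (ennreal (1 / l) * g (l *\<^sub>R v))) \<partial>lborel)"
        by (rule nn_integral_cmult[symmetric]) measurable
      also have "\<dots> = (\<integral>\<^sup>+v. ?e v * (ennreal l * g (l *\<^sub>R v) * indicator {0<..} l) \<partial>lborel)"
      proof (intro nn_integral_cong)
        fix v :: "real \<times> real"
        have "ennreal l = ennreal (l\<^sup>2) * ennreal (1 / l)"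
          using True by (simp add: ennreal_mult[symmetric] power2_eq_square)
        then show "ennreal (l\<^sup>2) * (?e v * (ennreal (1 / l) * g (l *\<^sub>R v))) =
          ?e v * (ennreal l * g (l *\<^sub>R v) * indicator {0<..} l)"
          using True by (simp add: mult_ac)
      qed
      finally show ?thesis by (rule sym)
    next
      case False
      then show ?thesis by simp
    qed
  qed
  also have "\<dots> = (\<integral>\<^sup>+v. (\<integral>\<^sup>+l. ?e (v /\<^sub>R l) * (ennreal (1 / l) * g v * indicator {0<..} l) \<partial>lborel) \<partial>lborel)"
    by (rule lborel_pair.Fubini') measurable
  also have "\<dots> = (\<integral>\<^sup>+v. ennreal (1/3) * g v \<partial>lborel)"
  proof (rule nn_integral_cong_AE)
    have "AE v in lborel. v \<noteq> (0::real\<times>real)" by (rule AE_lborel_singleton)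
    then show "AE v in lborel. (\<integral>\<^sup>+l. ?e (v /\<^sub>R l) * (ennreal (1 / l) * g v * indicator {0<..} l) \<partial>lborel) = ennreal (1/3) * g v"
    proof eventually_elim
      case v: (elim v)
      have "(\<integral>\<^sup>+l. ?e (v /\<^sub>R l) * (ennreal (1 / l) * g v * indicator {0<..} l) \<partial>lborel) =
         (\<integral>\<^sup>+l. (ennreal (l\<^sup>2 / norm v ^ 3) * indicator {0..norm v} l) * g v \<partial>lborel)"
      proof (intro nn_integral_cong)
        fix l :: real
        show "?e (v /\<^sub>R l) * (ennreal (1 / l) * g v * indicator {0<..} l) =
          (ennreal (l\<^sup>2 / norm v ^ 3) * indicator {0..norm v} l) * g v"
        proof (cases "l > 0 \<and> l \<le> norm v")
          case True
          then have "?e (v /\<^sub>R l) * ennreal (1 / l) = ennreal (l\<^sup>2 / norm v ^ 3)"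
            using v by (subst ennreal_mult[symmetric]) (auto simp: field_simps power2_eq_square power3_eq_cube)
          then show ?thesis using True by (simp add: mult.assoc[symmetric])
        next
          case False
          then show ?thesis by (cases "l = 0") (auto simp: field_simps split: split_indicator)
        qed
      qed
      also have "\<dots> = (\<integral>\<^sup>+l. ennreal (l\<^sup>2 / norm v ^ 3) * indicator {0..norm v} l \<partial>lborel) * g v"
        by (rule nn_integral_multc) measurable
      also have "(\<integral>\<^sup>+l. ennreal (l\<^sup>2 / norm v ^ 3) * indicator {0..norm v} l \<partial>lborel) =
         ennreal ((norm v)^3 / (3 * norm v ^ 3) - 0^3 / (3 * norm v ^ 3))"
      proof (intro nn_integral_FTC_Icc)
        define c where "c = norm v ^ 3"
        have "c \<noteq> 0" using v by (simp add: c_def)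
        then have "((\<lambda>l. l ^ 3 / (3 * c)) has_real_derivative l\<^sup>2 / c) (at l)" for l
          by (auto intro!: derivative_eq_intros simp: field_simps)
        then show "((\<lambda>l. l ^ 3 / (3 * norm v ^ 3)) has_real_derivative l\<^sup>2 / norm v ^ 3) (at l)" for l
          by (simp add: c_def)
      qed auto
      finally show "(\<integral>\<^sup>+l. ?e (v /\<^sub>R l) * (ennreal (1 / l) * g v * indicator {0<..} l) \<partial>lborel) = ennreal (1/3) * g v"
        using v by simp
    qed
  qed
  also have "\<dots> = ennreal (1/3) * (\<integral>\<^sup>+v. g v \<partial>lborel)" by (rule nn_integral_cmult) measurable
  finally show ?thesis .
qed

lemma radial_comparison:
  fixes g k :: "real \<times> real \<Rightarrow> ennreal"
  assumes [measurable]: "g \<in> borel_measurable borel" "k \<in> borel_measurable borel"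
    and le: "\<And>v. v \<noteq> 0 \<Longrightarrow> (\<integral>\<^sup>+l. ennreal l * g (l *\<^sub>R v) * indicator {0<..} l \<partial>lborel)
       \<le> (\<integral>\<^sup>+l. ennreal l * k (l *\<^sub>R v) * indicator {0<..} l \<partial>lborel)"
  shows "(\<integral>\<^sup>+v. g v \<partial>lborel) \<le> (\<integral>\<^sup>+v. k v \<partial>lborel)"
proof -
  have "ennreal (1/3) * (\<integral>\<^sup>+v. g v \<partial>lborel) \<le> ennreal (1/3) * (\<integral>\<^sup>+v. k v \<partial>lborel)"
    unfolding radial_integral_representation[symmetric, OF assms(1)] radial_integral_representation[symmetric, OF assms(2)]
  proof (intro nn_integral_mono)
    fix v :: "real \<times> real"
    show "ennreal (indicator {1..} (norm v) / norm v ^ 3) * (\<integral>\<^sup>+l. ennreal l * g (l *\<^sub>R v) * indicator {0<..} l \<partial>lborel)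
     \<le> ennreal (indicator {1..} (norm v) / norm v ^ 3) * (\<integral>\<^sup>+l. ennreal l * k (l *\<^sub>R v) * indicator {0<..} l \<partial>lborel)"
      by (cases "v = 0") (auto intro!: mult_left_mono le)
  qed
  then have "ennreal 3 * (ennreal (1/3) * (\<integral>\<^sup>+v. g v \<partial>lborel)) \<le> ennreal 3 * (ennreal (1/3) * (\<integral>\<^sup>+v. k v \<partial>lborel))"
    by (rule mult_left_mono) auto
  moreover have "ennreal 3 * ennreal (1/3) = 1" by (subst ennreal_mult[symmetric]) auto
  ultimately show ?thesis by (simp only: mult.assoc[symmetric] mult_1)
qed


section \<open>Rotations and shears of the plane\<close>

lemma borel_measurable_fst_snd [measurable]:
  "(fst :: 'a::topological_space \<times> 'b::topological_space \<Rightarrow> 'a) \<in> borel_measurable borel"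
  "(snd :: 'a::topological_space \<times> 'b::topological_space \<Rightarrow> 'b) \<in> borel_measurable borel"
  by (auto intro!: borel_measurable_continuous_onI continuous_intros)

lemma nn_integral_lborel_Pair:
  fixes f :: "'a::euclidean_space \<times> 'b::euclidean_space \<Rightarrow> ennreal"
  assumes "f \<in> borel_measurable borel"
  shows "(\<integral>\<^sup>+v. f v \<partial>lborel) = (\<integral>\<^sup>+x. (\<integral>\<^sup>+y. f (x, y) \<partial>lborel) \<partial>lborel)"
    and "(\<integral>\<^sup>+v. f v \<partial>lborel) = (\<integral>\<^sup>+y. (\<integral>\<^sup>+x. f (x, y) \<partial>lborel) \<partial>lborel)"
proof -
  have f: "f \<in> borel_measurable (lborel \<Otimes>\<^sub>M lborel)" using assms by (simp add: lborel_prod)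
  show "(\<integral>\<^sup>+v. f v \<partial>lborel) = (\<integral>\<^sup>+x. (\<integral>\<^sup>+y. f (x, y) \<partial>lborel) \<partial>lborel)"
    using lborel.nn_integral_fst[OF f] by (simp add: lborel_prod)
  show "(\<integral>\<^sup>+v. f v \<partial>lborel) = (\<integral>\<^sup>+y. (\<integral>\<^sup>+x. f (x, y) \<partial>lborel) \<partial>lborel)"
    using lborel_pair.nn_integral_snd[OF f] by (simp add: lborel_prod)
qed

lemma nn_integral_translate_real:
  fixes f :: "real \<Rightarrow> ennreal"
  assumes "f \<in> borel_measurable borel"
  shows "(\<integral>\<^sup>+x. f (t + x) \<partial>lborel) = (\<integral>\<^sup>+x. f x \<partial>lborel)"
  using nn_integral_real_affine[OF assms, of 1 t] by simp

lemma nn_integral_shear1: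
  fixes f :: "real \<times> real \<Rightarrow> ennreal"
  assumes [measurable]: "f \<in> borel_measurable borel"
  shows "(\<integral>\<^sup>+v. f (k * snd v + fst v, snd v) \<partial>lborel) = (\<integral>\<^sup>+v. f v \<partial>lborel)"
proof -
  have "(\<integral>\<^sup>+v. f (k * snd v + fst v, snd v) \<partial>lborel) = (\<integral>\<^sup>+y. (\<integral>\<^sup>+x. f (k * y + x, y) \<partial>lborel) \<partial>lborel)"
    by (subst nn_integral_lborel_Pair(2)) auto
  also have "\<dots> = (\<integral>\<^sup>+y. (\<integral>\<^sup>+x. f (x, y) \<partial>lborel) \<partial>lborel)"
    by (intro nn_integral_cong nn_integral_translate_real) measurable
  also have "\<dots> = (\<integral>\<^sup>+v. f v \<partial>lborel)" by (subst nn_integral_lborel_Pair(2)) auto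
  finally show ?thesis .
qed

lemma nn_integral_shear2:
  fixes f :: "real \<times> real \<Rightarrow> ennreal"
  assumes [measurable]: "f \<in> borel_measurable borel"
  shows "(\<integral>\<^sup>+v. f (fst v, k * fst v + snd v) \<partial>lborel) = (\<integral>\<^sup>+v. f v \<partial>lborel)"
proof -
  have "(\<integral>\<^sup>+v. f (fst v, k * fst v + snd v) \<partial>lborel) = (\<integral>\<^sup>+x. (\<integral>\<^sup>+y. f (x, k * x + y) \<partial>lborel) \<partial>lborel)"
    by (subst nn_integral_lborel_Pair(1)) auto
  also have "\<dots> = (\<integral>\<^sup>+x. (\<integral>\<^sup>+y. f (x, y) \<partial>lborel) \<partial>lborel)"
    by (intro nn_integral_cong nn_integral_translate_real) measurable
  also have "\<dots> = (\<integral>\<^sup>+v. f v \<partial>lborel)" by (subst nn_integral_lborel_Pair(1)) auto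
  finally show ?thesis .
qed

definition rot2 :: "real \<Rightarrow> real \<Rightarrow> real \<times> real \<Rightarrow> real \<times> real" where
  "rot2 c s v = (c * fst v - s * snd v, s * fst v + c * snd v)"

lemma measurable_rot2 [measurable]: "rot2 c s \<in> borel_measurable borel"
  unfolding rot2_def by measurable

text \<open>A rotation is a product of three shears.\<close>

lemma nn_integral_rot2:
  fixes f :: "real \<times> real \<Rightarrow> ennreal"
  assumes f[measurable]: "f \<in> borel_measurable borel" and cs: "c\<^sup>2 + s\<^sup>2 = 1"
  shows "(\<integral>\<^sup>+v. f (rot2 c s v) \<partial>lborel) = (\<integral>\<^sup>+v. f v \<partial>lborel)"
proof (cases "s = 0")
  case True
  then have "c = 1 \<or> c = -1" using cs by (simp add: power2_eq_1_iff)
  then show ?thesis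
  proof
    assume "c = -1"
    have "(\<integral>\<^sup>+v. f v \<partial>lborel) = (\<integral>\<^sup>+v. f (- v) \<partial>lborel)"
      by (subst lborel_affine[of "-1" 0]) (auto simp: nn_integral_density nn_integral_distr)
    moreover have "rot2 c s v = - v" for v by (cases v) (simp add: rot2_def True \<open>c = -1\<close>)
    ultimately show ?thesis by simp
  qed (simp add: rot2_def True)
next
  case False
  \<comment> \<open>\<open>k\<close> is minus the tangent of half the rotation angle; the outer two
    shears have slope \<open>k\<close>, the middle one has slope \<open>s\<close>. For
    \<open>s = 0\<close> this breaks down at the half turn, hence the case split.\<close>
  define k where "k = (c - 1) / s"
  have ks: "k * s = c - 1" using False by (simp add: k_def)
  have k2: "k * (c + 1) = - s"
  proof -
    have "k * (c + 1) * s = (k * s) * (c + 1)" by simp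
    also have "\<dots> = - s * s" unfolding ks using cs by (simp add: algebra_simps power2_eq_square)
    finally have "k * (c + 1) * s = - s * s" .
    then have "(k * (c + 1) + s) * s = 0" by (simp add: algebra_simps)
    then show ?thesis using False by simp
  qed
  have eq: "rot2 c s v = (let a = (k * snd v + fst v, snd v); b = (fst a, s * fst a + snd a) in (k * snd b + fst b, snd b))" for v
  proof -
    have "s * (k * y + x) + y = s * x + c * y" for x y
    proof -
      have "s * (k * y + x) + y = (k * s) * y + s * x + y" by (simp add: algebra_simps)
      also have "\<dots> = s * x + c * y" unfolding ks by (simp add: algebra_simps)
      finally show ?thesis .
    qed
    moreover have "k * (s * x + c * y) + (k * y + x) = c * x - s * y" for x y
    proof -
      have "k * (s * x + c * y) + (k * y + x) = (k * s) * x + (k * (c + 1)) * y + x" by (simp add: algebra_simps)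
      then show ?thesis unfolding ks k2 by (simp add: algebra_simps)
    qed
    ultimately show ?thesis by (simp add: rot2_def Let_def)
  qed
  have "(\<integral>\<^sup>+v. f (rot2 c s v) \<partial>lborel) =
    (\<integral>\<^sup>+v. (\<lambda>a. (\<lambda>b. f (k * snd b + fst b, snd b)) (fst a, s * fst a + snd a)) (k * snd v + fst v, snd v) \<partial>lborel)"
    by (simp add: eq Let_def)
  also have "\<dots> = (\<integral>\<^sup>+v. f v \<partial>lborel)"
    by (subst nn_integral_shear1, measurable, subst nn_integral_shear2, measurable) (rule nn_integral_shear1[OF f])
  finally show ?thesis .
qed

lemma emeasure_disc:
  assumes "r \<ge> 0"
  shows "emeasure lborel {v :: real \<times> real. (fst v)\<^sup>2 + (snd v)\<^sup>2 \<le> r} = ennreal (pi * r)"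
proof -
  have "{v :: real \<times> real. (fst v)\<^sup>2 + (snd v)\<^sup>2 \<le> r} = cball 0 (sqrt r)"
    using assms by (auto simp: norm_prod_def real_sqrt_le_iff)
  then show ?thesis using assms by (simp add: emeasure_cball unit_ball_vol_2)
qed

text \<open>Completing the square writes the form as (p (x + (b/a) y))^2 + (q y)^2: an
  area-preserving shear followed by axis scalings with
  \<open>p * q = sqrt (a * c - b\<^sup>2)\<close> maps the region onto a disc.\<close>

lemma emeasure_ellipse:
  fixes a b c :: real
  assumes a: "a > 0" and det: "a * c - b\<^sup>2 > 0" and r: "r \<ge> 0"
  shows "emeasure lborel {v :: real \<times> real. a * (fst v)\<^sup>2 + 2 * b * fst v * snd v + c * (snd v)\<^sup>2 \<le> r} =
    ennreal (pi * r / sqrt (a * c - b\<^sup>2))"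
proof -
  define p where "p = sqrt a"
  define q where "q = sqrt ((a * c - b\<^sup>2) / a)"
  have pq: "p > 0" "q > 0" "p\<^sup>2 = a" "q\<^sup>2 = (a * c - b\<^sup>2) / a" "p * q = sqrt (a * c - b\<^sup>2)"
    using a det by (auto simp: p_def q_def real_sqrt_mult[symmetric])
  let ?E = "\<lambda>v::real\<times>real. indicator {v. (fst v)\<^sup>2 + (snd v)\<^sup>2 \<le> r} v :: ennreal"
  have form: "a * x\<^sup>2 + 2 * b * x * y + c * y\<^sup>2 = (p * ((b / a) * y + x))\<^sup>2 + (q * y)\<^sup>2" for x y
    unfolding power_mult_distrib pq using a by (simp add: field_simps power2_eq_square)
  have "emeasure lborel {v :: real \<times> real. a * (fst v)\<^sup>2 + 2 * b * fst v * snd v + c * (snd v)\<^sup>2 \<le> r} =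
    (\<integral>\<^sup>+v. indicator {v :: real \<times> real. a * (fst v)\<^sup>2 + 2 * b * fst v * snd v + c * (snd v)\<^sup>2 \<le> r} v \<partial>lborel)"
    by (rule nn_integral_indicator[symmetric]) measurable
  also have "\<dots> = (\<integral>\<^sup>+v. (\<lambda>w. ?E (p * fst w, q * snd w)) ((b / a) * snd v + fst v, snd v) \<partial>lborel)"
    by (intro nn_integral_cong) (simp add: form split: split_indicator)
  also have "\<dots> = (\<integral>\<^sup>+w. ?E (p * fst w, q * snd w) \<partial>lborel)"
    by (rule nn_integral_shear1) measurable
  also have "\<dots> = (\<integral>\<^sup>+x. (\<integral>\<^sup>+y. ?E (p * x, q * y) \<partial>lborel) \<partial>lborel)"
    by (subst nn_integral_lborel_Pair(1)) auto
  also have "\<dots> = (\<integral>\<^sup>+x. ennreal (1 / q) * (\<integral>\<^sup>+y. ?E (p * x, y) \<partial>lborel) \<partial>lborel)"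
  proof (intro nn_integral_cong)
    fix x
    show "(\<integral>\<^sup>+y. ?E (p * x, q * y) \<partial>lborel) = ennreal (1 / q) * (\<integral>\<^sup>+y. ?E (p * x, y) \<partial>lborel)"
      using nn_integral_real_affine[of "\<lambda>y. ?E (p * x, q * y)" "1 / q" 0] pq by simp
  qed
  also have "\<dots> = ennreal (1 / q) * (\<integral>\<^sup>+x. (\<integral>\<^sup>+y. ?E (p * x, y) \<partial>lborel) \<partial>lborel)"
    by (rule nn_integral_cmult) measurable
  also have "(\<integral>\<^sup>+x. (\<integral>\<^sup>+y. ?E (p * x, y) \<partial>lborel) \<partial>lborel) = ennreal (1 / p) * (\<integral>\<^sup>+x. (\<integral>\<^sup>+y. ?E (x, y) \<partial>lborel) \<partial>lborel)"
    using nn_integral_real_affine[of "\<lambda>x. (\<integral>\<^sup>+y. ?E (p * x, y) \<partial>lborel)" "1 / p" 0] pq by simp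
  also have "(\<integral>\<^sup>+x. (\<integral>\<^sup>+y. ?E (x, y) \<partial>lborel) \<partial>lborel) = (\<integral>\<^sup>+v. ?E v \<partial>lborel)"
    by (subst nn_integral_lborel_Pair(1)) auto
  also have "\<dots> = emeasure lborel {v :: real \<times> real. (fst v)\<^sup>2 + (snd v)\<^sup>2 \<le> r}"
    by (rule nn_integral_indicator) measurable
  also have "\<dots> = ennreal (pi * r)" by (rule emeasure_disc[OF r])
  finally show ?thesis using pq r
    by (simp add: ennreal_mult[symmetric] field_simps)
qed

section \<open>The planar inequality\<close>

text \<open>Stated for any inner product space, because it is applied both to the body in four-space
  and to its planar projections; a section of the former is the \<open>width_dual\<close> of the
  latter.\<close>

definition width_dual :: "'a::real_inner set \<Rightarrow> 'a set" where
  "width_dual L = {z. \<forall>x\<in>L. \<forall>y\<in>L. (x - y) \<bullet> z \<le> 1}"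

lemma closed_width_dual: "closed (width_dual L)"
proof -
  have "width_dual L = (\<Inter>x\<in>L. \<Inter>y\<in>L. {z. (x - y) \<bullet> z \<le> 1})" by (auto simp: width_dual_def)
  then show ?thesis by (auto intro!: closed_INT closed_Collect_le continuous_intros)
qed

lemma uminus_in_width_dual: "- z \<in> width_dual L \<longleftrightarrow> z \<in> width_dual L"
  by (auto simp: width_dual_def inner_diff_left)

lemma nn_integral_even:
  fixes h :: "real \<Rightarrow> ennreal"
  assumes [measurable]: "h \<in> borel_measurable borel" and even: "\<And>t. h (- t) = h t"
  shows "(\<integral>\<^sup>+t. h t \<partial>lborel) = 2 * (\<integral>\<^sup>+t. h t * indicator {0<..} t \<partial>lborel)"
proof -
  have "(\<integral>\<^sup>+t. h t \<partial>lborel) = (\<integral>\<^sup>+t. h t * indicator {0<..} t + h t * indicator {..<0} t \<partial>lborel)"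
  proof (rule nn_integral_cong_AE)
    have "AE t in lborel. t \<noteq> (0::real)" by (rule AE_lborel_singleton)
    then show "AE t in lborel. h t = h t * indicator {0<..} t + h t * indicator {..<0} t"
      by eventually_elim (auto split: split_indicator)
  qed
  also have "\<dots> = (\<integral>\<^sup>+t. h t * indicator {0<..} t \<partial>lborel) + (\<integral>\<^sup>+t. h t * indicator {..<0} t \<partial>lborel)"
    by (rule nn_integral_add) measurable
  also have "(\<integral>\<^sup>+t. h t * indicator {..<0} t \<partial>lborel) = (\<integral>\<^sup>+t. h (0 + (-1) * t) * indicator {..<0} (0 + (-1) * t) \<partial>lborel)"
    by (subst nn_integral_real_affine[of _ "-1" 0]) auto
  also have "\<dots> = (\<integral>\<^sup>+t. h t * indicator {0<..} t \<partial>lborel)"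
    by (intro nn_integral_cong) (auto simp: even split: split_indicator)
  finally show ?thesis by (simp add: mult_2)
qed

lemma nn_integral_monomial_Icc:
  assumes "a \<le> b"
  shows "(\<integral>\<^sup>+x. ennreal ((x - a) ^ n) * indicator {a..b} x \<partial>lborel) = ennreal ((b - a) ^ Suc n / Suc n)"
proof -
  have "(\<integral>\<^sup>+x. ennreal ((x - a) ^ n) * indicator {a..b} x \<partial>lborel) =
    ennreal ((b - a) ^ Suc n / Suc n - (a - a) ^ Suc n / Suc n)"
  proof (rule nn_integral_FTC_Icc)
    show "((\<lambda>x. (x - a) ^ Suc n / Suc n) has_real_derivative (x - a) ^ n) (at x)" for x
    proof -
      have "((\<lambda>x. (x - a) ^ Suc n) has_real_derivative (1 + real n) * (1 * (x - a) ^ n)) (at x)"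
        by (rule DERIV_power_Suc) (auto intro!: derivative_eq_intros)
      from DERIV_cdivide[OF this, of "Suc n"] show ?thesis by (simp add: add.commute)
    qed
  qed (use assms in auto)
  then show ?thesis by simp
qed

text \<open>Both sides are a multiple of the cubed length of the interval \<open>S\<close>.\<close>

lemma interval_difference_moment:
  fixes S :: "real set"
  assumes "compact S" "convex S"
  shows "(\<integral>\<^sup>+l. ennreal l * indicator {0<..} l * (\<integral>\<^sup>+y. indicator S y * indicator S (y - l) \<partial>lborel) \<partial>lborel)
    = ennreal (1/2) * (\<integral>\<^sup>+l. ennreal (l\<^sup>2) * indicator {0<..} l * indicator {l. \<exists>y. y \<in> S \<and> y + l \<in> S} l \<partial>lborel)"
proof (cases "S = {}")
  case False
  obtain a b where S: "S = {a..b}" using assms by (metis connected_compact_interval_1 convex_connected)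
  with False have ab: "a \<le> b" by auto
  have "(\<integral>\<^sup>+l. ennreal l * indicator {0<..} l * (\<integral>\<^sup>+y. indicator S y * indicator S (y - l) \<partial>lborel) \<partial>lborel) =
    (\<integral>\<^sup>+l. (\<integral>\<^sup>+y. ennreal l * indicator {0<..} l * (indicator S y * indicator S (y - l)) \<partial>lborel) \<partial>lborel)"
    unfolding S by (intro nn_integral_cong nn_integral_cmult[symmetric]) measurable
  also have "\<dots> = (\<integral>\<^sup>+y. (\<integral>\<^sup>+l. ennreal l * indicator {0<..} l * (indicator S y * indicator S (y - l)) \<partial>lborel) \<partial>lborel)"
    unfolding S by (rule lborel_pair.Fubini') measurable
  also have "\<dots> = (\<integral>\<^sup>+y. ennreal (1/2) * (ennreal ((y - a) ^ 2) * indicator {a..b} y) \<partial>lborel)"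
  proof (rule nn_integral_cong)
    fix y
    show "(\<integral>\<^sup>+l. ennreal l * indicator {0<..} l * (indicator S y * indicator S (y - l)) \<partial>lborel) =
      ennreal (1/2) * (ennreal ((y - a) ^ 2) * indicator {a..b} y)"
    proof (cases "y \<in> {a..b}")
      case True
      have "(\<integral>\<^sup>+l. ennreal l * indicator {0<..} l * (indicator S y * indicator S (y - l)) \<partial>lborel) =
        (\<integral>\<^sup>+l. ennreal ((l - 0) ^ 1) * indicator {0..y - a} l \<partial>lborel)"
        using True unfolding S by (intro nn_integral_cong) (auto split: split_indicator)
      also have "\<dots> = ennreal ((y - a - 0) ^ Suc 1 / Suc 1)" using True by (intro nn_integral_monomial_Icc) auto
      also have "\<dots> = ennreal (1/2) * ennreal ((y - a) ^ 2)"
        by (subst ennreal_mult[symmetric]) (auto simp: power2_eq_square)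
      finally show ?thesis using True by simp
    qed (simp add: S)
  qed
  also have "\<dots> = ennreal (1/2) * ennreal ((b - a) ^ 3 / 3)"
    using ab by (subst nn_integral_cmult) (auto simp: nn_integral_monomial_Icc numeral_3_eq_3)
  also have "ennreal ((b - a) ^ 3 / 3) = (\<integral>\<^sup>+l. ennreal ((l - 0)\<^sup>2) * indicator {0..b - a} l \<partial>lborel)"
    using ab by (subst nn_integral_monomial_Icc) (auto simp: numeral_3_eq_3)
  also have "\<dots> = (\<integral>\<^sup>+l. ennreal (l\<^sup>2) * indicator {0<..} l * indicator {l. \<exists>y. y \<in> S \<and> y + l \<in> S} l \<partial>lborel)"
  proof (rule nn_integral_cong)
    fix l :: real
    have "(\<exists>y. y \<in> S \<and> y + l \<in> S) \<longleftrightarrow> l \<le> b - a" if "l > 0"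
    proof
      assume "l \<le> b - a"
      then show "\<exists>y. y \<in> S \<and> y + l \<in> S" using that by (intro exI[of _ a]) (auto simp: S)
    qed (auto simp: S)
    then show "ennreal ((l - 0)\<^sup>2) * indicator {0..b - a} l =
      ennreal (l\<^sup>2) * indicator {0<..} l * indicator {l. \<exists>y. y \<in> S \<and> y + l \<in> S} l"
      by (cases "l > 0"; cases "l = 0") (auto split: split_indicator)
  qed
  finally show ?thesis .
qed simp

section \<open>The covariogram and its radial moments\<close>

lemma nn_integral_reflect:
  fixes f :: "'a::euclidean_space \<Rightarrow> ennreal"
  assumes [measurable]: "f \<in> borel_measurable borel"
  shows "(\<integral>\<^sup>+v. f (z - v) \<partial>lborel) = (\<integral>\<^sup>+v. f v \<partial>lborel)"
proof -
  have "(\<integral>\<^sup>+v. f v \<partial>lborel) =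
    (\<integral>\<^sup>+v. f v \<partial>density (distr lborel borel (\<lambda>x. z + (-1) *\<^sub>R x)) (\<lambda>_. ennreal (\<bar>-1\<bar> ^ DIM('a))))"
    by (rule arg_cong[OF lborel_affine]) simp
  then show ?thesis by (simp add: nn_integral_density nn_integral_distr)
qed

definition covariogram :: "(real \<times> real) set \<Rightarrow> real \<times> real \<Rightarrow> ennreal" where
  "covariogram L v = (\<integral>\<^sup>+z. indicator L z * indicator L (z - v) \<partial>lborel)"

lemma measurable_covariogram [measurable]:
  assumes [measurable]: "L \<in> sets borel"
  shows "covariogram L \<in> borel_measurable borel"
  unfolding covariogram_def by measurable

lemma nn_integral_covariogram:
  assumes [measurable]: "L \<in> sets borel"
  shows "(\<integral>\<^sup>+v. covariogram L v \<partial>lborel) = (emeasure lborel L)\<^sup>2"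
proof -
  have "(\<integral>\<^sup>+v. covariogram L v \<partial>lborel) = (\<integral>\<^sup>+z. (\<integral>\<^sup>+v. indicator L z * indicator L (z - v) \<partial>lborel) \<partial>lborel)"
    unfolding covariogram_def by (rule lborel_pair.Fubini') measurable
  also have "\<dots> = (\<integral>\<^sup>+z. indicator L z * emeasure lborel L \<partial>lborel)"
  proof (rule nn_integral_cong)
    fix z :: "real \<times> real"
    have "(\<integral>\<^sup>+v. indicator L z * indicator L (z - v) \<partial>lborel) = (indicator L z :: ennreal) * (\<integral>\<^sup>+v. indicator L (z - v) \<partial>lborel)"
      by (rule nn_integral_cmult) measurable
    also have "(\<integral>\<^sup>+v. indicator L (z - v) \<partial>lborel) = (\<integral>\<^sup>+v. (indicator L v :: ennreal) \<partial>lborel)"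
      by (rule nn_integral_reflect) measurable
    finally show "(\<integral>\<^sup>+v. indicator L z * indicator L (z - v) \<partial>lborel) = indicator L z * emeasure lborel L" by simp
  qed
  also have "\<dots> = (emeasure lborel L)\<^sup>2" by (simp add: nn_integral_multc power2_eq_square)
  finally show ?thesis .
qed

text \<open>Slice the dual by horizontal lines, giving \<open>S t\<close>, and collect in
  \<open>U l\<close> the abscissae over which \<open>L\<close> has two points at vertical distance
  \<open>l\<close>. The second moment of the dual and the first moment of the covariogram are
  moments of the lengths of these sets, and the lengths satisfy the duality assumed in
  \<open>moment_product_bound\<close>.\<close>

lemma covariogram_moment_vertical:
  fixes L :: "(real \<times> real) set"
  assumes L: "compact L" "convex L" and D: "bounded (width_dual L)"
  shows "(\<integral>\<^sup>+z. ennreal ((snd z)\<^sup>2) * indicator (width_dual L) z \<partial>lborel) *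
    (\<integral>\<^sup>+l. ennreal l * covariogram L (0, l) * indicator {0<..} l \<partial>lborel) \<le> ennreal (pi\<^sup>2 / 128)"
proof -
  let ?D = "width_dual L"
  have cD: "compact ?D" using D closed_width_dual by (simp add: compact_eq_bounded_closed)
  have [measurable]: "L \<in> sets borel" "?D \<in> sets borel" using L cD by (auto intro: borel_compact)
  define S where "S t = {s. (s, t) \<in> ?D}" for t
  define U where "U l = {x. \<exists>y. (x, y) \<in> L \<and> (x, y + l) \<in> L}" for l
  have cS: "compact (S t)" for t
  proof -
    have "S t = fst ` (?D \<inter> {z. snd z = t})" unfolding S_def by force
    then show ?thesis using cD
      by (auto intro!: compact_continuous_image continuous_intros compact_Int_closed closed_Collect_eq)
  qed
  have cU: "compact (U l)" for l
  proof -
    have "U l = fst ` (L \<inter> (\<lambda>z. z + (0, l)) -` L)" unfolding U_def by force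
    moreover have "closed ((\<lambda>z. z + (0, l)) -` L)"
      using L by (intro continuous_closed_vimage) (auto intro: compact_imp_closed continuous_intros)
    ultimately show ?thesis using L
      by (auto intro!: compact_continuous_image continuous_intros compact_Int_closed)
  qed
  define d where "d t = measure lborel (S t)" for t
  define W where "W l = measure lborel (U l)" for l
  have ed: "emeasure lborel (S t) = ennreal (d t)" for t
    unfolding d_def using emeasure_compact_finite[OF cS[of t]] by (intro emeasure_eq_ennreal_measure) auto
  have eW: "emeasure lborel (U l) = ennreal (W l)" for l
    unfolding W_def using emeasure_compact_finite[OF cU[of l]] by (intro emeasure_eq_ennreal_measure) auto
  have nn: "0 \<le> d t" "0 \<le> W l" for t l by (auto simp: d_def W_def)
  have [measurable]: "S t \<in> sets borel" "U t \<in> sets borel" for t using cS cU by (auto intro: borel_compact)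
  \<comment> \<open>All sets \<open>U l\<close> are sections of this one compact set, which makes
    \<open>W\<close> measurable by Fubini.\<close>
  define Q where "Q = {p. \<exists>y. (snd p, y) \<in> L \<and> (snd p, y + fst p) \<in> L}"
  have "compact Q"
  proof -
    have "Q = (\<lambda>z. (snd (snd z) - snd (fst z), fst (fst z))) ` ((L \<times> L) \<inter> {z. fst (fst z) = fst (snd z)})"
    proof (intro equalityI subsetI)
      fix p assume "p \<in> Q"
      then obtain y where "(snd p, y) \<in> L" "(snd p, y + fst p) \<in> L" by (auto simp: Q_def)
      then show "p \<in> (\<lambda>z. (snd (snd z) - snd (fst z), fst (fst z))) ` ((L \<times> L) \<inter> {z. fst (fst z) = fst (snd z)})"
        by (intro image_eqI[of _ _ "((snd p, y), (snd p, y + fst p))"]) auto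
    qed (auto simp: Q_def)
    then show ?thesis using L
      by (auto intro!: compact_continuous_image continuous_intros compact_Int_closed closed_Collect_eq compact_Times)
  qed
  then have [measurable]: "Q \<in> sets borel" by (rule borel_compact)
  have [measurable]: "d \<in> borel_measurable borel"
  proof -
    have "(\<lambda>t. \<integral>\<^sup>+s. indicator ?D (s, t) \<partial>lborel) \<in> borel_measurable borel" by measurable
    also have "(\<lambda>t. \<integral>\<^sup>+s. indicator ?D (s, t) \<partial>lborel) = (\<lambda>t. ennreal (d t))"
    proof
      fix t
      have "(\<integral>\<^sup>+s. indicator ?D (s, t) \<partial>lborel) = (\<integral>\<^sup>+s. indicator (S t) s \<partial>lborel)"
        by (intro nn_integral_cong) (auto simp: S_def split: split_indicator)
      then show "(\<integral>\<^sup>+s. indicator ?D (s, t) \<partial>lborel) = ennreal (d t)" by (simp add: ed)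
    qed
    finally show ?thesis using nn measurable_compose[OF _ borel_measurable_enn2real] by (force simp: fun_eq_iff)
  qed
  have [measurable]: "W \<in> borel_measurable borel"
  proof -
    have "(\<lambda>l. \<integral>\<^sup>+x. indicator Q (l, x) \<partial>lborel) \<in> borel_measurable borel" by measurable
    also have "(\<lambda>l. \<integral>\<^sup>+x. indicator Q (l, x) \<partial>lborel) = (\<lambda>l. ennreal (W l))"
    proof
      fix l
      have "(\<integral>\<^sup>+x. indicator Q (l, x) \<partial>lborel) = (\<integral>\<^sup>+x. indicator (U l) x \<partial>lborel)"
        by (intro nn_integral_cong) (auto simp: U_def Q_def split: split_indicator)
      then show "(\<integral>\<^sup>+x. indicator Q (l, x) \<partial>lborel) = ennreal (W l)" by (simp add: eW)
    qed
    finally show ?thesis using nn measurable_compose[OF _ borel_measurable_enn2real] by (force simp: fun_eq_iff)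
  qed
  have dual: "d t * W l + 2 * t * l \<le> 2" if pos: "0 < d t" "0 < W l" for t l
  proof -
    have extent: "\<exists>a b. a \<in> S \<and> b \<in> S \<and> a \<le> b \<and> measure lborel S \<le> b - a"
      if S: "compact S" "0 < measure lborel S" for S :: "real set"
    proof -
      have "S \<noteq> {}" using S by auto
      obtain a where a: "a \<in> S" "\<And>x. x \<in> S \<Longrightarrow> a \<le> x" using compact_attains_inf[OF S(1) \<open>S \<noteq> {}\<close>] by auto
      obtain b where b: "b \<in> S" "\<And>x. x \<in> S \<Longrightarrow> x \<le> b" using compact_attains_sup[OF S(1) \<open>S \<noteq> {}\<close>] by auto
      have "measure lborel S \<le> measure lborel {a..b}"
        using a b S(1) by (intro measure_mono_fmeasurable) (auto intro: fmeasurable_compact borel_compact)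
      then show ?thesis using a b by auto
    qed
    obtain s s' where s: "s \<in> S t" "s' \<in> S t" "s \<le> s'" "d t \<le> s' - s"
      using extent[OF cS[of t]] pos by (auto simp: d_def)
    obtain x x' where x: "x \<in> U l" "x' \<in> U l" "x \<le> x'" "W l \<le> x' - x"
      using extent[OF cU[of l]] pos by (auto simp: W_def)
    obtain y y' where y: "(x, y) \<in> L" "(x, y + l) \<in> L" "(x', y') \<in> L" "(x', y' + l) \<in> L"
      using x by (auto simp: U_def)
    \<comment> \<open>The upper end of each vertical chord is compared with the lower end of the
      other, and each comparison is tested against a different end of \<open>S t\<close>. On adding
      the two inequalities the unknown heights \<open>y\<close> and \<open>y'\<close>
      cancel.\<close>
    have "((x', y' + l) - (x, y)) \<bullet> (s', t) \<le> 1" "((x, y + l) - (x', y')) \<bullet> (s, t) \<le> 1"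
      using s y unfolding S_def width_dual_def by blast+
    then have "(x' - x) * s' + (y' + l - y) * t \<le> 1" "(x - x') * s + (y + l - y') * t \<le> 1" by simp_all
    then have "(s' - s) * (x' - x) + 2 * t * l \<le> 2" by (simp add: algebra_simps)
    moreover have "d t * W l \<le> (s' - s) * (x' - x)" using s x pos by (intro mult_mono) auto
    ultimately show ?thesis by simp
  qed
  have q: "(\<integral>\<^sup>+z. ennreal ((snd z)\<^sup>2) * indicator ?D z \<partial>lborel) = 2 * (\<integral>\<^sup>+t. ennreal (t\<^sup>2 * d t) * indicator {0<..} t \<partial>lborel)"
  proof -
    have "(\<integral>\<^sup>+z. ennreal ((snd z)\<^sup>2) * indicator ?D z \<partial>lborel) =
       (\<integral>\<^sup>+t. (\<integral>\<^sup>+s. ennreal (t\<^sup>2) * indicator (S t) s \<partial>lborel) \<partial>lborel)"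
      by (subst nn_integral_lborel_Pair(2)) (auto simp: S_def indicator_def intro!: nn_integral_cong)
    also have "\<dots> = (\<integral>\<^sup>+t. ennreal (t\<^sup>2 * d t) \<partial>lborel)"
      by (intro nn_integral_cong) (simp add: nn_integral_cmult_indicator ed ennreal_mult nn)
    also have "\<dots> = 2 * (\<integral>\<^sup>+t. ennreal (t\<^sup>2 * d t) * indicator {0<..} t \<partial>lborel)"
    proof (rule nn_integral_even)
      fix t
      have "ennreal (d (- t)) = (\<integral>\<^sup>+s. indicator (S (- t)) s \<partial>lborel)" by (simp add: ed)
      also have "\<dots> = (\<integral>\<^sup>+s. indicator (S (- t)) (0 + (-1) * s) \<partial>lborel)"
        by (subst nn_integral_real_affine[of _ "-1" 0]) auto
      also have "\<dots> = (\<integral>\<^sup>+s. indicator (S t) s \<partial>lborel)"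
        using uminus_in_width_dual[of "(_, t)" L]
        by (intro nn_integral_cong) (auto simp: S_def indicator_def)
      finally have "ennreal (d (- t)) = ennreal (d t)" by (simp add: ed)
      then show "ennreal ((- t)\<^sup>2 * d (- t)) = ennreal (t\<^sup>2 * d t)" using nn by simp
    qed measurable
    finally show ?thesis .
  qed
  have g: "(\<integral>\<^sup>+l. ennreal l * covariogram L (0, l) * indicator {0<..} l \<partial>lborel) =
    ennreal (1/2) * (\<integral>\<^sup>+l. ennreal (l\<^sup>2 * W l) * indicator {0<..} l \<partial>lborel)"
  proof -
    let ?i = "\<lambda>x y. indicator L (x, y) :: ennreal"
    have "(\<integral>\<^sup>+l. ennreal l * covariogram L (0, l) * indicator {0<..} l \<partial>lborel) =
      (\<integral>\<^sup>+l. (\<integral>\<^sup>+x. ennreal l * indicator {0<..} l * (\<integral>\<^sup>+y. ?i x y * ?i x (y - l) \<partial>lborel) \<partial>lborel) \<partial>lborel)"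
    proof (rule nn_integral_cong)
      fix l :: real
      have "covariogram L (0, l) = (\<integral>\<^sup>+x. (\<integral>\<^sup>+y. ?i x y * ?i x (y - l) \<partial>lborel) \<partial>lborel)"
        unfolding covariogram_def by (subst nn_integral_lborel_Pair(1)) auto
      then have "ennreal l * covariogram L (0, l) * indicator {0<..} l =
        (ennreal l * indicator {0<..} l) * (\<integral>\<^sup>+x. (\<integral>\<^sup>+y. ?i x y * ?i x (y - l) \<partial>lborel) \<partial>lborel)"
        by (simp add: mult_ac)
      also have "\<dots> = (\<integral>\<^sup>+x. ennreal l * indicator {0<..} l * (\<integral>\<^sup>+y. ?i x y * ?i x (y - l) \<partial>lborel) \<partial>lborel)"
        by (rule nn_integral_cmult[symmetric]) measurable
      finally show "ennreal l * covariogram L (0, l) * indicator {0<..} l =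
        (\<integral>\<^sup>+x. ennreal l * indicator {0<..} l * (\<integral>\<^sup>+y. ?i x y * ?i x (y - l) \<partial>lborel) \<partial>lborel)" .
    qed
    also have "\<dots> = (\<integral>\<^sup>+x. (\<integral>\<^sup>+l. ennreal l * indicator {0<..} l * (\<integral>\<^sup>+y. ?i x y * ?i x (y - l) \<partial>lborel) \<partial>lborel) \<partial>lborel)"
      by (rule lborel_pair.Fubini') measurable
    also have "\<dots> = (\<integral>\<^sup>+x. ennreal (1/2) * (\<integral>\<^sup>+l. ennreal (l\<^sup>2) * indicator {0<..} l * indicator Q (l, x) \<partial>lborel) \<partial>lborel)"
    proof (rule nn_integral_cong)
      fix x
      let ?S = "{y. (x, y) \<in> L}"
      have "compact ?S"
      proof -
        have "?S = snd ` (L \<inter> {z. fst z = x})" by force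
        then show ?thesis using L
          by (auto intro!: compact_continuous_image continuous_intros compact_Int_closed closed_Collect_eq)
      qed
      moreover have "convex ?S"
      proof (rule convexI)
        fix y z u v :: real assume *: "y \<in> ?S" "z \<in> ?S" "0 \<le> u" "0 \<le> v" "u + v = 1"
        then have "u *\<^sub>R (x, y) + v *\<^sub>R (x, z) \<in> L" using L(2) by (intro convexD) auto
        moreover have "u *\<^sub>R (x, y) + v *\<^sub>R (x, z) = (x, u *\<^sub>R y + v *\<^sub>R z)" using *
          by (simp add: distrib_right[symmetric])
        ultimately show "u *\<^sub>R y + v *\<^sub>R z \<in> ?S" by simp
      qed
      ultimately have "(\<integral>\<^sup>+l. ennreal l * indicator {0<..} l * (\<integral>\<^sup>+y. indicator ?S y * indicator ?S (y - l) \<partial>lborel) \<partial>lborel)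
        = ennreal (1/2) * (\<integral>\<^sup>+l. ennreal (l\<^sup>2) * indicator {0<..} l * indicator {l. \<exists>y. y \<in> ?S \<and> y + l \<in> ?S} l \<partial>lborel)"
        by (rule interval_difference_moment)
      moreover have "indicator ?S y = ?i x y" for y by (simp add: indicator_def)
      moreover have "indicator {l. \<exists>y. y \<in> ?S \<and> y + l \<in> ?S} l = (indicator Q (l, x) :: ennreal)" for l
        by (simp add: indicator_def Q_def)
      ultimately show "(\<integral>\<^sup>+l. ennreal l * indicator {0<..} l * (\<integral>\<^sup>+y. ?i x y * ?i x (y - l) \<partial>lborel) \<partial>lborel) =
         ennreal (1/2) * (\<integral>\<^sup>+l. ennreal (l\<^sup>2) * indicator {0<..} l * indicator Q (l, x) \<partial>lborel)"
        by simp
    qed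
    also have "\<dots> = ennreal (1/2) * (\<integral>\<^sup>+x. (\<integral>\<^sup>+l. ennreal (l\<^sup>2) * indicator {0<..} l * indicator Q (l, x) \<partial>lborel) \<partial>lborel)"
      by (rule nn_integral_cmult) measurable
    also have "(\<integral>\<^sup>+x. (\<integral>\<^sup>+l. ennreal (l\<^sup>2) * indicator {0<..} l * indicator Q (l, x) \<partial>lborel) \<partial>lborel) =
      (\<integral>\<^sup>+l. (\<integral>\<^sup>+x. ennreal (l\<^sup>2) * indicator {0<..} l * indicator Q (l, x) \<partial>lborel) \<partial>lborel)"
      by (rule lborel_pair.Fubini') measurable
    also have "\<dots> = (\<integral>\<^sup>+l. ennreal (l\<^sup>2 * W l) * indicator {0<..} l \<partial>lborel)"
    proof (rule nn_integral_cong)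
      fix l
      have "indicator Q (l, x) = (indicator (U l) x :: ennreal)" for x by (simp add: Q_def U_def indicator_def)
      then have "(\<integral>\<^sup>+x. ennreal (l\<^sup>2) * indicator {0<..} l * indicator Q (l, x) \<partial>lborel) =
         ennreal (l\<^sup>2) * indicator {0<..} l * (\<integral>\<^sup>+x. indicator (U l) x \<partial>lborel)"
        by (subst nn_integral_cmult[symmetric]) auto
      then show "(\<integral>\<^sup>+x. ennreal (l\<^sup>2) * indicator {0<..} l * indicator Q (l, x) \<partial>lborel) = ennreal (l\<^sup>2 * W l) * indicator {0<..} l"
        by (simp add: eW ennreal_mult nn mult_ac)
    qed
    finally show ?thesis .
  qed
  \<comment> \<open>The factor 2 from the central symmetry of the dual cancels the factor 1/2 from
    \<open>interval_difference_moment\<close>.\<close>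
  have "2 * ennreal (1/2) = 1"
    using ennreal_mult[of 2 "1/2"] by simp
  then have "(\<integral>\<^sup>+z. ennreal ((snd z)\<^sup>2) * indicator ?D z \<partial>lborel) *
    (\<integral>\<^sup>+l. ennreal l * covariogram L (0, l) * indicator {0<..} l \<partial>lborel) =
    (\<integral>\<^sup>+t. ennreal (t\<^sup>2 * d t) * indicator {0<..} t \<partial>lborel) * (\<integral>\<^sup>+l. ennreal (l\<^sup>2 * W l) * indicator {0<..} l \<partial>lborel)"
    unfolding q g by (metis (no_types, lifting) mult.assoc mult.commute mult_1)
  also have "\<dots> \<le> ennreal (pi\<^sup>2 / 128)"
    by (rule moment_product_bound) (use nn dual in auto)
  finally show ?thesis .
qed


lemma rot2_inner: "c\<^sup>2 + s\<^sup>2 = 1 \<Longrightarrow> rot2 c s x \<bullet> rot2 c s y = x \<bullet> y"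
proof -
  assume cs: "c\<^sup>2 + s\<^sup>2 = 1"
  have "rot2 c s x \<bullet> rot2 c s y = (c\<^sup>2 + s\<^sup>2) * (x \<bullet> y)"
    by (cases x; cases y) (simp add: rot2_def algebra_simps power2_eq_square)
  then show ?thesis using cs by simp
qed

lemma rot2_inverse: "c\<^sup>2 + s\<^sup>2 = 1 \<Longrightarrow> rot2 c s (rot2 c (- s) x) = x"
proof -
  assume cs: "c\<^sup>2 + s\<^sup>2 = 1"
  have "rot2 c s (rot2 c (- s) x) = ((c\<^sup>2 + s\<^sup>2) * fst x, (c\<^sup>2 + s\<^sup>2) * snd x)"
    by (simp add: rot2_def algebra_simps power2_eq_square)
  then show ?thesis using cs by simp
qed

lemma linear_rot2: "linear (rot2 c s)"
  by (auto intro!: linearI simp: rot2_def algebra_simps)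

text \<open>A rotation carries \<open>v\<close> to the vertical axis. Passing to the unit direction
  divides the inertia by the square of the norm of \<open>v\<close> and multiplies the covariogram
  moment by it, so the product does not see the length of \<open>v\<close>.\<close>

lemma covariogram_moment:
  fixes L :: "(real \<times> real) set"
  assumes L: "compact L" "convex L" and D: "bounded (width_dual L)" and v: "v \<noteq> 0"
  shows "(\<integral>\<^sup>+z. ennreal ((v \<bullet> z)\<^sup>2) * indicator (width_dual L) z \<partial>lborel) *
    (\<integral>\<^sup>+l. ennreal l * covariogram L (l *\<^sub>R v) * indicator {0<..} l \<partial>lborel) \<le> ennreal (pi\<^sup>2 / 128)"
proof -
  define n where "n = norm v"
  have n: "n > 0" using v by (simp add: n_def)
  \<comment> \<open>Chosen so that the rotation maps \<open>(0, 1)\<close> to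
    \<open>v / n\<close>.\<close>
  define c s where "c = snd v / n" and "s = - (fst v / n)"
  have n2: "n\<^sup>2 = (fst v)\<^sup>2 + (snd v)\<^sup>2" by (simp add: n_def norm_prod_def)
  have "c\<^sup>2 + s\<^sup>2 = ((fst v)\<^sup>2 + (snd v)\<^sup>2) / n\<^sup>2"
    by (simp add: c_def s_def power_divide add_divide_distrib)
  also have "\<dots> = 1" unfolding n2[symmetric] using n by simp
  finally have cs: "c\<^sup>2 + s\<^sup>2 = 1" .
  then have cs': "c\<^sup>2 + (- s)\<^sup>2 = 1" by simp
  have up: "rot2 c s (0, l) = (l / n) *\<^sub>R v" for l by (cases v) (simp add: rot2_def c_def s_def)
  define L' where "L' = rot2 c (- s) ` L"
  have inL': "z \<in> L' \<longleftrightarrow> rot2 c s z \<in> L" for z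
    unfolding L'_def image_iff using rot2_inverse[OF cs] rot2_inverse[OF cs', unfolded minus_minus] by metis
  have D': "z \<in> width_dual L' \<longleftrightarrow> rot2 c s z \<in> width_dual L" for z
  proof -
    have "(rot2 c (- s) x - rot2 c (- s) y) \<bullet> z = (x - y) \<bullet> rot2 c s z" for x y
      using rot2_inner[OF cs', of "x - y" "rot2 c s z"] rot2_inverse[OF cs', of z]
      by (simp add: linear_diff[OF linear_rot2])
    then show ?thesis by (simp add: width_dual_def L'_def)
  qed
  have lin: "linear (rot2 c (-s))" by (rule linear_rot2)
  have cL': "compact L'" "convex L'" unfolding L'_def
    using L lin by (auto intro: compact_continuous_image linear_continuous_on convex_linear_image simp: linear_conv_bounded_linear)
  have "width_dual L' = rot2 c (- s) ` width_dual L"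
    unfolding set_eq_iff image_iff
    using D' rot2_inverse[OF cs] rot2_inverse[OF cs', unfolded minus_minus] by metis
  then have bD': "bounded (width_dual L')" using D lin by (simp add: bounded_linear_image linear_conv_bounded_linear)
  have [measurable]: "L \<in> sets borel" "L' \<in> sets borel" using L cL' by (auto intro: borel_compact)
  have [measurable]: "width_dual L \<in> sets borel" "width_dual L' \<in> sets borel"
    by (simp_all add: borel_closed closed_width_dual)
  have q: "(\<integral>\<^sup>+z. ennreal ((snd z)\<^sup>2) * indicator (width_dual L') z \<partial>lborel) =
    ennreal (1 / n\<^sup>2) * (\<integral>\<^sup>+z. ennreal ((v \<bullet> z)\<^sup>2) * indicator (width_dual L) z \<partial>lborel)"
  proof -
    have "(\<integral>\<^sup>+z. ennreal ((snd z)\<^sup>2) * indicator (width_dual L') z \<partial>lborel) =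
      (\<integral>\<^sup>+z. (\<lambda>z. ennreal (1 / n\<^sup>2) * (ennreal ((v \<bullet> z)\<^sup>2) * indicator (width_dual L) z)) (rot2 c s z) \<partial>lborel)"
    proof (rule nn_integral_cong)
      fix z :: "real \<times> real"
      have "snd z = (0, 1) \<bullet> z" by (cases z) simp
      also have "\<dots> = (v \<bullet> rot2 c s z) / n" using rot2_inner[OF cs, of "(0, 1)" z] by (simp add: up)
      finally have "(snd z)\<^sup>2 = 1 / n\<^sup>2 * (v \<bullet> rot2 c s z)\<^sup>2" by (simp add: power_divide)
      then have "ennreal ((snd z)\<^sup>2) = ennreal (1 / n\<^sup>2) * ennreal ((v \<bullet> rot2 c s z)\<^sup>2)"
        by (simp only: ennreal_mult zero_le_power2 divide_nonneg_nonneg zero_le_one)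
      then show "ennreal ((snd z)\<^sup>2) * indicator (width_dual L') z =
        (\<lambda>z. ennreal (1 / n\<^sup>2) * (ennreal ((v \<bullet> z)\<^sup>2) * indicator (width_dual L) z)) (rot2 c s z)"
        by (simp add: D' indicator_def)
    qed
    also have "\<dots> = (\<integral>\<^sup>+z. ennreal (1 / n\<^sup>2) * (ennreal ((v \<bullet> z)\<^sup>2) * indicator (width_dual L) z) \<partial>lborel)"
      by (rule nn_integral_rot2[OF _ cs]) measurable
    also have "\<dots> = ennreal (1 / n\<^sup>2) * (\<integral>\<^sup>+z. ennreal ((v \<bullet> z)\<^sup>2) * indicator (width_dual L) z \<partial>lborel)"
      by (rule nn_integral_cmult) measurable
    finally show ?thesis .
  qed
  have cov: "covariogram L' (0, l) = covariogram L ((l / n) *\<^sub>R v)" for l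
  proof -
    have "covariogram L' (0, l) = (\<integral>\<^sup>+z. (\<lambda>z. indicator L z * indicator L (z - (l / n) *\<^sub>R v)) (rot2 c s z) \<partial>lborel)"
      unfolding covariogram_def by (intro nn_integral_cong) (simp add: indicator_def inL' linear_diff[OF linear_rot2] up)
    also have "\<dots> = covariogram L ((l / n) *\<^sub>R v)"
      unfolding covariogram_def by (rule nn_integral_rot2[OF _ cs]) measurable
    finally show ?thesis .
  qed
  have g: "(\<integral>\<^sup>+l. ennreal l * covariogram L' (0, l) * indicator {0<..} l \<partial>lborel) =
    ennreal (n\<^sup>2) * (\<integral>\<^sup>+l. ennreal l * covariogram L (l *\<^sub>R v) * indicator {0<..} l \<partial>lborel)"
  proof -
    have "(\<integral>\<^sup>+l. ennreal l * covariogram L' (0, l) * indicator {0<..} l \<partial>lborel) =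
      ennreal n * (\<integral>\<^sup>+l. ennreal (n * l) * covariogram L (l *\<^sub>R v) * indicator {0<..} (n * l) \<partial>lborel)"
      unfolding cov using n by (subst nn_integral_real_affine[of _ n 0]) auto
    also have "(\<integral>\<^sup>+l. ennreal (n * l) * covariogram L (l *\<^sub>R v) * indicator {0<..} (n * l) \<partial>lborel) =
      (\<integral>\<^sup>+l. ennreal n * (ennreal l * covariogram L (l *\<^sub>R v) * indicator {0<..} l) \<partial>lborel)"
      using n by (intro nn_integral_cong) (auto simp: ennreal_mult mult_ac zero_less_mult_iff split: split_indicator)
    also have "\<dots> = ennreal n * (\<integral>\<^sup>+l. ennreal l * covariogram L (l *\<^sub>R v) * indicator {0<..} l \<partial>lborel)"
      by (rule nn_integral_cmult) measurable
    finally show ?thesis using n by (simp add: power2_eq_square ennreal_mult mult_ac)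
  qed
  have one: "ennreal (1 / n\<^sup>2) * ennreal (n\<^sup>2) = 1" using n by (subst ennreal_mult[symmetric]) auto
  have "(\<integral>\<^sup>+z. ennreal ((v \<bullet> z)\<^sup>2) * indicator (width_dual L) z \<partial>lborel) *
    (\<integral>\<^sup>+l. ennreal l * covariogram L (l *\<^sub>R v) * indicator {0<..} l \<partial>lborel) =
    (\<integral>\<^sup>+z. ennreal ((snd z)\<^sup>2) * indicator (width_dual L') z \<partial>lborel) *
    (\<integral>\<^sup>+l. ennreal l * covariogram L' (0, l) * indicator {0<..} l \<partial>lborel)"
    (is "?a * ?b = _")
  proof -
    have "?a * ?b = (ennreal (1 / n\<^sup>2) * ennreal (n\<^sup>2)) * (?a * ?b)" unfolding one by simp
    then show ?thesis unfolding q g by (simp only: mult_ac)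
  qed
  also have "\<dots> \<le> ennreal (pi\<^sup>2 / 128)" by (rule covariogram_moment_vertical) fact+
  finally show ?thesis .
qed

text \<open>If the determinant is not positive the claim is trivial. Otherwise the covariogram of
  \<open>L\<close> has on every ray at most the first moment of the ellipse
  \<open>Q v \<le> r\<close>; comparing the total integrals gives \<open>(measure lborel L)\<^sup>2
  \<le> pi * r / sqrt (J11 * J22 - J12\<^sup>2)\<close>, which is then squared.\<close>

theorem area_dual_inertia:
  fixes L :: "(real \<times> real) set"
  assumes L: "compact L" "convex L" and D: "bounded (width_dual L)"
  defines "J11 \<equiv> \<integral>z. (fst z)\<^sup>2 * indicator (width_dual L) z \<partial>lborel"
    and "J12 \<equiv> \<integral>z. fst z * snd z * indicator (width_dual L) z \<partial>lborel"
    and "J22 \<equiv> \<integral>z. (snd z)\<^sup>2 * indicator (width_dual L) z \<partial>lborel"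
  shows "measure lborel L ^ 4 * (J11 * J22 - J12\<^sup>2) \<le> pi ^ 6 / 4096"
proof (cases "J11 * J22 - J12\<^sup>2 > 0")
  case False
  then have "measure lborel L ^ 4 * (J11 * J22 - J12\<^sup>2) \<le> 0" by (intro mult_nonneg_nonpos) auto
  then show ?thesis by (smt (verit) pi_gt_zero divide_nonneg_nonneg zero_le_power)
next
  case det: True
  let ?D = "width_dual L"
  have cD: "compact ?D" using D closed_width_dual by (simp add: compact_eq_bounded_closed)
  have [measurable]: "L \<in> sets borel" "?D \<in> sets borel" using L cD by (auto intro: borel_compact)
  have int: "integrable lborel (\<lambda>z. f z * indicator ?D z)" if "continuous_on UNIV f" for f :: "real \<times> real \<Rightarrow> real"
    using borel_integrable_compact[OF cD continuous_on_subset[OF that]]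
    by (simp add: indicator_scaleR_eq_if mult.commute[of "f _"] indicator_def if_distrib cong: if_cong)
  have int3: "integrable lborel (\<lambda>z. (fst z)\<^sup>2 * indicator ?D z)" "integrable lborel (\<lambda>z. fst z * snd z * indicator ?D z)"
    "integrable lborel (\<lambda>z. (snd z)\<^sup>2 * indicator ?D z)"
    by (auto intro!: int continuous_intros)
  have "J11 \<ge> 0" unfolding J11_def by (intro integral_nonneg_AE) auto
  moreover have "J11 \<noteq> 0" using det by auto
  ultimately have J11: "J11 > 0" by simp
  define Q where "Q v = J11 * (fst v)\<^sup>2 + 2 * J12 * fst v * snd v + J22 * (snd v)\<^sup>2" for v
  have Qint: "(\<integral>\<^sup>+z. ennreal ((v \<bullet> z)\<^sup>2) * indicator ?D z \<partial>lborel) = ennreal (Q v)" for v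
  proof -
    have eq: "(v \<bullet> z)\<^sup>2 * indicator ?D z = (fst v)\<^sup>2 * ((fst z)\<^sup>2 * indicator ?D z)
       + (2 * fst v * snd v) * (fst z * snd z * indicator ?D z) + (snd v)\<^sup>2 * ((snd z)\<^sup>2 * indicator ?D z)" for z
      by (cases v; cases z) (simp add: power2_eq_square algebra_simps)
    have "(\<integral>\<^sup>+z. ennreal ((v \<bullet> z)\<^sup>2) * indicator ?D z \<partial>lborel) = (\<integral>\<^sup>+z. ennreal ((v \<bullet> z)\<^sup>2 * indicator ?D z) \<partial>lborel)"
      by (intro nn_integral_cong) (auto split: split_indicator)
    also have "\<dots> = ennreal (\<integral>z. (v \<bullet> z)\<^sup>2 * indicator ?D z \<partial>lborel)"
      by (rule nn_integral_eq_integral) (auto intro!: int continuous_intros)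
    also have "(\<integral>z. (v \<bullet> z)\<^sup>2 * indicator ?D z \<partial>lborel) = Q v"
      unfolding eq Q_def J11_def J12_def J22_def using int3
      by (simp add: Bochner_Integration.integral_add Bochner_Integration.integrable_add integrable_mult_right)
    finally show ?thesis .
  qed
  have Qpos: "Q v > 0" if "v \<noteq> 0" for v
  proof -
    have "J11 * Q v = (J11 * fst v + J12 * snd v)\<^sup>2 + (J11 * J22 - J12\<^sup>2) * (snd v)\<^sup>2"
      by (simp add: Q_def power2_eq_square algebra_simps)
    also have "\<dots> > 0"
    proof (cases "snd v = 0")
      case True
      then have "fst v \<noteq> 0" using that by (cases v) (auto simp: zero_prod_def)
      then show ?thesis using J11 True by simp
    next
      case False
      then show ?thesis using det by (intro add_nonneg_pos) auto
    qed
    finally show ?thesis using J11 by (simp add: zero_less_mult_iff)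
  qed
  have Qscale: "Q (l *\<^sub>R v) = l\<^sup>2 * Q v" for l v
    by (simp add: Q_def power2_eq_square algebra_simps)
  \<comment> \<open>Along \<open>v\<close> the ellipse reaches \<open>sqrt (r / Q v)\<close>, so its
    first moment is r/(2 Q v). This \<open>r\<close> makes it equal to pi^2/(128 Q v), the bound
    from \<open>covariogram_moment\<close>.\<close>
  define r where "r = pi\<^sup>2 / 64"
  have r: "r > 0" by (simp add: r_def)
  have [measurable]: "Q \<in> borel_measurable borel" unfolding Q_def by measurable
  have "(emeasure lborel L)\<^sup>2 = (\<integral>\<^sup>+v. covariogram L v \<partial>lborel)"
    by (rule nn_integral_covariogram[symmetric]) measurable
  also have "\<dots> \<le> (\<integral>\<^sup>+v. indicator {v. Q v \<le> r} v \<partial>lborel)"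
  proof (rule radial_comparison)
    fix v :: "real \<times> real" assume v: "v \<noteq> 0"
    let ?X = "\<integral>\<^sup>+l. ennreal l * covariogram L (l *\<^sub>R v) * indicator {0<..} l \<partial>lborel"
    have "ennreal (1 / Q v) * (ennreal (Q v) * ?X) \<le> ennreal (1 / Q v) * ennreal (pi\<^sup>2 / 128)"
      using covariogram_moment[OF L D v] unfolding Qint by (intro mult_left_mono) auto
    moreover have "ennreal (1 / Q v) * ennreal (Q v) = 1"
      using Qpos[OF v] by (subst ennreal_mult[symmetric]) auto
    ultimately have "?X \<le> ennreal (1 / Q v) * ennreal (pi\<^sup>2 / 128)" by (simp only: mult.assoc[symmetric] mult_1)
    also have "\<dots> = ennreal (1 / Q v * (pi\<^sup>2 / 128))"
      using Qpos[OF v] by (subst ennreal_mult[symmetric]) auto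
    also have "1 / Q v * (pi\<^sup>2 / 128) = (sqrt (r / Q v) - 0) ^ Suc 1 / Suc 1"
      using Qpos[OF v] r by (simp add: r_def)
    also have "ennreal \<dots> = (\<integral>\<^sup>+l. ennreal ((l - 0) ^ 1) * indicator {0..sqrt (r / Q v)} l \<partial>lborel)"
      using Qpos[OF v] r by (intro nn_integral_monomial_Icc[symmetric]) auto
    also have "\<dots> = (\<integral>\<^sup>+l. ennreal l * indicator {v. Q v \<le> r} (l *\<^sub>R v) * indicator {0<..} l \<partial>lborel)"
    proof (rule nn_integral_cong)
      fix l :: real
      have "l \<le> sqrt (r / Q v) \<longleftrightarrow> Q (l *\<^sub>R v) \<le> r" if "l > 0"
      proof -
        have "l \<le> sqrt (r / Q v) \<longleftrightarrow> l\<^sup>2 \<le> r / Q v"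
          using that r Qpos[OF v] by (metis abs_of_pos real_sqrt_abs real_sqrt_le_iff)
        then show ?thesis using Qpos[OF v] by (simp add: Qscale field_simps)
      qed
      then show "ennreal ((l - 0) ^ 1) * indicator {0..sqrt (r / Q v)} l =
        ennreal l * indicator {v. Q v \<le> r} (l *\<^sub>R v) * indicator {0<..} l"
        by (cases "l > 0"; cases "l = 0") (auto split: split_indicator)
    qed
    finally show "?X \<le> (\<integral>\<^sup>+l. ennreal l * indicator {v. Q v \<le> r} (l *\<^sub>R v) * indicator {0<..} l \<partial>lborel)" .
  qed measurable
  also have "\<dots> = emeasure lborel {v. Q v \<le> r}" by (rule nn_integral_indicator) measurable
  also have "\<dots> = ennreal (pi * r / sqrt (J11 * J22 - J12\<^sup>2))"
    unfolding Q_def using J11 det r by (intro emeasure_ellipse) auto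
  finally have "(emeasure lborel L)\<^sup>2 \<le> ennreal (pi * r / sqrt (J11 * J22 - J12\<^sup>2))" .
  moreover have "emeasure lborel L = ennreal (measure lborel L)"
    using emeasure_compact_finite[OF L(1)] by (intro emeasure_eq_ennreal_measure) auto
  ultimately have "(measure lborel L)\<^sup>2 \<le> pi * r / sqrt (J11 * J22 - J12\<^sup>2)"
    using det r by (simp add: ennreal_power)
  then have "(measure lborel L)\<^sup>2 * sqrt (J11 * J22 - J12\<^sup>2) \<le> pi * r"
    using det by (simp add: field_simps)
  then have "((measure lborel L)\<^sup>2 * sqrt (J11 * J22 - J12\<^sup>2))\<^sup>2 \<le> (pi * r)\<^sup>2"
    using det by (intro power_mono) auto
  then show ?thesis using det by (simp add: power_mult_distrib r_def power_divide flip: power_mult)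
qed

section \<open>Quaternions and rotations of four-space\<close>

definition vec4 :: "real \<Rightarrow> real \<Rightarrow> real \<Rightarrow> real \<Rightarrow> real^4" where
  "vec4 w x y z = (\<chi> i. if i = 1 then w else if i = 2 then x else if i = 3 then y else z)"

lemma vec4_nth [simp]:
  "vec4 w x y z $ 1 = w" "vec4 w x y z $ 2 = x" "vec4 w x y z $ 3 = y" "vec4 w x y z $ 4 = z"
  by (simp_all add: vec4_def)

lemma vec4_eq_iff: "(a :: real^4) = b \<longleftrightarrow> a $ 1 = b $ 1 \<and> a $ 2 = b $ 2 \<and> a $ 3 = b $ 3 \<and> a $ 4 = b $ 4"
  by (simp add: vec_eq_iff forall_4)

lemma axis4_nth [simp]:
  "(axis 1 1 :: real^4) $ 1 = 1" "(axis 1 1 :: real^4) $ 2 = 0" "(axis 1 1 :: real^4) $ 3 = 0" "(axis 1 1 :: real^4) $ 4 = 0"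
  "(axis 2 1 :: real^4) $ 1 = 0" "(axis 2 1 :: real^4) $ 2 = 1" "(axis 2 1 :: real^4) $ 3 = 0" "(axis 2 1 :: real^4) $ 4 = 0"
  "(axis 3 1 :: real^4) $ 1 = 0" "(axis 3 1 :: real^4) $ 2 = 0" "(axis 3 1 :: real^4) $ 3 = 1" "(axis 3 1 :: real^4) $ 4 = 0"
  "(axis 4 1 :: real^4) $ 1 = 0" "(axis 4 1 :: real^4) $ 2 = 0" "(axis 4 1 :: real^4) $ 3 = 0" "(axis 4 1 :: real^4) $ 4 = 1"
  by (simp_all add: axis_def)

lemma inner_vec4: "(a :: real^4) \<bullet> b = a $ 1 * b $ 1 + a $ 2 * b $ 2 + a $ 3 * b $ 3 + a $ 4 * b $ 4"
  by (simp add: inner_vec_def sum_4)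

text \<open>Hamilton's product on \<open>real^4\<close>, with \<open>axis 1 1\<close> as the unit.\<close>

definition qmult :: "real^4 \<Rightarrow> real^4 \<Rightarrow> real^4" where
  "qmult a b = vec4
    (a $ 1 * b $ 1 - a $ 2 * b $ 2 - a $ 3 * b $ 3 - a $ 4 * b $ 4)
    (a $ 1 * b $ 2 + a $ 2 * b $ 1 + a $ 3 * b $ 4 - a $ 4 * b $ 3)
    (a $ 1 * b $ 3 - a $ 2 * b $ 4 + a $ 3 * b $ 1 + a $ 4 * b $ 2)
    (a $ 1 * b $ 4 + a $ 2 * b $ 3 - a $ 3 * b $ 2 + a $ 4 * b $ 1)"

definition qconj :: "real^4 \<Rightarrow> real^4" where
  "qconj a = vec4 (a $ 1) (- a $ 2) (- a $ 3) (- a $ 4)"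

lemma qmult_assoc: "qmult (qmult a b) c = qmult a (qmult b c)"
  by (simp add: qmult_def vec4_eq_iff algebra_simps)

lemma qmult_one [simp]: "qmult (axis 1 1) a = a" "qmult a (axis 1 1) = a"
  by (simp_all add: qmult_def vec4_eq_iff)

lemma qconj_one [simp]: "qconj (axis 1 1) = axis 1 1" "qconj (qconj a) = a"
  by (simp_all add: qconj_def vec4_eq_iff)

lemma qconj_qmult: "qconj (qmult a b) = qmult (qconj b) (qconj a)"
  by (simp add: qmult_def qconj_def vec4_eq_iff algebra_simps)

lemma qmult_linear:
  "qmult a (b + c) = qmult a b + qmult a c" "qmult (a + b) c = qmult a c + qmult b c"
  "qmult a (r *\<^sub>R b) = r *\<^sub>R qmult a b" "qmult (r *\<^sub>R a) b = r *\<^sub>R qmult a b"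
  by (simp_all add: qmult_def vec4_eq_iff algebra_simps)

lemma qmult_diff:
  "qmult a (b - c) = qmult a b - qmult a c" "qmult (a - b) c = qmult a c - qmult b c"
  by (simp_all add: qmult_def vec4_eq_iff algebra_simps)

lemma qmult_qconj: "qmult a (qconj a) = (a \<bullet> a) *\<^sub>R axis 1 1" "qmult (qconj a) a = (a \<bullet> a) *\<^sub>R axis 1 1"
  by (simp_all add: qmult_def qconj_def vec4_eq_iff inner_vec4 algebra_simps)

lemma inner_qmult: "qmult a b \<bullet> qmult a c = (a \<bullet> a) * (b \<bullet> c)" "qmult b a \<bullet> qmult c a = (a \<bullet> a) * (b \<bullet> c)"
  by (simp_all add: qmult_def inner_vec4 algebra_simps)

lemma qconj_inner: "qconj a \<bullet> qconj b = a \<bullet> b"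
  by (simp add: qconj_def inner_vec4)

lemma norm_qconj [simp]: "norm (qconj a) = norm a"
  by (simp add: norm_eq_sqrt_inner qconj_inner)

lemma norm_qmult [simp]: "norm (qmult a b) = norm a * norm b"
  by (simp add: norm_eq_sqrt_inner inner_qmult real_sqrt_mult)

lemma qmult_unit:
  assumes "norm a = 1"
  shows "qmult a (qconj a) = axis 1 1" "qmult (qconj a) a = axis 1 1"
  using assms by (simp_all add: qmult_qconj norm_eq_1)

text \<open>The conjugate on the right-hand factor makes the map multiplicative in the pair of
  quaternions, see \<open>qrot_mult\<close>.\<close>

definition qrot :: "real^4 \<Rightarrow> real^4 \<Rightarrow> real^4^4" where
  "qrot a b = matrix (\<lambda>x. qmult (qmult a x) (qconj b))"

lemma qrot_mult_vec: "qrot a b *v x = qmult (qmult a x) (qconj b)"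
proof -
  have "linear (\<lambda>x. qmult (qmult a x) (qconj b))" by (auto intro!: linearI simp: qmult_linear)
  from fun_cong[OF matrix_vector_mul(2)[OF this]] show ?thesis by (simp add: qrot_def)
qed

lemma qrot_mult: "qrot a b ** qrot c d = qrot (qmult a c) (qmult b d)"
proof -
  have "(qrot a b ** qrot c d) *v x = qrot (qmult a c) (qmult b d) *v x" for x
    by (simp add: matrix_vector_mul_assoc[symmetric] qrot_mult_vec qconj_qmult qmult_assoc)
  then show ?thesis by (simp add: matrix_eq)
qed

text \<open>1 + a bisects the angle between 1 and a, and its square is a times its squared norm, so
  normalising it gives a root. This degenerates only at a = -1, where the imaginary unit
  \<open>axis 2 1\<close> is a root.\<close>

lemma qsqrt_exists:
  assumes "norm a = 1"
  shows "\<exists>b. norm b = 1 \<and> qmult b b = a"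
proof (cases "a = - axis 1 1")
  case True
  then show ?thesis
    by (intro exI[of _ "axis 2 1"]) (simp add: qmult_def vec4_eq_iff norm_eq_1 inner_vec4)
next
  case False
  define c where "c = axis 1 1 + a"
  have aa: "a $ 1 * a $ 1 + a $ 2 * a $ 2 + a $ 3 * a $ 3 + a $ 4 * a $ 4 = 1"
    using assms by (simp add: norm_eq_1 inner_vec4)
  have "c \<noteq> 0" using False by (auto simp: c_def add_eq_0_iff)
  then have c0: "norm c > 0" by simp
  have cc: "(norm c)\<^sup>2 = 2 + 2 * a $ 1"
    by (simp add: power2_norm_eq_inner inner_vec4 c_def; use aa in algebra)
  have "qmult c c = (2 + 2 * a $ 1) *\<^sub>R a"
    unfolding vec4_eq_iff by (intro conjI; simp add: c_def qmult_def; use aa in algebra)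
  then have "qmult (c /\<^sub>R norm c) (c /\<^sub>R norm c) = (inverse (norm c) * (inverse (norm c) * (norm c)\<^sup>2)) *\<^sub>R a"
    by (simp add: qmult_linear cc[symmetric])
  also have "inverse (norm c) * (inverse (norm c) * (norm c)\<^sup>2) = 1" using c0 by (simp add: field_simps power2_eq_square)
  finally have "qmult (c /\<^sub>R norm c) (c /\<^sub>R norm c) = a" by simp
  then show ?thesis using c0 by (intro exI[of _ "c /\<^sub>R norm c"]) simp
qed

text \<open>Norm preservation gives determinant 1 or -1. Square roots of the two quaternions exhibit
  the matrix as the square of another one, so the determinant is nonnegative.\<close>

lemma rotation_qrot:
  assumes "norm a = 1" "norm b = 1"
  shows "rotation_matrix (qrot a b)"
proof -
  have orth: "orthogonal_matrix (qrot a b)" if "norm a = 1" "norm b = 1" for a b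
  proof -
    have "orthogonal_transformation (\<lambda>x. qrot a b *v x)"
      unfolding orthogonal_transformation using that by (simp add: qrot_mult_vec)
    then show ?thesis by (simp add: orthogonal_transformation_matrix)
  qed
  obtain c d where cd: "norm c = 1" "qmult c c = a" "norm d = 1" "qmult d d = b"
    using qsqrt_exists assms by metis
  have "qrot a b = qrot c d ** qrot c d" using cd by (simp add: qrot_mult)
  then have "det (qrot a b) = det (qrot c d) * det (qrot c d)" by (simp add: det_mul)
  then have "det (qrot a b) \<ge> 0" by simp
  moreover have "det (qrot a b) = 1 \<or> det (qrot a b) = -1" using orth[OF assms] by (rule det_orthogonal_matrix)
  ultimately show ?thesis using orth[OF assms] by (auto simp: rotation_matrix_def)
qed

text \<open>Multiplying by the conjugate of \<open>u\<close> reduces the problem to the pair 1 and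
  \<open>w\<close>, where \<open>w\<close> is a purely imaginary unit because \<open>u\<close> and
  \<open>v\<close> are orthogonal. It remains to conjugate the imaginary unit i to \<open>w\<close>,
  that is, to solve b i = w b.\<close>

lemma qrot_frame_exists:
  assumes u: "norm u = 1" and v: "norm v = 1" and uv: "u \<bullet> v = 0"
  shows "\<exists>a b. norm a = 1 \<and> norm b = 1 \<and> qrot a b *v axis 1 1 = u \<and> qrot a b *v axis 2 1 = v"
proof -
  define w where "w = qmult (qconj u) v"
  have nw: "norm w = 1" by (simp add: w_def u v)
  have w1: "w $ 1 = 0" using uv by (simp add: w_def qmult_def qconj_def inner_vec4)
  have ww: "w $ 2 * w $ 2 + w $ 3 * w $ 3 + w $ 4 * w $ 4 = 1"
    using nw w1 by (simp add: norm_eq_1 inner_vec4)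
  have "\<exists>b. norm b = 1 \<and> qmult b (axis 2 1) = qmult w b"
  proof (cases "w = - axis 2 1")
    case True
    then show ?thesis
      by (intro exI[of _ "axis 3 1"]) (simp add: qmult_def vec4_eq_iff norm_eq_1 inner_vec4)
  next
    case False
    \<comment> \<open>Since i^2 = w^2 = -1, the element 1 - w i satisfies c i = i + w = w c. It
      vanishes only for w = -i, where the imaginary unit \<open>axis 3 1\<close> was used
      instead.\<close>
    define c where "c = axis 1 1 - qmult w (axis 2 1)"
    have "c \<noteq> 0"
    proof
      assume "c = 0"
      then have "w $ 2 = -1" "w $ 3 = 0" "w $ 4 = 0" using w1 by (auto simp: c_def qmult_def vec4_eq_iff)
      then show False using False w1 by (simp add: vec4_eq_iff)
    qed
    moreover have "qmult c (axis 2 1) = qmult w c"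
    proof -
      have "qmult w w = - axis 1 1"
        using w1 ww by (simp add: qmult_def vec4_eq_iff)
      then have "qmult w c = w + axis 2 1"
        by (simp add: c_def qmult_linear qmult_diff qmult_assoc[symmetric]) (simp add: qmult_def vec4_eq_iff)
      moreover have "qmult c (axis 2 1) = w + axis 2 1"
        by (simp add: c_def qmult_diff qmult_assoc) (simp add: qmult_def vec4_eq_iff)
      ultimately show ?thesis by simp
    qed
    ultimately show ?thesis by (intro exI[of _ "c /\<^sub>R norm c"]) (simp add: qmult_linear)
  qed
  then obtain b where b: "norm b = 1" "qmult b (axis 2 1) = qmult w b" by blast
  have "qrot (qmult u b) b *v axis 1 1 = u"
    using b by (simp add: qrot_mult_vec qmult_assoc qmult_unit)
  moreover have "qrot (qmult u b) b *v axis 2 1 = v"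
  proof -
    have "qrot (qmult u b) b *v axis 2 1 = qmult u (qmult (qmult b (axis 2 1)) (qconj b))"
      by (simp add: qrot_mult_vec qmult_assoc)
    also have "\<dots> = qmult u w" unfolding b(2) using b(1) by (simp add: qmult_assoc qmult_unit)
    also have "\<dots> = v" using u by (simp add: w_def qmult_assoc[symmetric] qmult_unit)
    finally show ?thesis .
  qed
  ultimately show ?thesis using b u by (intro exI[of _ "qmult u b"] exI[of _ b]) simp
qed

text \<open>Conjugation by p + q i fixes 1 and i and turns the plane of the other two units by twice
  the angle of (p, q). So p and q are the cosine and sine of the half angle, with the sign of
  \<open>s\<close> put into q.\<close>

lemma qrot_plane_exists:
  assumes "c\<^sup>2 + s\<^sup>2 = 1"
  shows "\<exists>a. norm a = 1 \<and> qrot a a *v axis 1 1 = axis 1 1 \<and> qrot a a *v axis 2 1 = axis 2 1 \<and>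
    qrot a a *v axis 3 1 = vec4 0 0 c s"
proof -
  have "\<exists>p q::real. p\<^sup>2 + q\<^sup>2 = 1 \<and> p\<^sup>2 - q\<^sup>2 = c \<and> 2 * p * q = s"
  proof -
    have c: "\<bar>c\<bar> \<le> 1" using assms by (metis abs_le_square_iff abs_one le_add_same_cancel1 one_power2 zero_le_power2)
    define p where "p = sqrt ((1 + c) / 2)"
    define q where "q = sqrt ((1 - c) / 2)"
    have pq: "p\<^sup>2 = (1 + c) / 2" "q\<^sup>2 = (1 - c) / 2" "0 \<le> p" "0 \<le> q"
      using c by (auto simp: p_def q_def abs_le_iff)
    have "(2 * p * q)\<^sup>2 = \<bar>s\<bar>\<^sup>2"
      using assms unfolding power_mult_distrib pq by (simp add: field_simps power2_eq_square)
    then have "2 * p * q = \<bar>s\<bar>" by (rule power2_eq_imp_eq) (use pq in auto)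
    then have "2 * p * (if s \<ge> 0 then q else - q) = s" by (auto simp: abs_if split: if_splits)
    then show ?thesis using pq by (intro exI[of _ p] exI[of _ "if s \<ge> 0 then q else - q"]) (simp add: field_simps)
  qed
  then obtain p q where pq: "p\<^sup>2 + q\<^sup>2 = 1" "p\<^sup>2 - q\<^sup>2 = c" "2 * p * q = s" by blast
  define a where "a = vec4 p q 0 0"
  have "norm a = 1" using pq by (simp add: a_def norm_eq_1 inner_vec4 power2_eq_square)
  moreover have "qrot a a *v axis 1 1 = axis 1 1" "qrot a a *v axis 2 1 = axis 2 1"
    "qrot a a *v axis 3 1 = vec4 0 0 c s"
    using pq by (simp_all add: qrot_mult_vec a_def qmult_def qconj_def vec4_eq_iff power2_eq_square algebra_simps)
  ultimately show ?thesis by blast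
qed

lemma rotation_matrix_mult: "rotation_matrix (A :: real^'n^'n) \<Longrightarrow> rotation_matrix B \<Longrightarrow> rotation_matrix (A ** B)"
  by (simp add: rotation_matrix_def orthogonal_matrix_mul det_mul)

lemma rotation_matrix_transpose: "rotation_matrix (A :: real^'n^'n) \<Longrightarrow> rotation_matrix (transpose A)"
  by (simp add: rotation_matrix_def)

lemma rotation_matrix_inverse:
  assumes "rotation_matrix (A :: real^'n^'n)"
  shows "transpose A ** A = mat 1" "A ** transpose A = mat 1"
  using assms by (simp_all add: rotation_matrix_def orthogonal_matrix_def)

lemma rotation_matrix_inner:
  assumes "rotation_matrix (A :: real^'n^'n)"
  shows "(A *v x) \<bullet> (A *v y) = x \<bullet> y"
  using assms orthogonal_transformation_matrix[of "\<lambda>x. A *v x"]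
  by (simp add: rotation_matrix_def orthogonal_transformation_def)

lemma rotation_matrix_norm:
  assumes "rotation_matrix (A :: real^'n^'n)"
  shows "norm (A *v x) = norm x"
  using rotation_matrix_inner[OF assms] by (simp add: norm_eq_sqrt_inner)

text \<open>The columns are undone in turn: one \<open>qrot\<close> matches the first two, a
  rotation of the orthogonal plane matches the third, and what remains is diagonal with one free
  entry, forced to be 1 by the determinant. Hence multiplication by an arbitrary rotation is a
  multiplication of the two quaternions.\<close>

lemma rotation_matrix_eq_qrot:
  fixes Q :: "real^4^4"
  assumes Q: "rotation_matrix Q"
  shows "\<exists>a b. norm a = 1 \<and> norm b = 1 \<and> Q = qrot a b"
proof -
  have orth: "(M *v axis i 1) \<bullet> (M *v axis j 1) = (if i = j then 1 else 0)" if "rotation_matrix M" for M :: "real^4^4" and i j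
    using rotation_matrix_inner[OF that] by (simp add: inner_axis_axis)
  have fix_mult: "(transpose S ** M) *v axis i 1 = axis i 1"
    if "rotation_matrix S" "S *v axis i 1 = M *v axis i 1" for S M :: "real^4^4" and i
  proof -
    have "(transpose S ** M) *v axis i 1 = transpose S *v (S *v axis i 1)"
      by (simp add: that(2) matrix_vector_mul_assoc)
    also have "\<dots> = axis i 1" by (simp add: matrix_vector_mul_assoc rotation_matrix_inverse[OF that(1)])
    finally show ?thesis .
  qed
  obtain a b where ab: "norm a = 1" "norm b = 1" "qrot a b *v axis 1 1 = Q *v axis 1 1" "qrot a b *v axis 2 1 = Q *v axis 2 1"
  proof -
    have "norm (Q *v axis 1 1) = 1" "norm (Q *v axis 2 1) = 1" "(Q *v axis 1 1) \<bullet> (Q *v axis 2 1) = 0"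
      by (simp_all add: norm_eq_1 orth[OF Q])
    from qrot_frame_exists[OF this] that show thesis by blast
  qed
  define M where "M = transpose (qrot a b) ** Q"
  have rS: "rotation_matrix (qrot a b)" using ab by (intro rotation_qrot)
  have rM: "rotation_matrix M" unfolding M_def using rS Q by (intro rotation_matrix_mult rotation_matrix_transpose)
  have M1: "M *v axis 1 1 = axis 1 1" "M *v axis 2 1 = axis 2 1"
    unfolding M_def by (rule fix_mult[OF rS ab(3)], rule fix_mult[OF rS ab(4)])
  define w where "w = M *v axis 3 1"
  have w: "w $ 1 = 0" "w $ 2 = 0" "w \<bullet> w = 1"
    using orth[OF rM, of 3 1] orth[OF rM, of 3 2] orth[OF rM, of 3 3] unfolding M1 w_def[symmetric] by (simp_all add: inner_axis)
  then have "(w $ 3)\<^sup>2 + (w $ 4)\<^sup>2 = 1" by (simp add: inner_vec4 power2_eq_square)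
  then obtain c where c: "norm c = 1" "qrot c c *v axis 1 1 = axis 1 1" "qrot c c *v axis 2 1 = axis 2 1" "qrot c c *v axis 3 1 = w"
  proof -
    assume *: "(w $ 3)\<^sup>2 + (w $ 4)\<^sup>2 = 1"
    have "vec4 0 0 (w $ 3) (w $ 4) = w" using w by (simp add: vec4_eq_iff)
    with qrot_plane_exists[OF *] that show thesis by auto
  qed
  define N where "N = transpose (qrot c c) ** M"
  have rT: "rotation_matrix (qrot c c)" using c by (intro rotation_qrot)
  have rN: "rotation_matrix N" unfolding N_def using rT rM by (intro rotation_matrix_mult rotation_matrix_transpose)
  have N1: "N *v axis 1 1 = axis 1 1" "N *v axis 2 1 = axis 2 1" "N *v axis 3 1 = axis 3 1"
    unfolding N_def using c M1 by (auto intro!: fix_mult[OF rT] simp: w_def)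
  define z where "z = N *v axis 4 1"
  have z: "z $ 1 = 0" "z $ 2 = 0" "z $ 3 = 0"
    using orth[OF rN, of 4 1] orth[OF rN, of 4 2] orth[OF rN, of 4 3] unfolding N1 z_def[symmetric] by (simp_all add: inner_axis)
  have col: "N $ i $ j = (N *v axis j 1) $ i" for i j by (simp add: matrix_vector_mult_basis column_def)
  have diag: "N $ i $ j = (if i = j then (if i = 4 then z $ 4 else 1) else 0)" for i j
  proof -
    have "\<forall>i j. (N *v axis j 1) $ i = (if i = j then (if i = 4 then z $ 4 else 1) else 0)"
      unfolding forall_4 N1 z_def[symmetric] using z by simp
    then show ?thesis by (simp add: col)
  qed
  have "det N = prod (\<lambda>i. N $ i $ i) UNIV" by (rule det_diagonal) (simp add: diag)
  also have "\<dots> = z $ 4" unfolding UNIV_4 by (simp add: diag)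
  finally have "z $ 4 = 1" using rN by (simp add: rotation_matrix_def)
  then have "N = mat 1" by (simp add: vec_eq_iff diag mat_def)
  have cancel: "S ** (transpose S ** X) = X" if "rotation_matrix S" for S X :: "real^4^4"
    by (simp add: matrix_mul_assoc rotation_matrix_inverse[OF that])
  have "M = qrot c c ** N" unfolding N_def by (rule cancel[OF rT, symmetric])
  then have "M = qrot c c" using \<open>N = mat 1\<close> by simp
  moreover have "Q = qrot a b ** M" unfolding M_def by (rule cancel[OF rS, symmetric])
  ultimately have "Q = qrot a b ** qrot c c" by simp
  then show ?thesis using ab c
    by (intro exI[of _ "qmult a c"] exI[of _ "qmult b c"]) (simp add: qrot_mult)
qed

section \<open>Haar measure on the rotation group\<close>

lemma matrix_matrix_mult_continuous [continuous_intros]: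
  fixes f :: "'a::topological_space \<Rightarrow> real^'n^'m" and g :: "'a \<Rightarrow> real^'k^'n"
  assumes "continuous_on S f" "continuous_on S g"
  shows "continuous_on S (\<lambda>x. f x ** g x)"
  unfolding matrix_matrix_mult_def using assms
  by (intro continuous_on_vec_lambda continuous_on_sum continuous_on_mult continuous_on_component)

lemma matrix_vector_mult_continuous [continuous_intros]:
  fixes f :: "'a::topological_space \<Rightarrow> real^'n^'m" and g :: "'a \<Rightarrow> real^'n"
  assumes "continuous_on S f" "continuous_on S g"
  shows "continuous_on S (\<lambda>x. f x *v g x)"
  unfolding matrix_vector_mult_def using assms
  by (intro continuous_on_vec_lambda continuous_on_sum continuous_on_mult continuous_on_component)

lemma transpose_continuous [continuous_intros]:
  fixes f :: "'a::topological_space \<Rightarrow> real^'n^'m"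
  assumes "continuous_on S f"
  shows "continuous_on S (\<lambda>x. transpose (f x))"
  unfolding transpose_def using assms
  by (intro continuous_on_vec_lambda continuous_on_component)

lemma borel_measurable_matrix_matrix_mult [measurable (raw)]:
  fixes f :: "'a \<Rightarrow> real^'n^'m" and g :: "'a \<Rightarrow> real^'k^'n"
  assumes "f \<in> borel_measurable M" "g \<in> borel_measurable M"
  shows "(\<lambda>x. f x ** g x) \<in> borel_measurable M"
  by (rule borel_measurable_continuous_Pair[OF assms]) (intro continuous_intros)

lemma borel_measurable_matrix_vector_mult [measurable (raw)]:
  fixes f :: "'a \<Rightarrow> real^'n^'m" and g :: "'a \<Rightarrow> real^'n"
  assumes "f \<in> borel_measurable M" "g \<in> borel_measurable M"
  shows "(\<lambda>x. f x *v g x) \<in> borel_measurable M"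
  by (rule borel_measurable_continuous_Pair[OF assms]) (intro continuous_intros)

lemma borel_measurable_transpose [measurable (raw)]:
  fixes f :: "'a \<Rightarrow> real^'n^'m"
  assumes "f \<in> borel_measurable M"
  shows "(\<lambda>x. transpose (f x)) \<in> borel_measurable M"
proof -
  have "(\<lambda>A::real^'n^'m. transpose A) \<in> borel_measurable borel"
    by (intro borel_measurable_continuous_onI continuous_intros)
  from measurable_compose[OF assms this] show ?thesis .
qed

lemma closed_rotation_matrices: "closed {R :: real^'n^'n. rotation_matrix R}"
proof -
  have det: "continuous_on UNIV (\<lambda>R :: real^'n^'n. det R)"
    unfolding det_def by (intro continuous_intros continuous_on_component)
  have "{R :: real^'n^'n. rotation_matrix R} = {R. transpose R ** R = mat 1} \<inter> {R. det R = 1}"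
    by (auto simp: rotation_matrix_def orthogonal_matrix)
  then show ?thesis by (auto intro!: closed_Int closed_Collect_eq continuous_intros det)
qed

lemma measurable_rotation_matrix [measurable]: "Measurable.pred borel (\<lambda>R :: real^'n^'n. rotation_matrix R)"
  using borel_closed[OF closed_rotation_matrices] by (simp add: pred_def)

lemma distr_lborel_rotation:
  fixes Q :: "real^'n::{finite,wellorder}^'n::{finite,wellorder}"
  assumes Q: "rotation_matrix Q"
  shows "distr lborel borel (\<lambda>x. Q *v x) = lborel"
proof (rule lborel_eqI[symmetric])
  fix l u :: "real^'n::{finite,wellorder}" assume le: "\<And>b. b \<in> Basis \<Longrightarrow> l \<bullet> b \<le> u \<bullet> b"
  have inv: "transpose Q *v (Q *v x) = x" "Q *v (transpose Q *v x) = x" for x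
    by (simp_all add: matrix_vector_mul_assoc rotation_matrix_inverse[OF Q] del: transpose_matrix_vector)
  have ot: "orthogonal_transformation (\<lambda>x. transpose Q *v x)"
    unfolding orthogonal_transformation using rotation_matrix_norm[OF rotation_matrix_transpose[OF Q]] by simp
  have pre: "(\<lambda>x. Q *v x) -` box l u = (\<lambda>x. transpose Q *v x) ` box l u"
    unfolding set_eq_iff image_iff vimage_eq using inv by metis
  have m: "(\<lambda>x. Q *v x) -` box l u \<in> sets borel"
    using measurable_sets_borel[of "\<lambda>x. Q *v x" borel "box l u"] by simp
  have lm: "box l u \<in> lmeasurable" by simp
  have "emeasure (distr lborel borel (\<lambda>x. Q *v x)) (box l u) = emeasure lborel ((\<lambda>x. Q *v x) -` box l u)"
    by (subst emeasure_distr) auto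
  also have "\<dots> = emeasure lebesgue ((\<lambda>x. transpose Q *v x) ` box l u)"
    using m unfolding pre by simp
  also have "\<dots> = ennreal (measure lebesgue ((\<lambda>x. transpose Q *v x) ` box l u))"
    using measurable_orthogonal_image[OF ot lm] by (intro emeasure_eq_measure2)
  also have "\<dots> = ennreal (measure lebesgue (box l u))" unfolding measure_orthogonal_image[OF ot lm] by (rule refl)
  also have "\<dots> = (\<Prod>b\<in>Basis. (u - l) \<bullet> b)"
    using le by (simp add: measure_lborel_box_eq inner_diff_left)
  finally show "emeasure (distr lborel borel (\<lambda>x. Q *v x)) (box l u) = (\<Prod>b\<in>Basis. (u - l) \<bullet> b)" .
qed simp

lemma nn_integral_lborel_rotation:
  fixes Q :: "real^'n::{finite,wellorder}^'n::{finite,wellorder}" and f :: "real^'n::{finite,wellorder} \<Rightarrow> ennreal"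
  assumes Q: "rotation_matrix Q" and [measurable]: "f \<in> borel_measurable borel"
  shows "(\<integral>\<^sup>+x. f (Q *v x) \<partial>lborel) = (\<integral>\<^sup>+x. f x \<partial>lborel)"
proof -
  have "(\<integral>\<^sup>+x. f x \<partial>lborel) = (\<integral>\<^sup>+x. f x \<partial>distr lborel borel (\<lambda>x. Q *v x))"
    by (simp add: distr_lborel_rotation[OF Q])
  also have "\<dots> = (\<integral>\<^sup>+x. f (Q *v x) \<partial>lborel)" by (rule nn_integral_distr) measurable
  finally show ?thesis by simp
qed

section \<open>Haar measure from two independent random unit quaternions\<close>

definition ball4 :: "(real^4) measure" where
  "ball4 = uniform_measure lborel (cball 0 1)"

text \<open>The value at 0 is arbitrary but of norm 1, so that \<open>qrot\<close> of two such
  values is a rotation everywhere; the origin is a null set.\<close>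

definition qnorm :: "real^4 \<Rightarrow> real^4" where
  "qnorm x = (if x = 0 then axis 1 1 else x /\<^sub>R norm x)"

text \<open>A uniform point of the unit ball has a uniform direction, so Lebesgue measure supplies
  the random unit quaternions. The result is a Borel measure on all 4 by 4 matrices that is carried
  by the rotations.\<close>

definition rot_haar :: "(real^4^4) measure" where
  "rot_haar = distr (ball4 \<Otimes>\<^sub>M ball4) borel (\<lambda>p. qrot (qnorm (fst p)) (qnorm (snd p)))"

lemma emeasure_unit_ball4: "emeasure lborel (cball (0::real^4) 1) = ennreal (pi\<^sup>2 / 2)"
  by (simp add: emeasure_cball unit_ball_vol_4)

lemma emeasure_ball4_UNIV: "emeasure ball4 UNIV = 1"
proof -
  have "emeasure ball4 UNIV = emeasure lborel (cball (0::real^4) 1) / emeasure lborel (cball (0::real^4) 1)"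
    unfolding ball4_def by (subst emeasure_uniform_measure) auto
  also have "\<dots> = 1" unfolding emeasure_unit_ball4 by (intro ennreal_divide_self) auto
  finally show ?thesis .
qed

lemma sets_ball4 [simp, measurable_cong]: "sets ball4 = sets borel"
  by (simp add: ball4_def)

lemma space_ball4 [simp]: "space ball4 = UNIV"
  by (simp add: ball4_def)

interpretation ball4: finite_measure ball4
  by (rule finite_measureI) (simp add: emeasure_ball4_UNIV)

lemma norm_qnorm [simp]: "norm (qnorm x) = 1"
  by (simp add: qnorm_def)

lemma measurable_qnorm [measurable]: "qnorm \<in> borel_measurable borel"
  unfolding qnorm_def by measurable

lemma AE_ball4: "AE x in ball4. x \<noteq> 0"
  unfolding ball4_def
proof (rule AE_uniform_measureI)
  show "AE x in lborel. x \<in> cball 0 1 \<longrightarrow> x \<noteq> (0::real^4)"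
    using AE_lborel_singleton[of 0] by eventually_elim simp
qed simp

lemma nn_integral_ball4_rotation:
  assumes Q: "rotation_matrix (Q :: real^4^4)" and [measurable]: "f \<in> borel_measurable borel"
  shows "(\<integral>\<^sup>+x. f (Q *v x) \<partial>ball4) = (\<integral>\<^sup>+x. f x \<partial>ball4)"
proof -
  have "(\<integral>\<^sup>+x. f (Q *v x) * indicator (cball 0 1) x \<partial>lborel) =
    (\<integral>\<^sup>+x. f (Q *v x) * indicator (cball 0 1) (Q *v x) \<partial>lborel)"
    by (intro nn_integral_cong) (simp add: indicator_def rotation_matrix_norm[OF Q])
  also have "\<dots> = (\<integral>\<^sup>+x. f x * indicator (cball 0 1) x \<partial>lborel)"
    by (rule nn_integral_lborel_rotation[OF Q]) (auto intro!: borel_measurable_times_ennreal borel_measurable_indicator)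
  finally show ?thesis unfolding ball4_def by (simp add: nn_integral_uniform_measure)
qed

lemma measurable_qrot [measurable (raw)]:
  assumes "f \<in> borel_measurable M" "g \<in> borel_measurable M"
  shows "(\<lambda>x. qrot (f x) (g x)) \<in> borel_measurable M"
proof (rule borel_measurable_continuous_Pair[OF assms])
  have "qrot a b = (\<chi> i j. qmult (qmult a (axis j 1)) (qconj b) $ i)" for a b
    by (simp add: qrot_def matrix_def)
  moreover have "continuous_on UNIV (\<lambda>p. qmult (qmult (fst p) (axis j 1)) (qconj (snd p)) $ i)" for i j :: 4
  proof -
    have "\<forall>i. continuous_on UNIV (\<lambda>p. qmult (qmult (fst p) (axis j 1)) (qconj (snd p)) $ i)"
      unfolding forall_4 by (simp add: qmult_def qconj_def) (intro conjI continuous_intros continuous_on_component)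
    then show ?thesis by blast
  qed
  ultimately show "continuous_on UNIV (\<lambda>p. qrot (fst p) (snd p))"
    by (simp add: continuous_on_vec_lambda)
qed

lemma sets_rot_haar [simp, measurable_cong]: "sets rot_haar = sets borel"
  by (simp add: rot_haar_def)

lemma space_rot_haar [simp]: "space rot_haar = UNIV"
  by (simp add: rot_haar_def)

lemma emeasure_rot_haar_UNIV: "emeasure rot_haar UNIV = 1"
proof -
  have "emeasure rot_haar UNIV = emeasure (ball4 \<Otimes>\<^sub>M ball4) (UNIV \<times> UNIV)"
    unfolding rot_haar_def by (subst emeasure_distr) (auto simp: space_pair_measure)
  also have "\<dots> = 1" by (subst ball4.emeasure_pair_measure_Times) (auto simp: emeasure_ball4_UNIV)
  finally show ?thesis .
qed

interpretation rot_haar: finite_measure rot_haar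
  by (rule finite_measureI) (simp add: emeasure_rot_haar_UNIV)

lemma AE_rot_haar: "AE R in rot_haar. rotation_matrix R"
  unfolding rot_haar_def by (subst AE_distr_iff) (auto simp: rotation_qrot)

lemma nn_integral_rot_haar:
  assumes [measurable]: "f \<in> borel_measurable borel"
  shows "(\<integral>\<^sup>+R. f R \<partial>rot_haar) = (\<integral>\<^sup>+x. (\<integral>\<^sup>+y. f (qrot (qnorm x) (qnorm y)) \<partial>ball4) \<partial>ball4)"
  unfolding rot_haar_def by (subst nn_integral_distr) (auto simp: ball4.nn_integral_fst[symmetric])

text \<open>Multiplication by a rotation replaces the two quaternions by quaternions obtained from
  them by orthogonal maps.\<close>

lemma nn_integral_rot_haar_qmult:
  assumes [measurable]: "f \<in> borel_measurable borel"
    and S: "rotation_matrix S" "\<And>x. x \<noteq> 0 \<Longrightarrow> qnorm (S *v x) = s (qnorm x)"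
    and T: "rotation_matrix T" "\<And>x. x \<noteq> 0 \<Longrightarrow> qnorm (T *v x) = t (qnorm x)"
  shows "(\<integral>\<^sup>+x. (\<integral>\<^sup>+y. f (qrot (s (qnorm x)) (t (qnorm y))) \<partial>ball4) \<partial>ball4) = (\<integral>\<^sup>+R. f R \<partial>rot_haar)"
proof -
  have "(\<integral>\<^sup>+x. (\<integral>\<^sup>+y. f (qrot (s (qnorm x)) (t (qnorm y))) \<partial>ball4) \<partial>ball4) =
    (\<integral>\<^sup>+x. (\<integral>\<^sup>+y. f (qrot (qnorm (S *v x)) (qnorm (T *v y))) \<partial>ball4) \<partial>ball4)"
  proof (rule nn_integral_cong_AE)
    show "AE x in ball4. (\<integral>\<^sup>+y. f (qrot (s (qnorm x)) (t (qnorm y))) \<partial>ball4) =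
       (\<integral>\<^sup>+y. f (qrot (qnorm (S *v x)) (qnorm (T *v y))) \<partial>ball4)"
      using AE_ball4
    proof eventually_elim
      case (elim x)
      then show ?case
        using AE_ball4 by (intro nn_integral_cong_AE) (auto elim!: eventually_mono simp: S T)
    qed
  qed
  also have "\<dots> = (\<integral>\<^sup>+x. (\<integral>\<^sup>+y. f (qrot (qnorm (S *v x)) (qnorm y)) \<partial>ball4) \<partial>ball4)"
    by (intro nn_integral_cong nn_integral_ball4_rotation[OF T(1)]) measurable
  also have "\<dots> = (\<integral>\<^sup>+x. (\<integral>\<^sup>+y. f (qrot (qnorm x) (qnorm y)) \<partial>ball4) \<partial>ball4)"
    by (rule nn_integral_ball4_rotation[OF S(1)]) measurable
  also have "\<dots> = (\<integral>\<^sup>+R. f R \<partial>rot_haar)" by (rule nn_integral_rot_haar[symmetric]) measurable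
  finally show ?thesis .
qed

lemma qnorm_qmult:
  assumes "norm a = 1" "x \<noteq> 0"
  shows "qnorm (qmult a x) = qmult a (qnorm x)" "qnorm (qmult x a) = qmult (qnorm x) a"
proof -
  have "norm (qmult a x) \<noteq> 0" "norm (qmult x a) \<noteq> 0" unfolding norm_qmult using assms by auto
  then have "qmult a x \<noteq> 0" "qmult x a \<noteq> 0" by (metis norm_zero)+
  then show "qnorm (qmult a x) = qmult a (qnorm x)" "qnorm (qmult x a) = qmult (qnorm x) a"
    using assms by (simp_all add: qnorm_def qmult_linear)
qed

lemma nn_integral_rot_haar_left:
  assumes f: "f \<in> borel_measurable borel" and S: "rotation_matrix S"
  shows "(\<integral>\<^sup>+R. f (S ** R) \<partial>rot_haar) = (\<integral>\<^sup>+R. f R \<partial>rot_haar)"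
proof -
  note [measurable] = f
  obtain a b where ab: "norm a = 1" "norm b = 1" "S = qrot a b" using rotation_matrix_eq_qrot[OF S] by blast
  have L: "qrot c (axis 1 1) *v x = qmult c x" "rotation_matrix (qrot c (axis 1 1))" if "norm c = 1" for c x
    using that by (auto simp: qrot_mult_vec intro!: rotation_qrot)
  have "(\<integral>\<^sup>+R. f (S ** R) \<partial>rot_haar) =
    (\<integral>\<^sup>+x. (\<integral>\<^sup>+y. f (qrot (qmult a (qnorm x)) (qmult b (qnorm y))) \<partial>ball4) \<partial>ball4)"
    by (subst nn_integral_rot_haar) (auto simp: ab qrot_mult)
  also have "\<dots> = (\<integral>\<^sup>+R. f R \<partial>rot_haar)"
    by (rule nn_integral_rot_haar_qmult[OF f, of "qrot a (axis 1 1)" _ "qrot b (axis 1 1)"])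
      (use ab in \<open>auto simp: L qnorm_qmult\<close>)
  finally show ?thesis .
qed

text \<open>Right multiplication of each quaternion by a fixed unit is again a rotation of
  four-space. Left invariance gives the invariance of the induced measures on the Grassmannians;
  right invariance allows a change of frame by \<open>R ** S\<close>, on which uniqueness and the
  averaging arguments rest.\<close>

lemma nn_integral_rot_haar_right:
  assumes f: "f \<in> borel_measurable borel" and S: "rotation_matrix S"
  shows "(\<integral>\<^sup>+R. f (R ** S) \<partial>rot_haar) = (\<integral>\<^sup>+R. f R \<partial>rot_haar)"
proof -
  note [measurable] = f
  obtain a b where ab: "norm a = 1" "norm b = 1" "S = qrot a b" using rotation_matrix_eq_qrot[OF S] by blast
  have L: "qrot (axis 1 1) (qconj c) *v x = qmult x c" "rotation_matrix (qrot (axis 1 1) (qconj c))" if "norm c = 1" for c x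
    using that by (auto simp: qrot_mult_vec intro!: rotation_qrot)
  have "(\<integral>\<^sup>+R. f (R ** S) \<partial>rot_haar) =
    (\<integral>\<^sup>+x. (\<integral>\<^sup>+y. f (qrot (qmult (qnorm x) a) (qmult (qnorm y) b)) \<partial>ball4) \<partial>ball4)"
    by (subst nn_integral_rot_haar) (auto simp: ab qrot_mult)
  also have "\<dots> = (\<integral>\<^sup>+R. f R \<partial>rot_haar)"
    by (rule nn_integral_rot_haar_qmult[OF f, of "qrot (axis 1 1) (qconj a)" "\<lambda>x. qmult x a" "qrot (axis 1 1) (qconj b)" "\<lambda>x. qmult x b"])
      (use ab in \<open>auto simp: L qnorm_qmult\<close>)
  finally show ?thesis .
qed

section \<open>The invariant measure on the Grassmannian\<close>

lemma orth_proj_eqI: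
  assumes F: "subspace F" and y: "y \<in> F" "\<And>z. z \<in> F \<Longrightarrow> orthogonal (x - y) z"
  shows "orth_proj F x = y"
  unfolding orth_proj_def
proof (rule the_equality)
  fix y' assume y': "y' \<in> F \<and> (\<forall>z\<in>F. orthogonal (x - y') z)"
  have "y' - y \<in> F" using F y y' by (simp add: subspace_diff)
  then have "orthogonal (x - y) (y' - y)" "orthogonal (x - y') (y' - y)" using y y' by auto
  then have "(y' - y) \<bullet> (y' - y) = 0" by (simp add: orthogonal_def inner_diff_left inner_diff_right)
  then show "y' = y" by simp
qed (use y in auto)

lemma
  assumes F: "subspace F"
  shows orth_proj_in: "orth_proj F x \<in> F"
    and orth_proj_orthogonal: "z \<in> F \<Longrightarrow> orthogonal (x - orth_proj F x) z"
proof -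
  obtain y d where yd: "y \<in> span F" "\<And>w. w \<in> span F \<Longrightarrow> orthogonal d w" "x = y + d"
    using orthogonal_subspace_decomp_exists[of F x] by blast
  have "span F = F" using F by (simp add: span_eq_iff)
  then have y: "y \<in> F" "\<And>w. w \<in> F \<Longrightarrow> orthogonal (x - y) w"
    using yd by (simp_all only: add_diff_cancel_left')
  have "orth_proj F x = y" using orth_proj_eqI[OF F y] .
  then show "orth_proj F x \<in> F" "z \<in> F \<Longrightarrow> orthogonal (x - orth_proj F x) z" using y by auto
qed

lemma linear_orth_proj:
  assumes F: "subspace F"
  shows "linear (orth_proj F)"
proof (rule linearI)
  note P = orth_proj_in[OF F] orth_proj_orthogonal[OF F, unfolded orthogonal_def]
  show "orth_proj F (x + y) = orth_proj F x + orth_proj F y" for x y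
  proof (rule orth_proj_eqI[OF F])
    fix z assume z: "z \<in> F"
    have "x + y - (orth_proj F x + orth_proj F y) = (x - orth_proj F x) + (y - orth_proj F y)" by simp
    then show "orthogonal (x + y - (orth_proj F x + orth_proj F y)) z"
      using P(2)[OF z, of x] P(2)[OF z, of y] by (simp only: orthogonal_def inner_add_left)
  qed (use P(1) in \<open>simp add: subspace_add[OF F]\<close>)
  show "orth_proj F (c *\<^sub>R x) = c *\<^sub>R orth_proj F x" for c x
  proof (rule orth_proj_eqI[OF F])
    fix z assume "z \<in> F"
    then show "orthogonal (c *\<^sub>R x - c *\<^sub>R orth_proj F x) z"
      using P(2)[of z x] by (simp add: orthogonal_def scaleR_diff_right[symmetric] del: scaleR_diff_right)
  qed (use P(1) in \<open>simp add: subspace_scale[OF F]\<close>)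
qed

lemma matrix_orth_proj:
  fixes F :: "(real^'n) set"
  assumes "subspace F"
  shows "matrix (orth_proj F) *v x = orth_proj F x"
  using fun_cong[OF matrix_vector_mul(2)[OF linear_orth_proj[OF assms]]] .

lemma subspace_rotation_image:
  fixes F :: "(real^'n) set"
  shows "subspace F \<Longrightarrow> subspace ((\<lambda>x. R *v x) ` F)"
  by (rule linear_subspace_image) auto

lemma orth_proj_rotation:
  fixes F :: "(real^'n) set"
  assumes R: "rotation_matrix R" and F: "subspace F"
  shows "orth_proj ((\<lambda>x. R *v x) ` F) (R *v x) = R *v orth_proj F x"
proof (rule orth_proj_eqI)
  show "subspace ((\<lambda>x. R *v x) ` F)" by (rule subspace_rotation_image[OF F])
  show "R *v orth_proj F x \<in> (\<lambda>x. R *v x) ` F" using orth_proj_in[OF F] by simp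
  fix z assume "z \<in> (\<lambda>x. R *v x) ` F"
  then obtain w where w: "w \<in> F" "z = R *v w" by blast
  have "(R *v x - R *v orth_proj F x) \<bullet> z = (x - orth_proj F x) \<bullet> w"
    unfolding w(2) matrix_vector_mult_diff_distrib[symmetric] by (rule rotation_matrix_inner[OF R])
  then show "orthogonal (R *v x - R *v orth_proj F x) z"
    using orth_proj_orthogonal[OF F w(1)] by (simp add: orthogonal_def)
qed

lemma matrix_orth_proj_rotation:
  fixes F :: "(real^'n) set"
  assumes R: "rotation_matrix R" and F: "subspace F"
  shows "matrix (orth_proj ((\<lambda>x. R *v x) ` F)) = R ** matrix (orth_proj F) ** transpose R"
proof -
  have "matrix (orth_proj ((\<lambda>x. R *v x) ` F)) *v x = (R ** matrix (orth_proj F) ** transpose R) *v x" for x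
  proof -
    have x: "x = R *v (transpose R *v x)"
      by (simp add: matrix_vector_mul_assoc rotation_matrix_inverse[OF R] del: transpose_matrix_vector)
    have "matrix (orth_proj ((\<lambda>x. R *v x) ` F)) *v x = orth_proj ((\<lambda>x. R *v x) ` F) (R *v (transpose R *v x))"
      using x by (simp add: matrix_orth_proj[OF subspace_rotation_image[OF F]] del: transpose_matrix_vector)
    also have "\<dots> = R *v (matrix (orth_proj F) *v (transpose R *v x))"
      by (simp add: orth_proj_rotation[OF R F] matrix_orth_proj[OF F] del: transpose_matrix_vector)
    finally show ?thesis by (simp only: matrix_vector_mul_assoc matrix_mul_assoc)
  qed
  then show ?thesis by (simp add: matrix_eq)
qed

lemma grassmannian_rotation:
  fixes F :: "(real^'n) set"
  assumes R: "rotation_matrix R" and F: "F \<in> grassmannian k"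
  shows "(\<lambda>x. R *v x) ` F \<in> grassmannian k"
proof -
  have "inj (\<lambda>x. R *v x)"
    by (rule inj_on_inverseI[of _ "\<lambda>x. transpose R *v x"])
      (simp add: matrix_vector_mul_assoc rotation_matrix_inverse[OF R] del: transpose_matrix_vector)
  then have "dim ((\<lambda>x. R *v x) ` F) = dim F"
    by (intro dim_image_eq) (auto intro: inj_on_subset)
  then show ?thesis using F by (simp add: grassmannian_def subspace_rotation_image)
qed

text \<open>Matrices that are not rotations act trivially, so that this is a total measurable action
  on the Grassmannian although \<open>rot_haar\<close> lives on all matrices.\<close>

definition rot_act :: "real^'n^'n \<Rightarrow> (real^'n) set \<Rightarrow> (real^'n) set" where
  "rot_act R F = (if rotation_matrix R then (\<lambda>x. R *v x) ` F else F)"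

lemma rot_act_mult:
  "rotation_matrix R \<Longrightarrow> rotation_matrix S \<Longrightarrow> rot_act R (rot_act S F) = rot_act (R ** S) F"
  by (simp add: rot_act_def rotation_matrix_mult image_image matrix_vector_mul_assoc)

lemma space_grassmannian_borel [simp]: "space (grassmannian_borel k) = grassmannian k"
  by (simp add: grassmannian_borel_def)

lemma measurable_matrix_orth_proj [measurable]:
  "(\<lambda>F. matrix (orth_proj F)) \<in> borel_measurable (grassmannian_borel k)"
  unfolding grassmannian_borel_def by (rule measurable_vimage_algebra1) simp

lemma measurable_rot_act [measurable (raw)]:
  assumes R[measurable]: "R \<in> borel_measurable M" and F[measurable]: "F \<in> M \<rightarrow>\<^sub>M grassmannian_borel k"
  shows "(\<lambda>x. rot_act (R x) (F x)) \<in> M \<rightarrow>\<^sub>M grassmannian_borel k"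
proof -
  have FG: "F x \<in> grassmannian k" if "x \<in> space M" for x using measurable_space[OF F that] by simp
  have "(\<lambda>x. matrix (orth_proj (rot_act (R x) (F x)))) \<in> borel_measurable M \<longleftrightarrow>
    (\<lambda>x. if rotation_matrix (R x) then R x ** matrix (orth_proj (F x)) ** transpose (R x) else matrix (orth_proj (F x))) \<in> borel_measurable M"
    using FG by (intro measurable_cong) (auto simp: rot_act_def matrix_orth_proj_rotation grassmannian_def)
  moreover have "\<dots>" by measurable
  moreover have "rot_act (R x) (F x) \<in> grassmannian k" if "x \<in> space M" for x
    using FG[OF that] grassmannian_rotation[of "R x" "F x" k] by (simp add: rot_act_def)
  ultimately show ?thesis
    unfolding grassmannian_borel_def by (intro measurable_vimage_algebra2) auto
qed

text \<open>Uniqueness: averaging an invariant measure over all rotations gives the image of Haar measure.\<close>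

lemma grassmannian_measure_eq_distr:
  fixes F0 :: "(real^4) set"
  assumes F0: "F0 \<in> grassmannian k"
    and trans: "\<And>F. F \<in> grassmannian k \<Longrightarrow> \<exists>S. rotation_matrix S \<and> F = (\<lambda>x. S *v x) ` F0"
  shows "grassmannian_measure k = distr rot_haar (grassmannian_borel k) (\<lambda>R. rot_act R F0)"
proof -
  let ?N = "grassmannian_borel k :: (real^4) set measure"
  define \<nu> where "\<nu> = distr rot_haar ?N (\<lambda>R. rot_act R F0)"
  have F0m[measurable]: "(\<lambda>_. F0) \<in> M \<rightarrow>\<^sub>M ?N" for M :: "'b measure" using F0 by simp
  have act0[measurable]: "(\<lambda>R. rot_act R F0) \<in> borel \<rightarrow>\<^sub>M ?N" by measurable
  \<comment> \<open>Right invariance absorbs \<open>S\<close>: the average over an orbit does not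
    depend on the subspace it starts from.\<close>
  have right: "(\<integral>\<^sup>+R. indicator A (rot_act R (rot_act S F0)) \<partial>rot_haar) = emeasure \<nu> A"
    if [measurable]: "A \<in> sets ?N" and S: "rotation_matrix S" for A S
  proof -
    have "(\<integral>\<^sup>+R. indicator A (rot_act R (rot_act S F0)) \<partial>rot_haar) = (\<integral>\<^sup>+R. indicator A (rot_act (R ** S) F0) \<partial>rot_haar)"
      using AE_rot_haar by (intro nn_integral_cong_AE) (auto elim!: eventually_mono simp: rot_act_mult S)
    also have "\<dots> = (\<integral>\<^sup>+R. indicator A (rot_act R F0) \<partial>rot_haar)"
      by (rule nn_integral_rot_haar_right[OF _ S]) measurable
    also have "\<dots> = (\<integral>\<^sup>+F. indicator A F \<partial>\<nu>)" unfolding \<nu>_def by (subst nn_integral_distr) auto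
    finally show ?thesis by (simp add: \<nu>_def)
  qed
  \<comment> \<open>This is the rotation invariance of \<nu>.\<close>
  have left: "(\<integral>\<^sup>+R. indicator A (rot_act S (rot_act R F0)) \<partial>rot_haar) = emeasure \<nu> A"
    if [measurable]: "A \<in> sets ?N" and S: "rotation_matrix S" for A S
  proof -
    have "(\<integral>\<^sup>+R. indicator A (rot_act S (rot_act R F0)) \<partial>rot_haar) = (\<integral>\<^sup>+R. indicator A (rot_act (S ** R) F0) \<partial>rot_haar)"
      using AE_rot_haar by (intro nn_integral_cong_AE) (auto elim!: eventually_mono simp: rot_act_mult S)
    also have "\<dots> = (\<integral>\<^sup>+R. indicator A (rot_act R F0) \<partial>rot_haar)"
      by (rule nn_integral_rot_haar_left[OF _ S]) measurable
    also have "\<dots> = (\<integral>\<^sup>+F. indicator A F \<partial>\<nu>)" unfolding \<nu>_def by (subst nn_integral_distr) auto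
    finally show ?thesis by (simp add: \<nu>_def)
  qed
  have total: "emeasure \<nu> (grassmannian k) = 1"
  proof -
    have "emeasure \<nu> (space ?N) = emeasure rot_haar ((\<lambda>R. rot_act R F0) -` space ?N \<inter> space rot_haar)"
      unfolding \<nu>_def by (rule emeasure_distr[OF _ sets.top]) measurable
    also have "(\<lambda>R. rot_act R F0) -` space ?N \<inter> space rot_haar = UNIV"
      using measurable_space[OF act0] by auto
    finally show ?thesis by (simp add: emeasure_rot_haar_UNIV)
  qed
  have Qm: "(\<lambda>F. (\<lambda>x. Q *v x) ` F) \<in> M \<rightarrow>\<^sub>M M"
    if "rotation_matrix Q" "sets M = sets ?N" for M and Q :: "real^4^4"
  proof -
    have "(\<lambda>F. rot_act Q F) \<in> ?N \<rightarrow>\<^sub>M ?N" by measurable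
    then show ?thesis using that by (simp add: rot_act_def cong: measurable_cong_sets)
  qed
  have "grassmannian_measure k = \<nu>"
    unfolding grassmannian_measure_def
  proof (rule the_equality)
    show "rotation_invariant_prob k \<nu>"
      unfolding rotation_invariant_prob_def
    proof (intro conjI allI impI)
      show sets: "sets \<nu> = sets ?N" by (simp add: \<nu>_def)
      show "emeasure \<nu> (space \<nu>) = 1" using total by (simp add: \<nu>_def)
      fix Q :: "real^4^4" assume Q: "rotation_matrix Q"
      show "distr \<nu> \<nu> (\<lambda>F. (\<lambda>x. Q *v x) ` F) = \<nu>"
      proof (rule measure_eqI)
        fix A assume "A \<in> sets (distr \<nu> \<nu> (\<lambda>F. (\<lambda>x. Q *v x) ` F))"
        then have A[measurable]: "A \<in> sets ?N" by (simp add: sets)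
        have "emeasure (distr \<nu> \<nu> (\<lambda>F. (\<lambda>x. Q *v x) ` F)) A = (\<integral>\<^sup>+F. indicator A F \<partial>distr \<nu> \<nu> (\<lambda>F. (\<lambda>x. Q *v x) ` F))"
          using A sets by simp
        also have "\<dots> = (\<integral>\<^sup>+F. indicator A ((\<lambda>x. Q *v x) ` F) \<partial>\<nu>)"
          using A sets by (intro nn_integral_distr Qm[OF Q sets]) (simp cong: measurable_cong_sets)
        also have "\<dots> = (\<integral>\<^sup>+F. indicator A (rot_act Q F) \<partial>\<nu>)" using Q by (simp add: rot_act_def)
        also have "\<dots> = (\<integral>\<^sup>+R. indicator A (rot_act Q (rot_act R F0)) \<partial>rot_haar)"
          unfolding \<nu>_def by (subst nn_integral_distr) auto
        also have "\<dots> = emeasure \<nu> A" by (rule left[OF A Q])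
        finally show "emeasure (distr \<nu> \<nu> (\<lambda>F. (\<lambda>x. Q *v x) ` F)) A = emeasure \<nu> A" .
      qed simp
    qed
  next
    fix \<mu> :: "(real^4) set measure" assume inv: "rotation_invariant_prob k \<mu>"
    then have sets[measurable_cong]: "sets \<mu> = sets ?N" and tot: "emeasure \<mu> (space \<mu>) = 1"
      and Qinv: "\<And>Q. rotation_matrix Q \<Longrightarrow> distr \<mu> \<mu> (\<lambda>F. (\<lambda>x. Q *v x) ` F) = \<mu>"
      by (auto simp: rotation_invariant_prob_def)
    have space: "space \<mu> = grassmannian k" using sets_eq_imp_space_eq[OF sets] by simp
    interpret \<mu>: finite_measure \<mu> by (rule finite_measureI) (simp add: tot)
    interpret P: pair_sigma_finite rot_haar \<mu> ..
    show "\<mu> = \<nu>"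
    proof (rule measure_eqI)
      fix A assume "A \<in> sets \<mu>"
      then have A[measurable]: "A \<in> sets ?N" using sets by simp
      have "emeasure \<mu> A = (\<integral>\<^sup>+R. emeasure \<mu> A \<partial>rot_haar)" by (simp add: emeasure_rot_haar_UNIV)
      also have "\<dots> = (\<integral>\<^sup>+R. (\<integral>\<^sup>+F. indicator A (rot_act R F) \<partial>\<mu>) \<partial>rot_haar)"
      proof (rule nn_integral_cong_AE, use AE_rot_haar in eventually_elim)
        case (elim R)
        have "emeasure \<mu> A = (\<integral>\<^sup>+F. indicator A F \<partial>distr \<mu> \<mu> (\<lambda>F. (\<lambda>x. R *v x) ` F))"
          using A sets by (simp add: Qinv[OF elim])
        also have "\<dots> = (\<integral>\<^sup>+F. indicator A ((\<lambda>x. R *v x) ` F) \<partial>\<mu>)"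
          using A sets by (intro nn_integral_distr Qm[OF elim sets]) (simp cong: measurable_cong_sets)
        finally show ?case using elim by (simp add: rot_act_def)
      qed
      also have "\<dots> = (\<integral>\<^sup>+F. (\<integral>\<^sup>+R. indicator A (rot_act R F) \<partial>rot_haar) \<partial>\<mu>)"
        by (rule P.Fubini'[symmetric]) measurable
      also have "\<dots> = (\<integral>\<^sup>+F. emeasure \<nu> A \<partial>\<mu>)"
      proof (rule nn_integral_cong)
        fix F assume "F \<in> space \<mu>"
        then obtain S where "rotation_matrix S" "F = (\<lambda>x. S *v x) ` F0" using trans space by blast
        then show "(\<integral>\<^sup>+R. indicator A (rot_act R F) \<partial>rot_haar) = emeasure \<nu> A"
          using right[OF A, of S] by (simp add: rot_act_def[of S])
      qed
      also have "\<dots> = emeasure \<nu> A" by (simp add: tot)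
      finally show "emeasure \<mu> A = emeasure \<nu> A" .
    qed (simp add: \<nu>_def sets)
  qed
  then show ?thesis by (simp add: \<nu>_def)
qed

section \<open>Transitivity on lines and planes\<close>

lemma rotation_frame_exists:
  fixes u v :: "real^4"
  assumes "norm u = 1" "norm v = 1" "u \<bullet> v = 0"
  shows "\<exists>S. rotation_matrix S \<and> S *v axis 1 1 = u \<and> S *v axis 2 1 = v"
  using qrot_frame_exists[OF assms] rotation_qrot by metis

lemma grassmannian_lineE:
  assumes "F \<in> grassmannian 1"
  obtains S :: "real^4^4" where "rotation_matrix S" "F = (\<lambda>x. S *v x) ` span {axis 1 1}"
proof -
  have F: "subspace F" "dim F = 1" using assms by (auto simp: grassmannian_def)
  obtain B where B: "\<And>x. x \<in> B \<Longrightarrow> norm x = 1" "card B = dim F" "span B = F"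
    using orthonormal_basis_subspace[OF F(1)] by metis
  then obtain u where u: "B = {u}" "norm u = 1" using F by (auto simp: card_1_singleton_iff)
  obtain S where S: "rotation_matrix S" "S *v (axis 1 1) = u"
    using rotation_matrix_exists_basis[of u 1] u by auto
  then show thesis using that[OF S(1)] B u
    by (simp add: span_linear_image[OF matrix_vector_mul_linear, symmetric])
qed

lemma orthonormal_pairE:
  fixes B :: "'a::euclidean_space set"
  assumes "pairwise orthogonal B" "\<And>x. x \<in> B \<Longrightarrow> norm x = 1" "card B = 2"
  obtains u v where "B = {u, v}" "u \<noteq> v" "norm u = 1" "norm v = 1" "u \<bullet> v = 0"
  using assms by (auto simp: card_2_iff pairwise_def orthogonal_def)

lemma grassmannian_planeE:
  assumes "F \<in> grassmannian 2"
  obtains S :: "real^4^4" where "rotation_matrix S" "F = (\<lambda>x. S *v x) ` span {axis 1 1, axis 2 1}"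
proof -
  have F: "subspace F" "dim F = 2" using assms by (auto simp: grassmannian_def)
  obtain B where B: "pairwise orthogonal B" "\<And>x. x \<in> B \<Longrightarrow> norm x = 1" "card B = dim F" "span B = F"
    using orthonormal_basis_subspace[OF F(1)] by metis
  then obtain u v where u: "B = {u, v}" "norm u = 1" "norm v = 1" "u \<bullet> v = 0"
    using orthonormal_pairE[of B] F by metis
  obtain S where S: "rotation_matrix S" "S *v (axis 1 1) = u" "S *v (axis 2 1) = v"
    using rotation_frame_exists[OF u(2-4)] by blast
  then show thesis using that[OF S(1)] B u
    by (simp add: span_linear_image[OF matrix_vector_mul_linear, symmetric])
qed

lemma span_axis_in_grassmannian:
  "span {axis 1 1 :: real^4} \<in> grassmannian 1"
  "span {axis 1 1, axis 2 1 :: real^4} \<in> grassmannian 2"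
proof -
  have "dim {axis 1 1 :: real^4} = card {axis 1 1 :: real^4}"
    by (rule dim_eq_card_independent) (simp add: vec4_eq_iff)
  then show "span {axis 1 1 :: real^4} \<in> grassmannian 1" by (simp add: grassmannian_def)
  have "independent {axis 1 1, axis 2 1 :: real^4}"
    by (rule pairwise_orthogonal_independent) (auto simp: pairwise_def orthogonal_def inner_vec4 vec4_eq_iff)
  then have "dim {axis 1 1, axis 2 1 :: real^4} = card {axis 1 1, axis 2 1 :: real^4}" by (rule dim_eq_card_independent)
  also have "\<dots> = 2" by (simp add: vec4_eq_iff)
  finally show "span {axis 1 1, axis 2 1 :: real^4} \<in> grassmannian 2" by (simp add: grassmannian_def)
qed

lemma grassmannian_measure_1:
  "grassmannian_measure 1 = distr rot_haar (grassmannian_borel 1) (\<lambda>R :: real^4^4. rot_act R (span {axis 1 1}))"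
proof (rule grassmannian_measure_eq_distr[OF span_axis_in_grassmannian(1)])
  fix F :: "(real^4) set" assume "F \<in> grassmannian 1"
  from grassmannian_lineE[OF this] show "\<exists>S. rotation_matrix S \<and> F = (\<lambda>x. S *v x) ` span {axis 1 1}" by metis
qed

lemma grassmannian_measure_2:
  "grassmannian_measure 2 = distr rot_haar (grassmannian_borel 2) (\<lambda>R :: real^4^4. rot_act R (span {axis 1 1, axis 2 1}))"
proof (rule grassmannian_measure_eq_distr[OF span_axis_in_grassmannian(2)])
  fix F :: "(real^4) set" assume "F \<in> grassmannian 2"
  from grassmannian_planeE[OF this] show "\<exists>S. rotation_matrix S \<and> F = (\<lambda>x. S *v x) ` span {axis 1 1, axis 2 1}" by metis
qed

section \<open>Projection volumes\<close>

text \<open>Projections written in the coordinates of a frame, so that all of them lie in one fixed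
  space where the planar inequality applies.\<close>

definition proj1 :: "'a::real_inner \<Rightarrow> 'a set \<Rightarrow> real set" where
  "proj1 u K = (\<lambda>x. x \<bullet> u) ` K"

definition proj2 :: "'a::real_inner \<Rightarrow> 'a \<Rightarrow> 'a set \<Rightarrow> (real \<times> real) set" where
  "proj2 u v K = (\<lambda>x. (x \<bullet> u, x \<bullet> v)) ` K"

lemma compact_proj1: "compact K \<Longrightarrow> compact (proj1 u K)"
  unfolding proj1_def by (intro compact_continuous_image continuous_intros)

lemma compact_proj2: "compact K \<Longrightarrow> compact (proj2 u v K)"
  unfolding proj2_def by (intro compact_continuous_image continuous_intros)

lemma orth_proj_span1:
  fixes u :: "'a::euclidean_space"
  assumes "norm u = 1"
  shows "orth_proj (span {u}) x = (x \<bullet> u) *\<^sub>R u"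
proof (rule orth_proj_eqI)
  show "orthogonal (x - (x \<bullet> u) *\<^sub>R u) z" if "z \<in> span {u}" for z
    using that assms by (auto simp: span_singleton orthogonal_def inner_diff_left norm_eq_1)
qed (auto simp: span_base span_scale)

lemma orth_proj_span2:
  fixes u v :: "'a::euclidean_space"
  assumes "norm u = 1" "norm v = 1" "u \<bullet> v = 0"
  shows "orth_proj (span {u, v}) x = (x \<bullet> u) *\<^sub>R u + (x \<bullet> v) *\<^sub>R v"
proof (rule orth_proj_eqI)
  fix z assume "z \<in> span {u, v}"
  then obtain a where "z - a *\<^sub>R u \<in> span {v}" by (auto simp: span_insert)
  then obtain b where "z - a *\<^sub>R u = b *\<^sub>R v" by (auto simp: span_singleton)
  then have z: "z = a *\<^sub>R u + b *\<^sub>R v" by (simp add: algebra_simps)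
  show "orthogonal (x - ((x \<bullet> u) *\<^sub>R u + (x \<bullet> v) *\<^sub>R v)) z"
    unfolding z using assms
    by (simp add: orthogonal_def inner_diff_left inner_add_left inner_add_right norm_eq_1 inner_commute[of v u])
qed (auto intro!: span_add span_scale intro: span_base)

lemma lborel_subspace_eq_distr:
  fixes F :: "'a::euclidean_space set"
  assumes "subspace F"
  shows "\<exists>B. pairwise orthogonal B \<and> (\<forall>b\<in>B. norm b = 1) \<and> span B = F \<and> card B = dim F \<and>
    lborel_subspace F = distr (\<Pi>\<^sub>M b\<in>B. lborel :: real measure) borel (\<lambda>f. \<Sum>b\<in>B. f b *\<^sub>R b)"
proof -
  define B where "B = (SOME B. orthonormal_basis_of F B)"
  obtain B' where "pairwise orthogonal B'" "\<And>b. b \<in> B' \<Longrightarrow> norm b = 1" "span B' = F"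
    using orthonormal_basis_subspace[OF assms] by metis
  then have "orthonormal_basis_of F B'" by (auto simp: orthonormal_basis_of_def)
  then have B: "orthonormal_basis_of F B" unfolding B_def by (rule someI)
  then have "independent B"
    by (intro pairwise_orthogonal_independent) (auto simp: orthonormal_basis_of_def)
  moreover have "dim F = dim B" using B by (auto simp: orthonormal_basis_of_def)
  ultimately have "card B = dim F" by (simp add: dim_eq_card_independent)
  then show ?thesis using B by (intro exI[of _ B]) (auto simp: orthonormal_basis_of_def lborel_subspace_def B_def Let_def)
qed

interpretation lborel_product: product_sigma_finite "\<lambda>_::'a. lborel :: real measure"
  by standard

lemma proj_vol_line:
  fixes F :: "'a::euclidean_space set"
  assumes F: "subspace F" "dim F = 1" and K: "compact K"
  obtains u where "norm u = 1" "span {u} = F" "proj_vol F K = measure lborel (proj1 u K)"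
proof -
  obtain B where B: "pairwise orthogonal B" "\<forall>b\<in>B. norm b = 1" "span B = F" "card B = dim F"
    "lborel_subspace F = distr (\<Pi>\<^sub>M b\<in>B. lborel :: real measure) borel (\<lambda>f. \<Sum>b\<in>B. f b *\<^sub>R b)"
    using lborel_subspace_eq_distr[OF F(1)] by blast
  obtain u where "B = {u}" using B(4) F(2) by (auto simp: card_1_singleton_iff)
  then have u: "B = {u}" "norm u = 1" "span {u} = F" using B by auto
  let ?P = "orth_proj F ` K"
  have cP: "compact ?P"
    using K linear_orth_proj[OF F(1)] by (intro compact_continuous_image linear_continuous_on) (simp add: linear_conv_bounded_linear)
  then have [measurable]: "?P \<in> sets borel" by (rule borel_compact)
  have [measurable]: "proj1 u K \<in> sets borel" using compact_proj1[OF K] by (rule borel_compact)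
  have mem: "a *\<^sub>R u \<in> ?P \<longleftrightarrow> a \<in> proj1 u K" for a
  proof -
    have "u \<noteq> 0" using u by auto
    then show ?thesis unfolding u(3)[symmetric] proj1_def image_iff orth_proj_span1[OF u(2)] by auto
  qed
  have "emeasure (lborel_subspace F) ?P = (\<integral>\<^sup>+f. indicator ?P (f u *\<^sub>R u) \<partial>(\<Pi>\<^sub>M b\<in>{u}. lborel))"
    unfolding B(5) u(1) by (subst nn_integral_indicator[symmetric], simp, subst nn_integral_distr) auto
  also have "\<dots> = (\<integral>\<^sup>+a. indicator ?P (a *\<^sub>R u) \<partial>lborel)"
    by (rule lborel_product.product_nn_integral_singleton) measurable
  also have "\<dots> = (\<integral>\<^sup>+a. indicator (proj1 u K) a \<partial>lborel)"
    by (intro nn_integral_cong) (simp add: mem indicator_def)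
  finally have "proj_vol F K = measure lborel (proj1 u K)"
    by (simp add: proj_vol_def measure_def)
  then show thesis using that u by blast
qed

text \<open>The frame is whatever basis the choice operator in \<open>lborel_subspace\<close>
  picked, so it can only be given existentially; cylinder volumes later allow any frame of the
  plane.\<close>

lemma proj_vol_plane:
  fixes F :: "'a::euclidean_space set"
  assumes F: "subspace F" "dim F = 2" and K: "compact K"
  obtains u v where "norm u = 1" "norm v = 1" "u \<bullet> v = 0" "span {u, v} = F"
    "proj_vol F K = measure lborel (proj2 u v K)"
proof -
  obtain B where B: "pairwise orthogonal B" "\<forall>b\<in>B. norm b = 1" "span B = F" "card B = dim F"
    "lborel_subspace F = distr (\<Pi>\<^sub>M b\<in>B. lborel :: real measure) borel (\<lambda>f. \<Sum>b\<in>B. f b *\<^sub>R b)"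
    using lborel_subspace_eq_distr[OF F(1)] by blast
  obtain u v where "B = {u, v}" "u \<noteq> v" "norm u = 1" "norm v = 1" "u \<bullet> v = 0"
    using orthonormal_pairE[of B] B(1,2,4) F(2) by (metis (no_types))
  then have u: "B = {u, v}" "u \<noteq> v" "norm u = 1" "norm v = 1" "u \<bullet> v = 0" "span {u, v} = F" using B(3) by auto
  let ?P = "orth_proj F ` K"
  have cP: "compact ?P"
    using K linear_orth_proj[OF F(1)] by (intro compact_continuous_image linear_continuous_on) (simp add: linear_conv_bounded_linear)
  then have [measurable]: "?P \<in> sets borel" by (rule borel_compact)
  have [measurable]: "proj2 u v K \<in> sets borel" using compact_proj2[OF K] by (rule borel_compact)
  have mem: "a *\<^sub>R u + b *\<^sub>R v \<in> ?P \<longleftrightarrow> (a, b) \<in> proj2 u v K" for a b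
  proof -
    have "a *\<^sub>R u + b *\<^sub>R v = c *\<^sub>R u + d *\<^sub>R v \<longleftrightarrow> a = c \<and> b = d" for c d
    proof
      assume eq: "a *\<^sub>R u + b *\<^sub>R v = c *\<^sub>R u + d *\<^sub>R v"
      have "(a *\<^sub>R u + b *\<^sub>R v) \<bullet> u = (c *\<^sub>R u + d *\<^sub>R v) \<bullet> u" "(a *\<^sub>R u + b *\<^sub>R v) \<bullet> v = (c *\<^sub>R u + d *\<^sub>R v) \<bullet> v"
        unfolding eq by auto
      then show "a = c \<and> b = d" using u by (auto simp: inner_add_left norm_eq_1 inner_commute[of v u])
    qed auto
    then show ?thesis unfolding u(6)[symmetric] proj2_def image_iff orth_proj_span2[OF u(3-5)] by auto
  qed
  have "emeasure (lborel_subspace F) ?P = (\<integral>\<^sup>+f. indicator ?P (f u *\<^sub>R u + f v *\<^sub>R v) \<partial>(\<Pi>\<^sub>M b\<in>{u, v}. lborel))"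
    unfolding B(5) u(1) using u(2) by (subst nn_integral_indicator[symmetric], simp, subst nn_integral_distr) auto
  also have "\<dots> = (\<integral>\<^sup>+b. (\<integral>\<^sup>+a. indicator ?P (a *\<^sub>R u + b *\<^sub>R v) \<partial>lborel) \<partial>lborel)"
  proof -
    have "(\<integral>\<^sup>+f. indicator ?P (f u *\<^sub>R u + f v *\<^sub>R v) \<partial>(\<Pi>\<^sub>M b\<in>{u, v}. lborel)) =
      (\<integral>\<^sup>+f. (\<integral>\<^sup>+a. indicator ?P ((f(u := a)) u *\<^sub>R u + (f(u := a)) v *\<^sub>R v) \<partial>lborel) \<partial>(\<Pi>\<^sub>M b\<in>{v}. lborel))"
      using u(2) by (intro lborel_product.product_nn_integral_insert) auto
    also have "\<dots> = (\<integral>\<^sup>+f. (\<lambda>b. \<integral>\<^sup>+a. indicator ?P (a *\<^sub>R u + b *\<^sub>R v) \<partial>lborel) (f v) \<partial>(\<Pi>\<^sub>M b\<in>{v}. lborel))"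
      using u(2) by simp
    also have "\<dots> = (\<integral>\<^sup>+b. (\<integral>\<^sup>+a. indicator ?P (a *\<^sub>R u + b *\<^sub>R v) \<partial>lborel) \<partial>lborel)"
      by (rule lborel_product.product_nn_integral_singleton) measurable
    finally show ?thesis .
  qed
  also have "\<dots> = (\<integral>\<^sup>+b. (\<integral>\<^sup>+a. indicator (proj2 u v K) (a, b) \<partial>lborel) \<partial>lborel)"
    by (simp add: mem indicator_def)
  also have "\<dots> = (\<integral>\<^sup>+p. indicator (proj2 u v K) p \<partial>lborel)"
    by (rule nn_integral_lborel_Pair(2)[symmetric]) measurable
  finally have "proj_vol F K = measure lborel (proj2 u v K)"
    by (simp add: proj_vol_def measure_def)
  then show thesis using that u by blast
qed

lemma Basis_vec4: "Basis = {axis 1 1, axis 2 1, axis 3 1, axis 4 1 :: real^4}"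
  unfolding Basis_vec_def UNIV_4 by auto

lemma continuous_vec4 [continuous_intros]:
  assumes "continuous_on S f" "continuous_on S g" "continuous_on S h" "continuous_on S k"
  shows "continuous_on S (\<lambda>x. vec4 (f x) (g x) (h x) (k x))"
  unfolding vec4_def
proof (rule continuous_on_vec_lambda)
  fix i :: 4
  show "continuous_on S (\<lambda>x. if i = 1 then f x else if i = 2 then g x else if i = 3 then h x else k x)"
    using assms by (cases "i = 1"; cases "i = 2"; cases "i = 3") simp_all
qed

lemma measurable_vec4 [measurable]:
  "(\<lambda>p :: real \<times> real \<times> real \<times> real. vec4 (fst p) (fst (snd p)) (fst (snd (snd p))) (snd (snd (snd p)))) \<in> borel_measurable borel"
  by (intro borel_measurable_continuous_onI continuous_intros)

lemma lborel_vec4: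
  "lborel = distr lborel borel
    (\<lambda>p :: real \<times> real \<times> real \<times> real. vec4 (fst p) (fst (snd p)) (fst (snd (snd p))) (snd (snd (snd p))))"
  (is "_ = distr _ _ ?v")
proof (rule lborel_eqI)
  fix l u :: "real^4" assume *: "\<And>b. b \<in> Basis \<Longrightarrow> l \<bullet> b \<le> u \<bullet> b"
  have le: "l $ 1 \<le> u $ 1" "l $ 2 \<le> u $ 2" "l $ 3 \<le> u $ 3" "l $ 4 \<le> u $ 4"
    using *[of "axis 1 1"] *[of "axis 2 1"] *[of "axis 3 1"] *[of "axis 4 1"] by (simp_all add: inner_axis)
  have mem: "?v p \<in> box l u \<longleftrightarrow> p \<in> {l $ 1<..<u $ 1} \<times> {l $ 2<..<u $ 2} \<times> {l $ 3<..<u $ 3} \<times> {l $ 4<..<u $ 4}" for p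
    by (cases p) (auto simp: mem_box Basis_vec4 inner_axis)
  have pair: "emeasure lborel (A \<times> B) = emeasure lborel A * emeasure lborel B"
    if "A \<in> sets borel" "B \<in> sets borel" for A :: "'a::euclidean_space set" and B :: "'b::euclidean_space set"
    using that lborel.emeasure_pair_measure_Times[of A lborel B] by (simp add: lborel_prod)
  have "emeasure (distr lborel borel ?v) (box l u) = emeasure lborel (?v -` box l u)"
    by (subst emeasure_distr) auto
  also have "?v -` box l u = {l $ 1<..<u $ 1} \<times> {l $ 2<..<u $ 2} \<times> {l $ 3<..<u $ 3} \<times> {l $ 4<..<u $ 4}"
    using mem by blast
  also have "emeasure lborel \<dots> = ennreal (u $ 1 - l $ 1) * (ennreal (u $ 2 - l $ 2) * (ennreal (u $ 3 - l $ 3) * ennreal (u $ 4 - l $ 4)))"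
    using le by (simp add: pair borel_prod[symmetric])
  also have "\<dots> = ennreal (\<Prod>b\<in>Basis. (u - l) \<bullet> b)"
    using le by (simp add: Basis_vec4 inner_axis vec4_eq_iff ennreal_mult mult_ac)
  finally show "emeasure (distr lborel borel ?v) (box l u) = (\<Prod>b\<in>Basis. (u - l) \<bullet> b)" .
qed simp

lemma nn_integral_vec4:
  fixes f :: "real^4 \<Rightarrow> ennreal"
  assumes [measurable]: "f \<in> borel_measurable borel"
  shows "(\<integral>\<^sup>+y. f y \<partial>lborel) =
    (\<integral>\<^sup>+p. f (vec4 (fst p) (fst (snd p)) (fst (snd (snd p))) (snd (snd (snd p)))) \<partial>(lborel :: (real \<times> real \<times> real \<times> real) measure))"
  by (subst lborel_vec4, subst nn_integral_distr) auto

lemma nn_integral_vec4_13: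
  fixes f :: "real^4 \<Rightarrow> ennreal"
  assumes [measurable]: "f \<in> borel_measurable borel"
  shows "(\<integral>\<^sup>+y. f y \<partial>lborel) =
    (\<integral>\<^sup>+s. (\<integral>\<^sup>+p. f (vec4 s (fst p) (fst (snd p)) (snd (snd p))) \<partial>(lborel :: (real \<times> real \<times> real) measure)) \<partial>lborel)"
  by (subst nn_integral_vec4, simp, subst nn_integral_lborel_Pair(1)) auto

lemma nn_integral_vec4_22:
  fixes f :: "real \<times> real \<Rightarrow> ennreal" and g :: "real \<times> real \<Rightarrow> ennreal"
  assumes [measurable]: "f \<in> borel_measurable borel" "g \<in> borel_measurable borel"
  shows "(\<integral>\<^sup>+(y::real^4). f (y $ 1, y $ 2) * g (y $ 3, y $ 4) \<partial>lborel) = (\<integral>\<^sup>+p. f p \<partial>lborel) * (\<integral>\<^sup>+q. g q \<partial>lborel)"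
proof -
  have "(\<integral>\<^sup>+(y::real^4). f (y $ 1, y $ 2) * g (y $ 3, y $ 4) \<partial>lborel) =
    (\<integral>\<^sup>+p. f (fst p, fst (snd p)) * g (snd (snd p)) \<partial>(lborel :: (real \<times> real \<times> real \<times> real) measure))"
    by (subst nn_integral_vec4) auto
  also have "\<dots> = (\<integral>\<^sup>+x. (\<integral>\<^sup>+r. f (x, fst r) * g (snd r) \<partial>lborel) \<partial>lborel)"
    by (subst nn_integral_lborel_Pair(1)) auto
  also have "\<dots> = (\<integral>\<^sup>+x. (\<integral>\<^sup>+y. (\<integral>\<^sup>+q. f (x, y) * g q \<partial>lborel) \<partial>lborel) \<partial>lborel)"
    by (subst nn_integral_lborel_Pair(1)) auto
  also have "\<dots> = (\<integral>\<^sup>+x. (\<integral>\<^sup>+y. f (x, y) * (\<integral>\<^sup>+q. g q \<partial>lborel) \<partial>lborel) \<partial>lborel)"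
    by (simp add: nn_integral_cmult)
  also have "\<dots> = (\<integral>\<^sup>+p. f p * (\<integral>\<^sup>+q. g q \<partial>lborel) \<partial>lborel)"
    by (subst nn_integral_lborel_Pair(1)) auto
  finally show ?thesis by (simp add: nn_integral_multc)
qed

text \<open>The \<open>k\<close>-volume of \<open>P K\<close> is read off from the volume of a cylinder of the full dimension, whose
  dependence on \<open>P\<close> is Borel measurable and which does not involve a choice of basis.\<close>

definition cylinder :: "real^'n^'n \<Rightarrow> (real^'n) set \<Rightarrow> (real^'n) set" where
  "cylinder P K = {y. (\<exists>x. x \<in> K \<and> P *v x = P *v y) \<and> norm (y - P *v y) \<le> 1}"

text \<open>The pairs \<open>(P, y)\<close> with \<open>y\<close> in the cylinder form a closed set,
  because projecting a closed relation along the compact \<open>K\<close> keeps it closed.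
  Measurability in \<open>P\<close> is then part of Fubini.\<close>

lemma measurable_emeasure_cylinder:
  fixes K :: "(real^'n) set"
  assumes K: "compact K"
  shows "(\<lambda>P. emeasure lborel (cylinder P K)) \<in> borel_measurable borel"
    and "cylinder P K \<in> sets borel"
proof -
  let ?Q = "{p :: (real^'n^'n) \<times> (real^'n). snd p \<in> cylinder (fst p) K}"
  have "closed {p :: (real^'n^'n) \<times> (real^'n). \<exists>x. x \<in> K \<and> (x, p) \<in> {(x, p). fst p *v x = fst p *v snd p}}"
  proof (rule closed_compact_projection[OF K])
    have "{(x, p). fst p *v x = fst p *v snd p} = {z :: (real^'n) \<times> (real^'n^'n) \<times> (real^'n). fst (snd z) *v fst z = fst (snd z) *v snd (snd z)}"
      by auto
    then show "closed {(x :: real^'n, p :: (real^'n^'n) \<times> (real^'n)). fst p *v x = fst p *v snd p}"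
      by (simp only:) (intro closed_Collect_eq continuous_intros)
  qed
  moreover have "closed {p :: (real^'n^'n) \<times> (real^'n). norm (snd p - fst p *v snd p) \<le> 1}"
    by (intro closed_Collect_le continuous_intros)
  moreover have "?Q = {p. \<exists>x. x \<in> K \<and> (x, p) \<in> {(x, p). fst p *v x = fst p *v snd p}} \<inter> {p. norm (snd p - fst p *v snd p) \<le> 1}"
    by (auto simp: cylinder_def)
  ultimately have "closed ?Q" by auto
  then have [measurable]: "?Q \<in> sets borel" by (rule borel_closed)
  have eq: "indicator ?Q (P, y) = (indicator (cylinder P K) y :: ennreal)" for P y by (simp add: indicator_def)
  show meas: "cylinder P K \<in> sets borel" for P
  proof -
    have "(\<lambda>y. (P, y)) -` ?Q \<in> sets borel" using measurable_sets_borel[of "\<lambda>y. (P, y)" borel ?Q] by simp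
    then show ?thesis by simp
  qed
  have "(\<lambda>P. \<integral>\<^sup>+y. indicator ?Q (P, y) \<partial>lborel) \<in> borel_measurable borel" by measurable
  then show "(\<lambda>P. emeasure lborel (cylinder P K)) \<in> borel_measurable borel"
    unfolding eq using meas by simp
qed

lemma cylinder_rotation:
  assumes R: "rotation_matrix R"
  shows "R *v y \<in> cylinder (R ** P ** transpose R) K \<longleftrightarrow> y \<in> cylinder P ((\<lambda>x. transpose R *v x) ` K)"
proof -
  have inv: "transpose R *v (R *v x) = x" for x
    by (simp add: matrix_vector_mul_assoc rotation_matrix_inverse[OF R] del: transpose_matrix_vector)
  have P: "(R ** P ** transpose R) *v x = R *v (P *v (transpose R *v x))" for x
    by (simp only: matrix_vector_mul_assoc matrix_mul_assoc)
  have inj: "R *v x = R *v y \<longleftrightarrow> x = y" for x y using inv by metis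
  have nrm: "norm (R *v x - R *v y) = norm (x - y)" for x y
    using rotation_matrix_norm[OF R] by (simp add: matrix_vector_mult_diff_distrib[symmetric])
  show ?thesis unfolding cylinder_def by (auto simp: P inv inj nrm simp del: transpose_matrix_vector)
qed

lemma transpose_inner: "(transpose (R :: real^'n^'n) *v x) \<bullet> y = x \<bullet> (R *v y)"
  by (metis dot_lmul_matrix transpose_matrix_vector)

lemma emeasure_cylinder_rotation:
  fixes K :: "(real^4) set"
  assumes R: "rotation_matrix R" and K: "compact K" and F: "subspace F"
  shows "emeasure lborel (cylinder (matrix (orth_proj ((\<lambda>x. R *v x) ` F))) K) =
    (\<integral>\<^sup>+y. indicator (cylinder (matrix (orth_proj F)) ((\<lambda>x. transpose R *v x) ` K)) y \<partial>lborel)"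
proof -
  let ?C = "cylinder (R ** matrix (orth_proj F) ** transpose R) K"
  have [measurable]: "?C \<in> sets borel" by (rule measurable_emeasure_cylinder[OF K])
  have "emeasure lborel ?C = (\<integral>\<^sup>+y. indicator ?C y \<partial>lborel)" by simp
  also have "\<dots> = (\<integral>\<^sup>+y. indicator ?C (R *v y) \<partial>lborel)"
    by (rule nn_integral_lborel_rotation[OF R, symmetric]) measurable
  finally show ?thesis
    by (simp add: indicator_def cylinder_rotation[OF R] matrix_orth_proj_rotation[OF R F] del: transpose_matrix_vector)
qed

text \<open>Rotating back makes \<open>P\<close> a coordinate projection, and the cylinder becomes
  the product of the planar shadow with a unit disc of area pi. For lines the second factor is the
  unit ball of three-space, of volume 4/3 pi.\<close>

lemma emeasure_cylinder_plane:
  fixes K :: "(real^4) set"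
  assumes R: "rotation_matrix R" and K: "compact K"
  shows "emeasure lborel (cylinder (matrix (orth_proj ((\<lambda>x. R *v x) ` span {axis 1 1, axis 2 1}))) K) =
    emeasure lborel (proj2 (R *v axis 1 1) (R *v axis 2 1) K) * ennreal pi"
proof -
  let ?F = "span {axis 1 1, axis 2 1 :: real^4}"
  let ?L = "proj2 (R *v axis 1 1) (R *v axis 2 1) K"
  have [measurable]: "?L \<in> sets borel" using compact_proj2[OF K] by (rule borel_compact)
  have P: "matrix (orth_proj ?F) *v y = vec4 (y $ 1) (y $ 2) 0 0" for y
    by (subst matrix_orth_proj, simp, subst orth_proj_span2) (simp_all add: norm_eq_1 inner_vec4 vec4_eq_iff)
  let ?D = "{q :: real \<times> real. (fst q)\<^sup>2 + (snd q)\<^sup>2 \<le> 1}"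
  have mem: "y \<in> cylinder (matrix (orth_proj ?F)) ((\<lambda>x. transpose R *v x) ` K) \<longleftrightarrow> (y $ 1, y $ 2) \<in> ?L \<and> (y $ 3, y $ 4) \<in> ?D" for y
  proof -
    have c: "(transpose R *v x) $ i = x \<bullet> (R *v axis i 1)" for x i
      using transpose_inner[of R x "axis i 1"] by (simp add: inner_axis del: transpose_matrix_vector)
    have n: "norm (y - vec4 (y $ 1) (y $ 2) 0 0) \<le> 1 \<longleftrightarrow> (y $ 3)\<^sup>2 + (y $ 4)\<^sup>2 \<le> 1"
      by (simp add: norm_eq_sqrt_inner inner_vec4 power2_eq_square)
    have "(\<exists>x. x \<in> (\<lambda>x. transpose R *v x) ` K \<and> vec4 (x $ 1) (x $ 2) 0 0 = vec4 (y $ 1) (y $ 2) 0 0) \<longleftrightarrow>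
      (\<exists>x\<in>K. x \<bullet> (R *v axis 1 1) = y $ 1 \<and> x \<bullet> (R *v axis 2 1) = y $ 2)"
      by (auto simp: c vec4_eq_iff simp del: transpose_matrix_vector)
    also have "\<dots> \<longleftrightarrow> (y $ 1, y $ 2) \<in> ?L" unfolding proj2_def image_iff prod.inject by metis
    finally show ?thesis unfolding cylinder_def P by (auto simp: n simp del: transpose_matrix_vector)
  qed
  have "emeasure lborel (cylinder (matrix (orth_proj ((\<lambda>x. R *v x) ` ?F))) K) =
    (\<integral>\<^sup>+(y::real^4). indicator ?L (y $ 1, y $ 2) * indicator ?D (y $ 3, y $ 4) \<partial>lborel)"
    unfolding emeasure_cylinder_rotation[OF R K subspace_span]
    by (intro nn_integral_cong) (simp add: indicator_def mem del: transpose_matrix_vector)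
  also have "\<dots> = (\<integral>\<^sup>+p. indicator ?L p \<partial>lborel) * (\<integral>\<^sup>+q. indicator ?D q \<partial>lborel)"
    by (rule nn_integral_vec4_22) measurable
  also have "(\<integral>\<^sup>+q. indicator ?D q \<partial>lborel) = emeasure lborel ?D" by (rule nn_integral_indicator) measurable
  also have "\<dots> = ennreal pi" using emeasure_disc[of 1] by simp
  finally show ?thesis by simp
qed

lemma emeasure_cylinder_line:
  fixes K :: "(real^4) set"
  assumes R: "rotation_matrix R" and K: "compact K"
  shows "emeasure lborel (cylinder (matrix (orth_proj ((\<lambda>x. R *v x) ` span {axis 1 1}))) K) =
    emeasure lborel (proj1 (R *v axis 1 1) K) * ennreal (4 / 3 * pi)"
proof -
  let ?F = "span {axis 1 1 :: real^4}"
  let ?L = "proj1 (R *v axis 1 1) K"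
  have [measurable]: "?L \<in> sets borel" using compact_proj1[OF K] by (rule borel_compact)
  have P: "matrix (orth_proj ?F) *v y = vec4 (y $ 1) 0 0 0" for y
    by (subst matrix_orth_proj, simp, subst orth_proj_span1) (simp_all add: norm_eq_1 inner_vec4 vec4_eq_iff)
  let ?D = "cball (0 :: real \<times> real \<times> real) 1"
  have mem: "vec4 s (fst p) (fst (snd p)) (snd (snd p)) \<in> cylinder (matrix (orth_proj ?F)) ((\<lambda>x. transpose R *v x) ` K)
    \<longleftrightarrow> s \<in> ?L \<and> p \<in> ?D" for s p
  proof -
    have c: "(transpose R *v x) $ i = x \<bullet> (R *v axis i 1)" for x i
      using transpose_inner[of R x "axis i 1"] by (simp add: inner_axis del: transpose_matrix_vector)
    have n: "norm (vec4 s (fst p) (fst (snd p)) (snd (snd p)) - vec4 s 0 0 0) \<le> 1 \<longleftrightarrow> p \<in> ?D"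
      by (cases p) (simp add: norm_eq_sqrt_inner inner_vec4 power2_eq_square add.assoc)
    show ?thesis unfolding cylinder_def P
      using n by (auto simp: c vec4_eq_iff proj1_def simp del: transpose_matrix_vector mem_cball)
  qed
  have cm: "cylinder (matrix (orth_proj ?F)) ((\<lambda>x. transpose R *v x) ` K) \<in> sets borel"
    by (intro measurable_emeasure_cylinder compact_continuous_image K continuous_intros)
  have "emeasure lborel (cylinder (matrix (orth_proj ((\<lambda>x. R *v x) ` ?F))) K) =
    (\<integral>\<^sup>+s. (\<integral>\<^sup>+p. indicator ?L s * indicator ?D p \<partial>lborel) \<partial>lborel)"
    unfolding emeasure_cylinder_rotation[OF R K subspace_span]
    by (subst nn_integral_vec4_13[OF borel_measurable_indicator[OF cm]])
      (simp add: indicator_def mem of_bool_conj del: transpose_matrix_vector mem_cball)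
  also have "\<dots> = (\<integral>\<^sup>+s. indicator ?L s * emeasure lborel ?D \<partial>lborel)"
    by (intro nn_integral_cong nn_integral_cmult_indicator) simp
  also have "\<dots> = emeasure lborel ?L * emeasure lborel ?D"
    by (rule trans[OF nn_integral_multc]) auto
  also have "emeasure lborel ?D = ennreal (4 / 3 * pi)" by (simp add: emeasure_cball unit_ball_vol_3)
  finally show ?thesis .
qed

lemma proj_vol_plane_cylinder:
  fixes K :: "(real^4) set"
  assumes F: "F \<in> grassmannian 2" and K: "compact K"
  shows "proj_vol F K = measure lborel (cylinder (matrix (orth_proj F)) K) / pi"
proof -
  have F': "subspace F" "dim F = 2" using F by (auto simp: grassmannian_def)
  obtain u v where u: "norm u = 1" "norm v = 1" "u \<bullet> v = 0" "span {u, v} = F"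
    "proj_vol F K = measure lborel (proj2 u v K)" using proj_vol_plane[OF F' K] .
  obtain R where R: "rotation_matrix R" "R *v axis 1 1 = u" "R *v axis 2 1 = v"
    using rotation_frame_exists[OF u(1-3)] by blast
  have "(\<lambda>x. R *v x) ` span {axis 1 1, axis 2 1} = F"
    using u R by (simp add: span_linear_image[OF matrix_vector_mul_linear, symmetric])
  then have "emeasure lborel (cylinder (matrix (orth_proj F)) K) = emeasure lborel (proj2 u v K) * ennreal pi"
    using emeasure_cylinder_plane[OF R(1) K] R by simp
  then show ?thesis by (simp add: u(5) measure_def enn2real_mult)
qed

lemma proj_vol_line_cylinder:
  fixes K :: "(real^4) set"
  assumes F: "F \<in> grassmannian 1" and K: "compact K"
  shows "proj_vol F K = measure lborel (cylinder (matrix (orth_proj F)) K) / (4 / 3 * pi)"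
proof -
  have F': "subspace F" "dim F = 1" using F by (auto simp: grassmannian_def)
  obtain u where u: "norm u = 1" "span {u} = F" "proj_vol F K = measure lborel (proj1 u K)"
    using proj_vol_line[OF F' K] .
  obtain R where R: "rotation_matrix R" "R *v axis 1 1 = u"
    using rotation_matrix_exists_basis[of u 1] u by auto
  have "(\<lambda>x. R *v x) ` span {axis 1 1} = F"
    using u R by (simp add: span_linear_image[OF matrix_vector_mul_linear, symmetric])
  then have "emeasure lborel (cylinder (matrix (orth_proj F)) K) = emeasure lborel (proj1 u K) * ennreal (4 / 3 * pi)"
    using emeasure_cylinder_line[OF R(1) K] R by simp
  then show ?thesis by (simp add: u(3) measure_def enn2real_mult)
qed

lemma measurable_measure_cylinder:
  fixes K :: "(real^4) set"
  assumes "compact K"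
  shows "(\<lambda>F. measure lborel (cylinder (matrix (orth_proj F)) K)) \<in> borel_measurable (grassmannian_borel k)"
proof -
  have "(\<lambda>F. emeasure lborel (cylinder (matrix (orth_proj F)) K)) \<in> borel_measurable (grassmannian_borel k)"
    by (rule measurable_compose[OF measurable_matrix_orth_proj measurable_emeasure_cylinder(1)[OF assms]])
  from measurable_compose[OF this borel_measurable_enn2real] show ?thesis by (simp add: measure_def)
qed

lemma measurable_proj_vol:
  fixes K :: "(real^4) set"
  assumes K: "compact K"
  shows "(\<lambda>F. proj_vol F K) \<in> borel_measurable (grassmannian_borel 1)"
    and "(\<lambda>F. proj_vol F K) \<in> borel_measurable (grassmannian_borel 2)"
proof -
  note [measurable] = measurable_measure_cylinder[OF K]
  have "(\<lambda>F. measure lborel (cylinder (matrix (orth_proj F)) K) / (4 / 3 * pi)) \<in> borel_measurable (grassmannian_borel 1)"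
    by measurable
  then show "(\<lambda>F. proj_vol F K) \<in> borel_measurable (grassmannian_borel 1)"
    by (rule measurable_cong[THEN iffD1, rotated]) (simp add: proj_vol_line_cylinder[OF _ K])
  have "(\<lambda>F. measure lborel (cylinder (matrix (orth_proj F)) K) / pi) \<in> borel_measurable (grassmannian_borel 2)"
    by measurable
  then show "(\<lambda>F. proj_vol F K) \<in> borel_measurable (grassmannian_borel 2)"
    by (rule measurable_cong[THEN iffD1, rotated]) (simp add: proj_vol_plane_cylinder[OF _ K])
qed

text \<open>The cylinder depends on the subspace only, so the frame given by \<open>R\<close> may
  replace the unknown basis behind \<open>proj_vol\<close>.\<close>

lemma proj_vol_rotation:
  fixes K :: "(real^4) set"
  assumes R: "rotation_matrix R" and K: "compact K"
  shows "proj_vol (rot_act R (span {axis 1 1})) K = measure lborel (proj1 (R *v axis 1 1) K)"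
    and "proj_vol (rot_act R (span {axis 1 1, axis 2 1})) K = measure lborel (proj2 (R *v axis 1 1) (R *v axis 2 1) K)"
proof -
  have act: "rot_act R F = (\<lambda>x. R *v x) ` F" for F using R by (simp add: rot_act_def)
  have G: "span {axis 1 1 :: real^4} \<in> grassmannian 1" "span {axis 1 1, axis 2 1 :: real^4} \<in> grassmannian 2"
    by (rule span_axis_in_grassmannian)+
  show "proj_vol (rot_act R (span {axis 1 1})) K = measure lborel (proj1 (R *v axis 1 1) K)"
    unfolding act proj_vol_line_cylinder[OF grassmannian_rotation[OF R G(1)] K]
    using emeasure_cylinder_line[OF R K] by (simp add: measure_def enn2real_mult)
  show "proj_vol (rot_act R (span {axis 1 1, axis 2 1})) K = measure lborel (proj2 (R *v axis 1 1) (R *v axis 2 1) K)"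
    unfolding act proj_vol_plane_cylinder[OF grassmannian_rotation[OF R G(2)] K]
    using emeasure_cylinder_plane[OF R K] by (simp add: measure_def enn2real_mult)
qed

section \<open>Widths, areas and integration in polar coordinates\<close>

text \<open>The image of Lebesgue measure under \<open>norm\<close> has a density on the half-line.
  Agreement is checked on the sets \<open>{..r}\<close>, where it is the volume formula for balls,
  and these generate the Borel sets.\<close>

lemma nn_integral_radial:
  fixes g :: "real \<Rightarrow> ennreal"
  assumes [measurable]: "g \<in> borel_measurable borel"
  shows "(\<integral>\<^sup>+p. g (norm p) \<partial>(lborel :: 'a::euclidean_space measure)) =
    ennreal (DIM('a) * unit_ball_vol (DIM('a))) * (\<integral>\<^sup>+r. ennreal (r ^ (DIM('a) - 1)) * g r * indicator {0<..} r \<partial>lborel)"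
proof -
  let ?c = "DIM('a) * unit_ball_vol (DIM('a))"
  define w where "w r = ennreal ?c * (ennreal (r ^ (DIM('a) - 1)) * indicator {0<..} r)" for r :: real
  have [measurable]: "w \<in> borel_measurable borel" unfolding w_def by measurable
  have c: "?c \<ge> 0" by simp
  have dim: "Suc (DIM('a) - 1) = DIM('a)" by simp
  have *: "emeasure (density lborel w) {..r} = emeasure (distr (lborel :: 'a measure) borel norm) {..r}" for r
  proof (cases "r \<ge> 0")
    case True
    have "emeasure (density lborel w) {..r} = (\<integral>\<^sup>+x. w x * indicator {..r} x \<partial>lborel)"
      by (rule emeasure_density) auto
    also have "\<dots> = (\<integral>\<^sup>+x. ennreal ?c * (ennreal ((x - 0) ^ (DIM('a) - 1)) * indicator {0..r} x) \<partial>lborel)"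
    proof (rule nn_integral_cong_AE)
      have "AE x in lborel. x \<noteq> (0::real)" by (rule AE_lborel_singleton)
      then show "AE x in lborel. w x * indicator {..r} x = ennreal ?c * (ennreal ((x - 0) ^ (DIM('a) - 1)) * indicator {0..r} x)"
        by eventually_elim (auto simp: w_def split: split_indicator)
    qed
    also have "\<dots> = ennreal ?c * ennreal ((r - 0) ^ Suc (DIM('a) - 1) / Suc (DIM('a) - 1))"
      using True by (subst nn_integral_cmult) (simp_all only: nn_integral_monomial_Icc, auto)
    also have "\<dots> = ennreal (?c * (r ^ DIM('a) / DIM('a)))"
      unfolding dim using True by (subst ennreal_mult[symmetric]) auto
    also have "?c * (r ^ DIM('a) / DIM('a)) = unit_ball_vol (DIM('a)) * r ^ DIM('a)" by simp
    also have "ennreal \<dots> = emeasure lborel (cball (0::'a) r)" using True by (simp add: emeasure_cball)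
    also have "cball (0::'a) r = norm -` {..r} \<inter> space lborel" by auto
    also have "emeasure lborel \<dots> = emeasure (distr (lborel :: 'a measure) borel norm) {..r}" by (rule emeasure_distr[symmetric]) auto
    finally show ?thesis .
  next
    case False
    have "emeasure (density lborel w) {..r} = (\<integral>\<^sup>+x. w x * indicator {..r} x \<partial>lborel)"
      by (rule emeasure_density) auto
    also have "\<dots> = (\<integral>\<^sup>+(x::real). 0 \<partial>lborel)"
      using False by (intro nn_integral_cong) (auto simp: w_def split: split_indicator)
    finally have 1: "emeasure (density lborel w) {..r} = 0" by simp
    have "emeasure (distr (lborel :: 'a measure) borel norm) {..r} = emeasure lborel (norm -` {..r} \<inter> space (lborel :: 'a measure))"
      by (rule emeasure_distr) auto
    also have "norm -` {..r} \<inter> space (lborel :: 'a measure) = {}"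
      using False by (auto dest: order_trans[OF norm_ge_zero])
    finally show ?thesis using 1 by simp
  qed
  have fin: "emeasure (distr (lborel :: 'a measure) borel norm) {..r} \<noteq> \<infinity>" for r
  proof -
    have "emeasure (distr (lborel :: 'a measure) borel norm) {..r} = emeasure lborel (norm -` {..r} \<inter> space (lborel :: 'a measure))"
      by (rule emeasure_distr) auto
    also have "norm -` {..r} \<inter> space (lborel :: 'a measure) = cball 0 r" by auto
    finally show ?thesis using emeasure_compact_finite[of "cball (0::'a) r"] by auto
  qed
  have eq: "density lborel w = distr (lborel :: 'a measure) borel norm"
  proof (rule measure_eqI_generator_eq[where E = "range (\<lambda>a. {..a})" and \<Omega> = UNIV and A = "\<lambda>n. {..real n}"])
    show "Int_stable (range (\<lambda>a::real. {..a}))" by (auto simp: Int_stable_def)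
    show "sets (density lborel w) = sigma_sets UNIV (range (\<lambda>a. {..a}))"
      "sets (distr (lborel :: 'a measure) borel norm) = sigma_sets UNIV (range (\<lambda>a. {..a}))"
      by (simp_all add: borel_eq_atMost)
    show "(\<Union>i. {..real i}) = UNIV" using real_arch_simple by auto
  qed (use * fin in auto)
  have "(\<integral>\<^sup>+p. g (norm p) \<partial>(lborel :: 'a measure)) = (\<integral>\<^sup>+r. g r \<partial>density lborel w)"
    unfolding eq by (rule nn_integral_distr[symmetric]) auto
  also have "\<dots> = (\<integral>\<^sup>+r. w r * g r \<partial>lborel)" by (rule nn_integral_density) auto
  also have "\<dots> = (\<integral>\<^sup>+r. ennreal ?c * (ennreal (r ^ (DIM('a) - 1)) * g r * indicator {0<..} r) \<partial>lborel)"
    unfolding w_def by (simp add: mult_ac)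
  also have "\<dots> = ennreal ?c * (\<integral>\<^sup>+r. ennreal (r ^ (DIM('a) - 1)) * g r * indicator {0<..} r \<partial>lborel)"
    by (rule nn_integral_cmult) measurable
  finally show ?thesis .
qed

interpretation lborel_haar: pair_sigma_finite "lborel :: 'a::euclidean_space measure" rot_haar ..

lemma measurable_borel_rot_haar [measurable_cong]:
  "sets (lborel \<Otimes>\<^sub>M rot_haar) = sets (borel :: ('a::euclidean_space \<times> (real^4^4)) measure)"
  "sets (rot_haar \<Otimes>\<^sub>M lborel) = sets (borel :: ((real^4^4) \<times> 'a::euclidean_space) measure)"
  by (simp_all add: borel_prod[symmetric] cong: sets_pair_measure_cong)

lemma Fubini_haar:
  fixes f :: "'a::euclidean_space \<Rightarrow> real^4^4 \<Rightarrow> ennreal"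
  assumes "(\<lambda>p. f (fst p) (snd p)) \<in> borel_measurable borel"
  shows "(\<integral>\<^sup>+x. (\<integral>\<^sup>+R. f x R \<partial>rot_haar) \<partial>lborel) = (\<integral>\<^sup>+R. (\<integral>\<^sup>+x. f x R \<partial>lborel) \<partial>rot_haar)"
proof -
  have "case_prod f \<in> borel_measurable (lborel \<Otimes>\<^sub>M rot_haar)"
    using assms unfolding measurable_cong_sets[OF measurable_borel_rot_haar(1) refl] case_prod_beta' .
  from lborel_haar.Fubini'[OF this] show ?thesis by simp
qed

lemma rotation_of_axis:
  fixes y :: "real^4"
  shows "\<exists>S. rotation_matrix S \<and> S *v (norm y *\<^sub>R axis 1 1) = y"
proof (cases "y = 0")
  case True
  have "rotation_matrix (mat 1 :: real^4^4)" by (simp add: rotation_matrix_def orthogonal_matrix_id)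
  then show ?thesis using True by (intro exI[of _ "mat 1"]) simp
next
  case False
  then have "norm (y /\<^sub>R norm y) = 1" by simp
  then obtain S where S: "rotation_matrix S" "S *v axis 1 1 = y /\<^sub>R norm y"
    using rotation_matrix_exists_basis[of "y /\<^sub>R norm y" 1] by auto
  then show ?thesis using False by (intro exI[of _ S]) (simp add: matrix_vector_mult_scaleR)
qed

text \<open>The stabiliser of the first axis is transitive on spheres around that axis. Only the
  square of \<open>r\<close> enters, so \<open>r\<close> may be negative; this later yields evenness
  in \<open>r\<close>.\<close>

lemma rotation_fixing_axis:
  fixes y :: "real^4"
  assumes "y $ 1 = s" "(y $ 2)\<^sup>2 + (y $ 3)\<^sup>2 + (y $ 4)\<^sup>2 = r\<^sup>2"
  shows "\<exists>S. rotation_matrix S \<and> S *v axis 1 1 = axis 1 1 \<and> S *v (s *\<^sub>R axis 1 1 + r *\<^sub>R axis 2 1) = y"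
proof (cases "r = 0")
  case True
  have "(y $ 2)\<^sup>2 + (y $ 3)\<^sup>2 + (y $ 4)\<^sup>2 = 0" using assms True by simp
  then have "y $ 2 = 0" "y $ 3 = 0" "y $ 4 = 0"
    by (smt (verit) zero_le_power2 power_eq_0_iff)+
  moreover have "rotation_matrix (mat 1 :: real^4^4)" by (simp add: rotation_matrix_def orthogonal_matrix_id)
  ultimately show ?thesis using True assms by (intro exI[of _ "mat 1"]) (simp add: vec4_eq_iff)
next
  case False
  define v where "v = vec4 0 (y $ 2) (y $ 3) (y $ 4) /\<^sub>R r"
  have "v \<bullet> v = ((y $ 2)\<^sup>2 + (y $ 3)\<^sup>2 + (y $ 4)\<^sup>2) / r\<^sup>2"
    by (simp add: v_def inner_vec4 power2_eq_square add_divide_distrib add.assoc) (simp add: field_simps)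
  then have "norm v = 1" unfolding assms using False by (simp add: norm_eq_1)
  moreover have "axis 1 1 \<bullet> v = 0" by (simp add: v_def inner_vec4)
  ultimately obtain S where S: "rotation_matrix S" "S *v axis 1 1 = axis 1 1" "S *v axis 2 1 = v"
    using rotation_frame_exists[of "axis 1 1" v] by (auto simp: norm_eq_1 inner_vec4)
  have "S *v (s *\<^sub>R axis 1 1 + r *\<^sub>R axis 2 1) = s *\<^sub>R axis 1 1 + r *\<^sub>R v"
    using S by (simp add: matrix_vector_right_distrib matrix_vector_mult_scaleR)
  also have "\<dots> = y" using assms False by (simp add: v_def vec4_eq_iff)
  finally show ?thesis using S by blast
qed

lemma bounded_width_dual:
  fixes K :: "'a::euclidean_space set"
  assumes "interior K \<noteq> {}"
  shows "bounded (width_dual K)"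
proof -
  obtain c e where e: "e > 0" "cball c e \<subseteq> K" using assms by (metis ex_in_conv mem_interior_cball)
  have "norm y \<le> 1 / e" if y: "y \<in> width_dual K" for y
  proof (cases "y = 0")
    case False
    have "c + (e / norm y) *\<^sub>R y \<in> K" "c \<in> K" using e False by (auto intro!: subsetD[OF e(2)] simp: dist_norm)
    then have "((c + (e / norm y) *\<^sub>R y) - c) \<bullet> y \<le> 1" using y unfolding width_dual_def by blast
    then have "e * norm y \<le> 1" using False by (simp add: power2_norm_eq_inner[symmetric] power2_eq_square)
    then show ?thesis using e by (simp add: field_simps)
  qed (use e in simp)
  then show ?thesis by (auto simp: bounded_iff)
qed

text \<open>The projection of \<open>K\<close> along \<open>u\<close> is a compact interval, so its
  length is also the largest value of \<open>(x - y) \<bullet> u\<close> over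
  \<open>K\<close>.\<close>

lemma width_dual_ray:
  fixes K :: "'a::euclidean_space set"
  assumes K: "compact K" "convex K" "K \<noteq> {}" and r: "r \<ge> 0"
  shows "r *\<^sub>R u \<in> width_dual K \<longleftrightarrow> r * measure lborel (proj1 u K) \<le> 1"
proof -
  have "compact (proj1 u K)" by (rule compact_proj1[OF K(1)])
  moreover have "connected (proj1 u K)" unfolding proj1_def
    using convex_connected[OF K(2)] by (intro connected_continuous_image continuous_intros)
  ultimately obtain m M where mM: "proj1 u K = {m..M}" by (metis connected_compact_interval_1)
  have "proj1 u K \<noteq> {}" using K by (simp add: proj1_def)
  with mM have le: "m \<le> M" by auto
  have "r *\<^sub>R u \<in> width_dual K \<longleftrightarrow> (\<forall>a\<in>proj1 u K. \<forall>b\<in>proj1 u K. r * (a - b) \<le> 1)"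
    by (auto simp: width_dual_def proj1_def inner_diff_left right_diff_distrib)
  also have "\<dots> \<longleftrightarrow> r * (M - m) \<le> 1"
  proof
    assume *: "r * (M - m) \<le> 1"
    show "\<forall>a\<in>proj1 u K. \<forall>b\<in>proj1 u K. r * (a - b) \<le> 1"
    proof (intro ballI)
      fix a b assume "a \<in> proj1 u K" "b \<in> proj1 u K"
      then have "r * (a - b) \<le> r * (M - m)" using r mM by (intro mult_left_mono) auto
      then show "r * (a - b) \<le> 1" using * by simp
    qed
  qed (use mM le in auto)
  finally show ?thesis using mM le by simp
qed

text \<open>For general bodies these bounds, like \<open>area_bounds\<close>, give integrability of
  negative powers. For a ball the inner and outer radius agree, so they evaluate its widths and
  areas exactly.\<close>

lemma width_bounds:
  fixes K :: "'a::euclidean_space set"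
  assumes K: "compact K" and e: "cball c e \<subseteq> K" "e > 0" and B: "K \<subseteq> cball 0 B" and u: "norm u = 1"
  shows "2 * e \<le> measure lborel (proj1 u K)" "measure lborel (proj1 u K) \<le> 2 * B"
proof -
  have c: "compact (proj1 u K)" by (rule compact_proj1[OF K])
  have "{c \<bullet> u - e..c \<bullet> u + e} \<subseteq> proj1 u K"
  proof
    fix t assume t: "t \<in> {c \<bullet> u - e..c \<bullet> u + e}"
    have "c + (t - c \<bullet> u) *\<^sub>R u \<in> K" using t u by (intro subsetD[OF e(1)]) (auto simp: dist_norm abs_le_iff)
    moreover have "(c + (t - c \<bullet> u) *\<^sub>R u) \<bullet> u = t" using u by (simp add: inner_add_left norm_eq_1)
    ultimately show "t \<in> proj1 u K" unfolding proj1_def by (metis imageI)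
  qed
  then have "measure lborel {c \<bullet> u - e..c \<bullet> u + e} \<le> measure lborel (proj1 u K)"
    using c by (intro measure_mono_fmeasurable) (auto intro: fmeasurable_compact)
  then show "2 * e \<le> measure lborel (proj1 u K)" using e by simp
  have "c \<in> K" using e by auto
  then have "B \<ge> 0" using B by (auto dest!: subsetD intro: order_trans[OF norm_ge_zero])
  have "proj1 u K \<subseteq> {- B..B}"
  proof
    fix t assume "t \<in> proj1 u K"
    then obtain x where x: "x \<in> K" "t = x \<bullet> u" by (auto simp: proj1_def)
    have "\<bar>x \<bullet> u\<bar> \<le> norm x * norm u" by (rule Cauchy_Schwarz_ineq2)
    moreover have "norm x \<le> B" using B x by auto
    ultimately show "t \<in> {- B..B}" using u x by auto
  qed
  then have "measure lborel (proj1 u K) \<le> measure lborel {- B..B}"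
    using c by (intro measure_mono_fmeasurable) (auto intro: borel_compact fmeasurable_compact)
  then show "measure lborel (proj1 u K) \<le> 2 * B" using \<open>B \<ge> 0\<close> by simp
qed

lemma area_bounds:
  fixes K :: "'a::euclidean_space set"
  assumes K: "compact K" and e: "cball c e \<subseteq> K" "e > 0" and B: "K \<subseteq> cball 0 B"
    and u: "norm u = 1" "norm v = 1" "u \<bullet> v = 0"
  shows "pi * e\<^sup>2 \<le> measure lborel (proj2 u v K)" "measure lborel (proj2 u v K) \<le> pi * B\<^sup>2"
proof -
  have c: "compact (proj2 u v K)" by (rule compact_proj2[OF K])
  have nrm: "(norm (a *\<^sub>R u + b *\<^sub>R v))\<^sup>2 = a\<^sup>2 + b\<^sup>2" for a b
    unfolding power2_norm_eq_inner using u
    by (simp add: inner_add_left inner_add_right norm_eq_1 inner_commute[of v u] power2_eq_square)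
  have "cball (c \<bullet> u, c \<bullet> v) e \<subseteq> proj2 u v K"
  proof
    fix p assume p: "p \<in> cball (c \<bullet> u, c \<bullet> v) e"
    define a b where "a = fst p - c \<bullet> u" and "b = snd p - c \<bullet> v"
    have "sqrt (a\<^sup>2 + b\<^sup>2) \<le> e" using p by (cases p) (simp add: a_def b_def dist_prod_def dist_real_def power2_commute)
    then have "norm (a *\<^sub>R u + b *\<^sub>R v) \<le> e" by (metis nrm norm_ge_zero real_sqrt_unique)
    have "c + (a *\<^sub>R u + b *\<^sub>R v) \<in> K"
    proof (rule subsetD[OF e(1)])
      have "dist c (c + w) = norm w" for w :: 'a by (simp add: dist_norm)
      with \<open>norm (a *\<^sub>R u + b *\<^sub>R v) \<le> e\<close> show "c + (a *\<^sub>R u + b *\<^sub>R v) \<in> cball c e"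
        unfolding mem_cball by (simp only:)
    qed
    moreover have "(c + (a *\<^sub>R u + b *\<^sub>R v)) \<bullet> u = fst p" "(c + (a *\<^sub>R u + b *\<^sub>R v)) \<bullet> v = snd p"
      using u by (simp_all add: a_def b_def inner_add_left norm_eq_1 inner_commute[of v u])
    ultimately show "p \<in> proj2 u v K"
      unfolding proj2_def by (intro image_eqI[of _ _ "c + (a *\<^sub>R u + b *\<^sub>R v)"]) (simp_all only: prod.collapse)
  qed
  then have "measure lborel (cball (c \<bullet> u, c \<bullet> v) e) \<le> measure lborel (proj2 u v K)"
    using c by (intro measure_mono_fmeasurable) (auto intro: fmeasurable_compact)
  then show "pi * e\<^sup>2 \<le> measure lborel (proj2 u v K)" using e by (simp add: content_cball unit_ball_vol_2 power2_eq_square)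
  have "c \<in> K" using e by auto
  then have "B \<ge> 0" using B by (auto dest!: subsetD intro: order_trans[OF norm_ge_zero])
  have "proj2 u v K \<subseteq> cball 0 B"
  proof
    fix p assume "p \<in> proj2 u v K"
    then obtain x where x: "x \<in> K" "p = (x \<bullet> u, x \<bullet> v)" by (auto simp: proj2_def)
    define y where "y = (x \<bullet> u) *\<^sub>R u + (x \<bullet> v) *\<^sub>R v"
    have np: "(norm p)\<^sup>2 = (x \<bullet> u)\<^sup>2 + (x \<bullet> v)\<^sup>2" by (simp add: x(2) norm_prod_def)
    have "(norm y)\<^sup>2 = (norm p)\<^sup>2" unfolding y_def np by (rule nrm)
    then have "norm y = norm p" by (rule power2_eq_imp_eq) simp_all
    moreover have "x \<bullet> y = (norm p)\<^sup>2" unfolding np by (simp add: y_def inner_add_right power2_eq_square)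
    ultimately have "norm p * norm p \<le> norm x * norm p"
      using norm_cauchy_schwarz[of x y] by (simp only: power2_eq_square)
    then have "norm p \<le> norm x" by (cases "norm p = 0") (simp_all only: mult_le_cancel_right norm_ge_zero, auto)
    then show "p \<in> cball 0 B" using B x(1) by auto
  qed
  then have "measure lborel (proj2 u v K) \<le> measure lborel (cball (0::real\<times>real) B)"
    using c by (intro measure_mono_fmeasurable) (auto intro: borel_compact fmeasurable_compact)
  then show "measure lborel (proj2 u v K) \<le> pi * B\<^sup>2" using \<open>B \<ge> 0\<close> by (simp add: content_cball unit_ball_vol_2 power2_eq_square)
qed

section \<open>Averaging over rotations\<close>

lemma axis_combination: "s *\<^sub>R axis 1 1 + r *\<^sub>R axis 2 1 = vec4 s r 0 0"
  by (simp add: vec4_eq_iff)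

text \<open>Reads a^-4 as an integral over a disc of radius 1/a. This is how the remaining factor
  \<open>1 / wid R ^ 4\<close> is turned into a second point of a planar section.\<close>

lemma emeasure_disc_moment:
  assumes "a > 0"
  shows "(\<integral>\<^sup>+(z :: real \<times> real). ennreal ((norm z)\<^sup>2) * indicator {z. norm z * a \<le> 1} z \<partial>lborel) = ennreal (pi / 2) * ennreal (1 / a ^ 4)"
proof -
  have "(\<integral>\<^sup>+(z :: real \<times> real). ennreal ((norm z)\<^sup>2) * indicator {z. norm z * a \<le> 1} z \<partial>lborel) =
    (\<integral>\<^sup>+(z :: real \<times> real). (\<lambda>r. ennreal (r\<^sup>2) * indicator {..1 / a} r) (norm z) \<partial>lborel)"
    using assms by (intro nn_integral_cong) (simp add: indicator_def field_simps)
  also have "\<dots> = ennreal (2 * pi) * (\<integral>\<^sup>+r. ennreal r * (ennreal (r\<^sup>2) * indicator {..1 / a} r) * indicator {0<..} r \<partial>lborel)"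
    by (subst nn_integral_radial) (auto simp: unit_ball_vol_2)
  also have "(\<integral>\<^sup>+r. ennreal r * (ennreal (r\<^sup>2) * indicator {..1 / a} r) * indicator {0<..} r \<partial>lborel) =
    (\<integral>\<^sup>+r. ennreal ((r - 0) ^ 3) * indicator {0..1 / a} r \<partial>lborel)"
    by (intro nn_integral_cong) (auto simp: ennreal_mult[symmetric] power2_eq_square power3_eq_cube split: split_indicator)
  also have "\<dots> = ennreal ((1 / a - 0) ^ Suc 3 / Suc 3)" using assms by (intro nn_integral_monomial_Icc) auto
  also have "ennreal (2 * pi) * \<dots> = ennreal (pi / 2 * (1 / a ^ 4))"
    using assms by (subst ennreal_mult[symmetric]) (auto simp: power_divide)
  also have "\<dots> = ennreal (pi / 2) * ennreal (1 / a ^ 4)" using assms by (intro ennreal_mult) auto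
  finally show ?thesis .
qed

locale body4 =
  fixes K :: "(real^4) set"
  assumes body: "compact K" "convex K" "interior K \<noteq> {}"
begin

abbreviation "D \<equiv> width_dual K"

definition wid :: "real^4^4 \<Rightarrow> real" where
  "wid R = proj_vol (rot_act R (span {axis 1 1})) K"

definition area :: "real^4^4 \<Rightarrow> real" where
  "area R = proj_vol (rot_act R (span {axis 1 1, axis 2 1})) K"

lemma wid: "rotation_matrix R \<Longrightarrow> wid R = measure lborel (proj1 (R *v axis 1 1) K)"
  unfolding wid_def by (rule proj_vol_rotation(1)[OF _ body(1)])

lemma area: "rotation_matrix R \<Longrightarrow> area R = measure lborel (proj2 (R *v axis 1 1) (R *v axis 2 1) K)"
  unfolding area_def by (rule proj_vol_rotation(2)[OF _ body(1)])

lemma measurable_rot_act_const: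
  assumes "F \<in> grassmannian k"
  shows "(\<lambda>R :: real^4^4. rot_act R F) \<in> borel \<rightarrow>\<^sub>M grassmannian_borel k"
  by (rule measurable_rot_act) (use assms in auto)

lemma measurable_wid [measurable]: "wid \<in> borel_measurable borel"
  unfolding wid_def
  by (rule measurable_compose[OF measurable_rot_act_const[OF span_axis_in_grassmannian(1)] measurable_proj_vol(1)[OF body(1)]])

lemma measurable_area [measurable]: "area \<in> borel_measurable borel"
  unfolding area_def
  by (rule measurable_compose[OF measurable_rot_act_const[OF span_axis_in_grassmannian(2)] measurable_proj_vol(2)[OF body(1)]])

lemma D_borel [measurable]: "D \<in> sets borel"
  by (simp add: borel_closed closed_width_dual)

lemma nonempty: "K \<noteq> {}"
  using body(3) by (metis interior_empty)

lemma wid_bounds: "\<exists>lo hi. 0 < lo \<and> (\<forall>R. rotation_matrix R \<longrightarrow> lo \<le> wid R \<and> wid R \<le> hi)"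
  and area_bounds': "\<exists>lo hi. 0 < lo \<and> (\<forall>R. rotation_matrix R \<longrightarrow> lo \<le> area R \<and> area R \<le> hi)"
proof -
  obtain c e where e: "cball c e \<subseteq> K" "e > 0" using body(3) by (metis ex_in_conv mem_interior_cball)
  obtain B where "\<forall>x\<in>K. norm x \<le> B" using compact_imp_bounded[OF body(1)] by (auto simp: bounded_iff)
  then have B: "K \<subseteq> cball 0 B" by auto
  have u: "norm (R *v axis 1 1) = 1" "norm (R *v axis 2 1) = 1" "(R *v axis 1 1) \<bullet> (R *v axis 2 1) = 0"
    if "rotation_matrix R" for R :: "real^4^4"
    unfolding rotation_matrix_norm[OF that] rotation_matrix_inner[OF that] by (simp_all add: norm_eq_1 inner_vec4)
  have "2 * e \<le> wid R \<and> wid R \<le> 2 * B" if R: "rotation_matrix R" for R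
    unfolding wid[OF R] using width_bounds[OF body(1) e B u(1)[OF R]] by blast
  then show "\<exists>lo hi. 0 < lo \<and> (\<forall>R. rotation_matrix R \<longrightarrow> lo \<le> wid R \<and> wid R \<le> hi)"
    using e(2) by (intro exI[of _ "2 * e"] exI[of _ "2 * B"]) simp
  have "pi * e\<^sup>2 \<le> area R \<and> area R \<le> pi * B\<^sup>2" if R: "rotation_matrix R" for R
    unfolding area[OF R] using area_bounds[OF body(1) e B u[OF R]] by blast
  then show "\<exists>lo hi. 0 < lo \<and> (\<forall>R. rotation_matrix R \<longrightarrow> lo \<le> area R \<and> area R \<le> hi)"
    using e(2) by (intro exI[of _ "pi * e\<^sup>2"] exI[of _ "pi * B\<^sup>2"]) simp
qed

lemma wid_pos: "rotation_matrix R \<Longrightarrow> wid R > 0"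
  using wid_bounds less_le_trans by blast

lemma area_pos: "rotation_matrix R \<Longrightarrow> area R > 0"
  using area_bounds' less_le_trans by blast

lemma mem_D_wid: "rotation_matrix R \<Longrightarrow> r \<ge> 0 \<Longrightarrow> r *\<^sub>R (R *v axis 1 1) \<in> D \<longleftrightarrow> r * wid R \<le> 1"
  using width_dual_ray[OF body(1,2) nonempty, of r "R *v axis 1 1"] by (simp add: wid)

lemma emeasure_D_rotation:
  "rotation_matrix R \<Longrightarrow> (\<integral>\<^sup>+y. indicator D (R *v y) \<partial>lborel) = emeasure lborel D"
  using nn_integral_lborel_rotation[of R "indicator D"] by simp

definition polar_mean :: ennreal where
  "polar_mean = (\<integral>\<^sup>+R. ennreal (1 / wid R ^ 4) \<partial>rot_haar)"

text \<open>Average the volume over rotations. Right invariance replaces \<open>y\<close> by its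
  norm times the first axis, and for fixed \<open>R\<close> the condition becomes that
  \<open>y\<close> lies in the ball of radius \<open>1 / wid R\<close>.\<close>

lemma emeasure_D: "emeasure lborel D = ennreal (pi\<^sup>2 / 2) * polar_mean"
proof -
  have "emeasure lborel D = (\<integral>\<^sup>+R. emeasure lborel D \<partial>rot_haar)" by (simp add: emeasure_rot_haar_UNIV)
  also have "\<dots> = (\<integral>\<^sup>+R. (\<integral>\<^sup>+y. indicator D (R *v y) \<partial>lborel) \<partial>rot_haar)"
    by (rule nn_integral_cong_AE, use AE_rot_haar in eventually_elim) (simp add: emeasure_D_rotation)
  also have "\<dots> = (\<integral>\<^sup>+y. (\<integral>\<^sup>+R. indicator D (R *v y) \<partial>rot_haar) \<partial>lborel)"
    by (rule Fubini_haar[symmetric]) measurable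
  also have "\<dots> = (\<integral>\<^sup>+(y::real^4). (\<integral>\<^sup>+R. indicator D (R *v (norm y *\<^sub>R axis 1 1)) \<partial>rot_haar) \<partial>lborel)"
  proof (rule nn_integral_cong)
    fix y :: "real^4"
    obtain S where S: "rotation_matrix S" "S *v (norm y *\<^sub>R axis 1 1) = y" using rotation_of_axis by blast
    have "(\<integral>\<^sup>+R. indicator D ((R ** S) *v (norm y *\<^sub>R axis 1 1)) \<partial>rot_haar) = (\<integral>\<^sup>+R. indicator D (R *v (norm y *\<^sub>R axis 1 1)) \<partial>rot_haar)"
      by (rule nn_integral_rot_haar_right[OF _ S(1)]) measurable
    then show "(\<integral>\<^sup>+R. indicator D (R *v y) \<partial>rot_haar) = (\<integral>\<^sup>+R. indicator D (R *v (norm y *\<^sub>R axis 1 1)) \<partial>rot_haar)"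
      by (simp add: matrix_vector_mul_assoc[symmetric] S(2))
  qed
  also have "\<dots> = (\<integral>\<^sup>+R. (\<integral>\<^sup>+y. indicator D (R *v (norm y *\<^sub>R axis 1 1)) \<partial>(lborel :: (real^4) measure)) \<partial>rot_haar)"
    by (rule Fubini_haar) measurable
  also have "\<dots> = (\<integral>\<^sup>+R. ennreal (pi\<^sup>2 / 2) * ennreal (1 / wid R ^ 4) \<partial>rot_haar)"
  proof (rule nn_integral_cong_AE, use AE_rot_haar in eventually_elim)
    case (elim R)
    have "indicator D (R *v (norm y *\<^sub>R axis 1 1)) = (indicator (cball 0 (1 / wid R)) y :: ennreal)" for y :: "real^4"
      using mem_D_wid[OF elim, of "norm y"] wid_pos[OF elim]
      by (simp add: indicator_def matrix_vector_mult_scaleR field_simps)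
    then have "(\<integral>\<^sup>+y. indicator D (R *v (norm y *\<^sub>R axis 1 1)) \<partial>(lborel :: (real^4) measure)) = emeasure lborel (cball (0::real^4) (1 / wid R))"
      by simp
    also have "\<dots> = ennreal (pi\<^sup>2 / 2 * (1 / wid R ^ 4))"
      using wid_pos[OF elim] by (simp add: emeasure_cball unit_ball_vol_4 power_divide)
    also have "\<dots> = ennreal (pi\<^sup>2 / 2) * ennreal (1 / wid R ^ 4)"
      using wid_pos[OF elim] by (intro ennreal_mult) auto
    finally show ?case .
  qed
  also have "\<dots> = ennreal (pi\<^sup>2 / 2) * polar_mean"
    unfolding polar_mean_def by (rule nn_integral_cmult) measurable
  finally show ?thesis .
qed

text \<open>The section of \<open>D\<close> by the plane of the first two frame vectors, in their
  coordinates; \<open>sec_moment\<close> is its second moment about the line of the first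
  vector.\<close>

definition Dsec :: "real^4^4 \<Rightarrow> real \<times> real \<Rightarrow> ennreal" where
  "Dsec R z = indicator D (R *v vec4 (fst z) (snd z) 0 0)"

lemma measurable_Dsec [measurable (raw)]:
  assumes [measurable]: "f \<in> borel_measurable M" "g \<in> borel_measurable M"
  shows "(\<lambda>x. Dsec (f x) (g x)) \<in> borel_measurable M"
proof -
  have *: "(\<lambda>z :: real \<times> real. vec4 (fst z) (snd z) 0 0) \<in> borel_measurable borel"
    by (intro borel_measurable_continuous_onI continuous_intros)
  have [measurable]: "(\<lambda>x. vec4 (fst (g x)) (snd (g x)) 0 0) \<in> borel_measurable M"
    using measurable_compose[OF assms(2) *] .
  show ?thesis unfolding Dsec_def by measurable
qed

definition sec_moment :: "real^4^4 \<Rightarrow> ennreal" where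
  "sec_moment R = (\<integral>\<^sup>+z. ennreal ((snd z)\<^sup>2) * Dsec R z \<partial>lborel)"

lemma measurable_sec_moment [measurable]: "sec_moment \<in> borel_measurable borel"
  unfolding sec_moment_def by measurable

lemma wid_fix: "rotation_matrix R \<Longrightarrow> rotation_matrix S \<Longrightarrow> S *v axis 1 1 = axis 1 1 \<Longrightarrow> wid (R ** S) = wid R"
  by (simp add: wid rotation_matrix_mult matrix_vector_mul_assoc[symmetric])

text \<open>The Blaschke--Petkantschin weight appears here: integrating \<open>y\<close> over the hyperplane orthogonal
  to the first frame vector in polar coordinates turns the four-dimensional integral into one over the
  plane spanned by the first two frame vectors, with the square of the distance to the first as density.\<close>

lemma polar_mean_sec_moment:
  "emeasure lborel D * polar_mean = ennreal (2 * pi) * (\<integral>\<^sup>+R. ennreal (1 / wid R ^ 4) * sec_moment R \<partial>rot_haar)"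
proof -
  let ?a = "\<lambda>R. ennreal (1 / wid R ^ 4)"
  \<comment> \<open>A rotation fixing the first axis changes neither the first frame vector nor
    \<open>wid R\<close>. So the average over \<open>R\<close> depends on \<open>y\<close> only
    through its first coordinate \<open>s\<close> and its distance \<open>r\<close> from the first
    axis.\<close>
  define \<Psi> where "\<Psi> s r = (\<integral>\<^sup>+R. ?a R * Dsec R (s, r) \<partial>rot_haar)" for s r
  have [measurable]: "(\<lambda>p. \<Psi> (fst p) (snd p)) \<in> borel_measurable (borel :: (real \<times> real) measure)"
    unfolding \<Psi>_def by measurable
  have \<Psi>: "(\<integral>\<^sup>+R. ?a R * indicator D (R *v y) \<partial>rot_haar) = \<Psi> s r"
    if y: "y $ 1 = s" "(y $ 2)\<^sup>2 + (y $ 3)\<^sup>2 + (y $ 4)\<^sup>2 = r\<^sup>2" for y s r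
  proof -
    obtain S where S: "rotation_matrix S" "S *v axis 1 1 = axis 1 1" "S *v vec4 s r 0 0 = y"
      using rotation_fixing_axis[OF y] unfolding axis_combination by blast
    have "(\<integral>\<^sup>+R. ?a R * indicator D (R *v y) \<partial>rot_haar) = (\<integral>\<^sup>+R. ?a (R ** S) * Dsec (R ** S) (s, r) \<partial>rot_haar)"
      by (rule nn_integral_cong_AE, use AE_rot_haar in eventually_elim)
        (simp add: wid_fix S Dsec_def matrix_vector_mul_assoc[symmetric])
    also have "\<dots> = \<Psi> s r" unfolding \<Psi>_def by (rule nn_integral_rot_haar_right[OF _ S(1)]) measurable
    finally show ?thesis .
  qed
  have even: "\<Psi> s (- r) = \<Psi> s r" for s r using \<Psi>[of "vec4 s r 0 0" s "- r"] \<Psi>[of "vec4 s r 0 0" s r] by simp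
  have "emeasure lborel D * polar_mean = (\<integral>\<^sup>+R. ?a R * emeasure lborel D \<partial>rot_haar)"
    unfolding polar_mean_def by (subst nn_integral_multc) (auto simp: mult.commute)
  also have "\<dots> = (\<integral>\<^sup>+R. (\<integral>\<^sup>+y. ?a R * indicator D (R *v y) \<partial>lborel) \<partial>rot_haar)"
  proof (rule nn_integral_cong_AE, use AE_rot_haar in eventually_elim)
    case (elim R)
    show ?case by (subst nn_integral_cmult) (auto simp: emeasure_D_rotation[OF elim])
  qed
  also have "\<dots> = (\<integral>\<^sup>+y. (\<integral>\<^sup>+R. ?a R * indicator D (R *v y) \<partial>rot_haar) \<partial>lborel)"
    by (rule Fubini_haar[symmetric]) measurable
  also have "\<dots> = (\<integral>\<^sup>+s. (\<integral>\<^sup>+p. \<Psi> s (norm p) \<partial>(lborel :: (real \<times> real \<times> real) measure)) \<partial>lborel)"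
  proof (subst nn_integral_vec4_13)
    show "(\<lambda>y. \<integral>\<^sup>+R. ?a R * indicator D (R *v y) \<partial>rot_haar) \<in> borel_measurable borel" by measurable
    have "(\<integral>\<^sup>+R. ?a R * indicator D (R *v vec4 s (fst p) (fst (snd p)) (snd (snd p))) \<partial>rot_haar) = \<Psi> s (norm p)" for s p
      by (rule \<Psi>) (cases p, simp_all add: norm_prod_def)
    then show "(\<integral>\<^sup>+s. (\<integral>\<^sup>+p. (\<integral>\<^sup>+R. ?a R * indicator D (R *v vec4 s (fst p) (fst (snd p)) (snd (snd p))) \<partial>rot_haar)
       \<partial>(lborel :: (real \<times> real \<times> real) measure)) \<partial>lborel) =
      (\<integral>\<^sup>+s. (\<integral>\<^sup>+p. \<Psi> s (norm p) \<partial>(lborel :: (real \<times> real \<times> real) measure)) \<partial>lborel)" by simp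
  qed
  also have "\<dots> = (\<integral>\<^sup>+s. ennreal (2 * pi) * (\<integral>\<^sup>+r. ennreal (r\<^sup>2) * \<Psi> s r \<partial>lborel) \<partial>lborel)"
  proof (rule nn_integral_cong)
    fix s
    have [measurable]: "\<Psi> s \<in> borel_measurable borel" unfolding \<Psi>_def by measurable
    have "(\<integral>\<^sup>+p. \<Psi> s (norm p) \<partial>(lborel :: (real \<times> real \<times> real) measure)) =
      ennreal (4 * pi) * (\<integral>\<^sup>+r. ennreal (r\<^sup>2) * \<Psi> s r * indicator {0<..} r \<partial>lborel)"
      by (subst nn_integral_radial) (auto simp: unit_ball_vol_3 power2_eq_square)
    \<comment> \<open>Polar coordinates give a half-line in \<open>r\<close>; half of the sphere
      area 4 pi is spent, by evenness, on extending the integral to the whole line, so that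
      \<open>(s, r)\<close> ranges over the full plane.\<close>
    also have "ennreal (4 * pi) = ennreal (2 * pi) * 2"
      using ennreal_mult[of "2 * pi" 2] by simp
    also have "\<dots> * (\<integral>\<^sup>+r. ennreal (r\<^sup>2) * \<Psi> s r * indicator {0<..} r \<partial>lborel) =
      ennreal (2 * pi) * (2 * (\<integral>\<^sup>+r. ennreal (r\<^sup>2) * \<Psi> s r * indicator {0<..} r \<partial>lborel))" by (simp only: mult.assoc)
    also have "2 * (\<integral>\<^sup>+r. ennreal (r\<^sup>2) * \<Psi> s r * indicator {0<..} r \<partial>lborel) = (\<integral>\<^sup>+r. ennreal (r\<^sup>2) * \<Psi> s r \<partial>lborel)"
      by (rule nn_integral_even[symmetric]) (auto simp: even)
    finally show "(\<integral>\<^sup>+p. \<Psi> s (norm p) \<partial>(lborel :: (real \<times> real \<times> real) measure)) =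
      ennreal (2 * pi) * (\<integral>\<^sup>+r. ennreal (r\<^sup>2) * \<Psi> s r \<partial>lborel)" .
  qed
  also have "\<dots> = ennreal (2 * pi) * (\<integral>\<^sup>+s. (\<integral>\<^sup>+r. ennreal (r\<^sup>2) * \<Psi> s r \<partial>lborel) \<partial>lborel)"
  proof (rule nn_integral_cmult)
    have "(\<lambda>p. ennreal ((snd p)\<^sup>2) * \<Psi> (fst p) (snd p)) \<in> borel_measurable (borel :: (real \<times> real) measure)" by measurable
    then have "(\<lambda>p. ennreal ((snd p)\<^sup>2) * \<Psi> (fst p) (snd p)) \<in> borel_measurable (lborel \<Otimes>\<^sub>M lborel)" by (simp add: lborel_prod)
    from lborel.borel_measurable_nn_integral_fst[OF this]
    show "(\<lambda>s. \<integral>\<^sup>+r. ennreal (r\<^sup>2) * \<Psi> s r \<partial>lborel) \<in> borel_measurable lborel" by simp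
  qed
  also have "(\<integral>\<^sup>+s. (\<integral>\<^sup>+r. ennreal (r\<^sup>2) * \<Psi> s r \<partial>lborel) \<partial>lborel) =
    (\<integral>\<^sup>+z. ennreal ((snd z)\<^sup>2) * \<Psi> (fst z) (snd z) \<partial>lborel)"
    by (subst nn_integral_lborel_Pair(1)) auto
  also have "\<dots> = (\<integral>\<^sup>+z. (\<integral>\<^sup>+R. ennreal ((snd z)\<^sup>2) * (?a R * Dsec R z) \<partial>rot_haar) \<partial>lborel)"
    unfolding \<Psi>_def prod.collapse by (intro nn_integral_cong nn_integral_cmult[symmetric]) measurable
  also have "\<dots> = (\<integral>\<^sup>+R. (\<integral>\<^sup>+z. ennreal ((snd z)\<^sup>2) * (?a R * Dsec R z) \<partial>lborel) \<partial>rot_haar)"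
    by (rule Fubini_haar) measurable
  also have "\<dots> = (\<integral>\<^sup>+R. ?a R * sec_moment R \<partial>rot_haar)"
  proof (rule nn_integral_cong)
    fix R
    have "(\<integral>\<^sup>+z. ennreal ((snd z)\<^sup>2) * (?a R * Dsec R z) \<partial>lborel) = (\<integral>\<^sup>+z. ?a R * (ennreal ((snd z)\<^sup>2) * Dsec R z) \<partial>lborel)"
      by (simp add: mult_ac)
    also have "\<dots> = ?a R * sec_moment R" unfolding sec_moment_def by (rule nn_integral_cmult) measurable
    finally show "(\<integral>\<^sup>+z. ennreal ((snd z)\<^sup>2) * (?a R * Dsec R z) \<partial>lborel) = ?a R * sec_moment R" .
  qed
  finally show ?thesis .
qed

text \<open>The mean square of the parallelogram area over pairs of points of the section, up to
  normalisation. Expanded, it is twice the determinant of the inertia matrix.\<close>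

definition sec_det :: "real^4^4 \<Rightarrow> ennreal" where
  "sec_det R = (\<integral>\<^sup>+z. (\<integral>\<^sup>+y. ennreal ((fst z * snd y - snd z * fst y)\<^sup>2) * Dsec R y * Dsec R z \<partial>lborel) \<partial>lborel)"

text \<open>The factor \<open>1 / wid R ^ 4\<close> becomes an integral over points \<open>z\<close>
  of the plane. For each \<open>z\<close> the frame is turned within its plane, by right invariance,
  until its first vector points along \<open>z\<close>. The constraint on \<open>norm z\<close> then
  says that \<open>z\<close> lies in the section, and the second moment is taken about the line
  through \<open>z\<close>.\<close>

lemma sec_moment_sec_det:
  "(\<integral>\<^sup>+R. ennreal (1 / wid R ^ 4) * sec_moment R \<partial>rot_haar) * ennreal (pi / 2) = (\<integral>\<^sup>+R. sec_det R \<partial>rot_haar)"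
proof -
  define h where "h R z = ennreal ((norm z)\<^sup>2) * indicator {z. norm z * wid R \<le> 1} z * sec_moment R" for R and z :: "real \<times> real"
  have h_eq: "h R z = ennreal ((norm z)\<^sup>2) * indicator {x. x \<le> 1} (norm z * wid R) * sec_moment R" for R z
    by (simp add: h_def indicator_def)
  have [measurable]: "(\<lambda>p. h (snd p) (fst p)) \<in> borel_measurable borel" "h R \<in> borel_measurable borel"
    "(\<lambda>R. h R z) \<in> borel_measurable borel" for R z
    unfolding h_eq by measurable
  have "(\<integral>\<^sup>+R. ennreal (1 / wid R ^ 4) * sec_moment R \<partial>rot_haar) * ennreal (pi / 2) =
    (\<integral>\<^sup>+R. ennreal (1 / wid R ^ 4) * sec_moment R * ennreal (pi / 2) \<partial>rot_haar)"
    by (rule nn_integral_multc[symmetric]) measurable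
  also have "\<dots> = (\<integral>\<^sup>+R. (\<integral>\<^sup>+z. h R z \<partial>lborel) \<partial>rot_haar)"
  proof (rule nn_integral_cong_AE, use AE_rot_haar in eventually_elim)
    case (elim R)
    have "(\<integral>\<^sup>+z. h R z \<partial>lborel) = (\<integral>\<^sup>+(z :: real \<times> real). ennreal ((norm z)\<^sup>2) * indicator {z. norm z * wid R \<le> 1} z \<partial>lborel) * sec_moment R"
      unfolding h_def by (rule nn_integral_multc) measurable
    then show ?case using emeasure_disc_moment[OF wid_pos[OF elim]] by (simp add: mult_ac)
  qed
  also have "\<dots> = (\<integral>\<^sup>+z. (\<integral>\<^sup>+R. h R z \<partial>rot_haar) \<partial>lborel)"
    by (rule Fubini_haar[symmetric]) measurable
  also have "\<dots> = (\<integral>\<^sup>+z. (\<integral>\<^sup>+R. (\<integral>\<^sup>+y. ennreal ((fst z * snd y - snd z * fst y)\<^sup>2) * Dsec R y * Dsec R z \<partial>lborel) \<partial>rot_haar) \<partial>lborel)"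
  proof (rule nn_integral_cong_AE)
    have "AE z in lborel. z \<noteq> (0 :: real \<times> real)" by (rule AE_lborel_singleton)
    then show "AE z in lborel. (\<integral>\<^sup>+R. h R z \<partial>rot_haar) =
      (\<integral>\<^sup>+R. (\<integral>\<^sup>+y. ennreal ((fst z * snd y - snd z * fst y)\<^sup>2) * Dsec R y * Dsec R z \<partial>lborel) \<partial>rot_haar)"
    proof eventually_elim
      case (elim z)
      define n where "n = norm z"
      have n: "n > 0" using elim by (simp add: n_def)
      define c s where "c = fst z / n" and "s = snd z / n"
      have n2: "n\<^sup>2 = (fst z)\<^sup>2 + (snd z)\<^sup>2" by (simp add: n_def norm_prod_def)
      have "c\<^sup>2 + s\<^sup>2 = ((fst z)\<^sup>2 + (snd z)\<^sup>2) / n\<^sup>2" by (simp add: c_def s_def power_divide add_divide_distrib)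
      then have cs: "c\<^sup>2 + s\<^sup>2 = 1" unfolding n2[symmetric] using n by simp
      obtain S where S: "rotation_matrix S" "S *v axis 1 1 = vec4 c s 0 0" "S *v axis 2 1 = vec4 (- s) c 0 0"
        using rotation_frame_exists[of "vec4 c s 0 0" "vec4 (- s) c 0 0"] cs
        by (auto simp: norm_eq_1 inner_vec4 power2_eq_square mult.commute add.commute)
      have Sz: "S *v vec4 (fst y) (snd y) 0 0 = vec4 (fst (rot2 c s y)) (snd (rot2 c s y)) 0 0" for y
      proof -
        have "S *v vec4 (fst y) (snd y) 0 0 = fst y *\<^sub>R vec4 c s 0 0 + snd y *\<^sub>R vec4 (- s) c 0 0"
          unfolding axis_combination[of "fst y" "snd y", symmetric]
          by (simp add: matrix_vector_right_distrib matrix_vector_mult_scaleR S)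
        then show ?thesis by (simp add: rot2_def vec4_eq_iff algebra_simps)
      qed
      have "(\<integral>\<^sup>+R. h R z \<partial>rot_haar) = (\<integral>\<^sup>+R. h (R ** S) z \<partial>rot_haar)"
        by (rule nn_integral_rot_haar_right[OF _ S(1), symmetric]) measurable
      also have "\<dots> = (\<integral>\<^sup>+R. (\<integral>\<^sup>+y. ennreal ((fst z * snd y - snd z * fst y)\<^sup>2) * Dsec R y * Dsec R z \<partial>lborel) \<partial>rot_haar)"
      proof (rule nn_integral_cong_AE, use AE_rot_haar in eventually_elim)
        case R: (elim R)
        have RS: "rotation_matrix (R ** S)" using R S(1) by (rule rotation_matrix_mult)
        have "n *\<^sub>R ((R ** S) *v axis 1 1) = R *v vec4 (fst z) (snd z) 0 0"
        proof -
          have "n *\<^sub>R vec4 c s 0 0 = vec4 (fst z) (snd z) 0 0" using n by (simp add: vec4_eq_iff c_def s_def)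
          then show ?thesis by (simp add: matrix_vector_mul_assoc[symmetric] S matrix_vector_mult_scaleR[symmetric])
        qed
        then have ind: "indicator {z. norm z * wid (R ** S) \<le> 1} z = Dsec R z"
          using mem_D_wid[OF RS, of n] n by (simp add: Dsec_def indicator_def n_def)
        have "sec_moment (R ** S) = (\<integral>\<^sup>+y. (\<lambda>y. ennreal ((snd (rot2 c (- s) y))\<^sup>2) * Dsec R y) (rot2 c s y) \<partial>lborel)"
        proof -
          have "rot2 c (- s) (rot2 c s y) = y" for y using rot2_inverse[of c "- s" y] cs by simp
          then show ?thesis unfolding sec_moment_def
            by (simp add: Dsec_def matrix_vector_mul_assoc[symmetric] Sz)
        qed
        also have "\<dots> = (\<integral>\<^sup>+y. ennreal ((snd (rot2 c (- s) y))\<^sup>2) * Dsec R y \<partial>lborel)"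
          by (rule nn_integral_rot2[OF _ cs]) measurable
        finally have "h (R ** S) z = (ennreal (n\<^sup>2) * Dsec R z) * (\<integral>\<^sup>+y. ennreal ((snd (rot2 c (- s) y))\<^sup>2) * Dsec R y \<partial>lborel)"
          by (simp add: h_def ind n_def)
        also have "\<dots> = (\<integral>\<^sup>+y. (ennreal (n\<^sup>2) * Dsec R z) * (ennreal ((snd (rot2 c (- s) y))\<^sup>2) * Dsec R y) \<partial>lborel)"
          by (rule nn_integral_cmult[symmetric]) measurable
        also have "\<dots> = (\<integral>\<^sup>+y. ennreal ((fst z * snd y - snd z * fst y)\<^sup>2) * Dsec R y * Dsec R z \<partial>lborel)"
        \<comment> \<open>The norm of \<open>z\<close> times the distance of \<open>y\<close> from
          the line through \<open>z\<close> is the absolute value of their determinant.\<close>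
        proof (rule nn_integral_cong)
          fix y
          have "n * snd (rot2 c (- s) y) = fst z * snd y - snd z * fst y"
            using n by (simp add: rot2_def c_def s_def field_simps)
          then have "n\<^sup>2 * (snd (rot2 c (- s) y))\<^sup>2 = (fst z * snd y - snd z * fst y)\<^sup>2" by (metis power_mult_distrib)
          then have "ennreal (n\<^sup>2) * ennreal ((snd (rot2 c (- s) y))\<^sup>2) = ennreal ((fst z * snd y - snd z * fst y)\<^sup>2)"
            by (metis ennreal_mult zero_le_power2)
          then show "(ennreal (n\<^sup>2) * Dsec R z) * (ennreal ((snd (rot2 c (- s) y))\<^sup>2) * Dsec R y) =
            ennreal ((fst z * snd y - snd z * fst y)\<^sup>2) * Dsec R y * Dsec R z"
            by (metis (no_types, lifting) mult.assoc mult.commute)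
        qed
        finally show ?case .
      qed
      finally show ?case .
    qed
  qed
  also have "\<dots> = (\<integral>\<^sup>+R. sec_det R \<partial>rot_haar)"
    unfolding sec_det_def by (rule Fubini_haar) measurable
  finally show ?thesis .
qed

text \<open>The section of \<open>D\<close> is the \<open>width_dual\<close> of the projection of
  \<open>K\<close> to the same plane, so \<open>area_dual_inertia\<close> applies. Expanding the
  squared determinant gives \<open>2 * (J11 * J22 - J12\<^sup>2)\<close>, which doubles its
  constant.\<close>

lemma sec_det_le:
  assumes R: "rotation_matrix R"
  shows "sec_det R \<le> ennreal (pi ^ 6 / 2048) * ennreal (1 / area R ^ 4)"
proof -
  let ?u = "R *v axis 1 1" and ?v = "R *v axis 2 1"
  let ?L = "proj2 ?u ?v K"
  let ?E = "width_dual ?L"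
  have vec: "R *v vec4 (fst z) (snd z) 0 0 = fst z *\<^sub>R ?u + snd z *\<^sub>R ?v" for z :: "real \<times> real"
    unfolding axis_combination[symmetric] by (simp add: matrix_vector_right_distrib matrix_vector_mult_scaleR)
  have memE: "z \<in> ?E \<longleftrightarrow> R *v vec4 (fst z) (snd z) 0 0 \<in> D" for z
    unfolding vec width_dual_def proj2_def
    by (cases z) (simp add: inner_add_right inner_diff_left algebra_simps)
  have ind: "Dsec R z = indicator ?E z" for z by (simp add: Dsec_def memE indicator_def)
  have cL: "compact ?L" by (rule compact_proj2[OF body(1)])
  have "linear (\<lambda>x. (x \<bullet> ?u, x \<bullet> ?v))" by (auto intro!: linearI simp: inner_add_left)
  then have convL: "convex ?L" unfolding proj2_def using body(2) by (rule convex_linear_image)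
  obtain B where B: "\<And>y. y \<in> D \<Longrightarrow> norm y \<le> B" using bounded_width_dual[OF body(3)] by (auto simp: bounded_iff)
  have "norm (vec4 (fst z) (snd z) 0 0) = norm z" for z :: "real \<times> real"
    by (simp add: norm_eq_sqrt_inner inner_vec4 inner_prod_def)
  then have "norm z \<le> B" if "z \<in> ?E" for z
    using B[of "R *v vec4 (fst z) (snd z) 0 0"] that unfolding memE by (simp add: rotation_matrix_norm[OF R])
  then have bE: "bounded ?E" unfolding bounded_iff by blast
  then have cE: "compact ?E" using closed_width_dual by (simp add: compact_eq_bounded_closed)
  have [measurable]: "?E \<in> sets borel" using cE by (rule borel_compact)
  have int: "integrable lborel (\<lambda>z. f z * indicator ?E z)" if "continuous_on UNIV f" for f :: "real \<times> real \<Rightarrow> real"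
    using borel_integrable_compact[OF cE continuous_on_subset[OF that]]
    by (simp add: mult.commute[of "f _"] indicator_def if_distrib cong: if_cong)
  define J11 J12 J22 where "J11 = (\<integral>z. (fst z)\<^sup>2 * indicator ?E z \<partial>lborel)"
    and "J12 = (\<integral>z. fst z * snd z * indicator ?E z \<partial>lborel)"
    and "J22 = (\<integral>z. (snd z)\<^sup>2 * indicator ?E z \<partial>lborel)"
  have int3: "integrable lborel (\<lambda>z. (fst z)\<^sup>2 * indicator ?E z)" "integrable lborel (\<lambda>z. fst z * snd z * indicator ?E z)"
    "integrable lborel (\<lambda>z. (snd z)\<^sup>2 * indicator ?E z)"
    by (auto intro!: int continuous_intros)
  have inner: "(\<integral>\<^sup>+y. ennreal ((fst z * snd y - snd z * fst y)\<^sup>2) * Dsec R y * Dsec R z \<partial>lborel) =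
    ennreal ((J22 * (fst z)\<^sup>2 - 2 * J12 * (fst z * snd z) + J11 * (snd z)\<^sup>2) * indicator ?E z)" for z
  proof -
    have eq: "(fst z * snd y - snd z * fst y)\<^sup>2 * indicator ?E y = (fst z)\<^sup>2 * ((snd y)\<^sup>2 * indicator ?E y)
       - (2 * fst z * snd z) * (fst y * snd y * indicator ?E y) + (snd z)\<^sup>2 * ((fst y)\<^sup>2 * indicator ?E y)" for y
      by (simp add: power2_eq_square algebra_simps)
    have "(\<integral>\<^sup>+y. ennreal ((fst z * snd y - snd z * fst y)\<^sup>2) * Dsec R y * Dsec R z \<partial>lborel) =
      (\<integral>\<^sup>+y. ennreal ((fst z * snd y - snd z * fst y)\<^sup>2 * indicator ?E y) * indicator ?E z \<partial>lborel)"
      unfolding ind by (intro nn_integral_cong) (auto split: split_indicator)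
    also have "\<dots> = (\<integral>\<^sup>+y. ennreal ((fst z * snd y - snd z * fst y)\<^sup>2 * indicator ?E y) \<partial>lborel) * indicator ?E z"
      by (rule nn_integral_multc) measurable
    also have "(\<integral>\<^sup>+y. ennreal ((fst z * snd y - snd z * fst y)\<^sup>2 * indicator ?E y) \<partial>lborel) =
      ennreal (\<integral>y. (fst z * snd y - snd z * fst y)\<^sup>2 * indicator ?E y \<partial>lborel)"
      by (rule nn_integral_eq_integral) (auto intro!: int continuous_intros)
    also have "(\<integral>y. (fst z * snd y - snd z * fst y)\<^sup>2 * indicator ?E y \<partial>lborel) =
      (fst z)\<^sup>2 * J22 - (2 * fst z * snd z) * J12 + (snd z)\<^sup>2 * J11"
      unfolding eq J11_def J12_def J22_def using int3 by simp
    finally show ?thesis by (simp add: mult_ac split: split_indicator)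
  qed
  have "sec_det R = (\<integral>\<^sup>+z. ennreal ((J22 * (fst z)\<^sup>2 - 2 * J12 * (fst z * snd z) + J11 * (snd z)\<^sup>2) * indicator ?E z) \<partial>lborel)"
    unfolding sec_det_def inner ..
  also have "\<dots> = ennreal (\<integral>z. (J22 * (fst z)\<^sup>2 - 2 * J12 * (fst z * snd z) + J11 * (snd z)\<^sup>2) * indicator ?E z \<partial>lborel)"
  proof (rule nn_integral_eq_integral)
    show "AE z in lborel. 0 \<le> (J22 * (fst z)\<^sup>2 - 2 * J12 * (fst z * snd z) + J11 * (snd z)\<^sup>2) * indicator ?E z"
    proof (rule AE_I2)
      fix z :: "real \<times> real"
      have "0 \<le> (\<integral>y. (fst z * snd y - snd z * fst y)\<^sup>2 * indicator ?E y \<partial>lborel)"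
        by (intro integral_nonneg_AE) auto
      also have "\<dots> = (\<integral>y. (fst z)\<^sup>2 * ((snd y)\<^sup>2 * indicator ?E y)
       - (2 * fst z * snd z) * (fst y * snd y * indicator ?E y) + (snd z)\<^sup>2 * ((fst y)\<^sup>2 * indicator ?E y) \<partial>lborel)"
        by (intro Bochner_Integration.integral_cong) (simp_all add: power2_eq_square algebra_simps)
      also have "\<dots> = J22 * (fst z)\<^sup>2 - 2 * J12 * (fst z * snd z) + J11 * (snd z)\<^sup>2"
        unfolding J11_def J12_def J22_def using int3 by simp
      finally show "0 \<le> (J22 * (fst z)\<^sup>2 - 2 * J12 * (fst z * snd z) + J11 * (snd z)\<^sup>2) * indicator ?E z" by simp
    qed
  qed (auto intro!: int continuous_intros)
  also have "(\<integral>z. (J22 * (fst z)\<^sup>2 - 2 * J12 * (fst z * snd z) + J11 * (snd z)\<^sup>2) * indicator ?E z \<partial>lborel) = 2 * (J11 * J22 - J12\<^sup>2)"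
  proof -
    have "(\<integral>z. (J22 * (fst z)\<^sup>2 - 2 * J12 * (fst z * snd z) + J11 * (snd z)\<^sup>2) * indicator ?E z \<partial>lborel) =
      (\<integral>z. J22 * ((fst z)\<^sup>2 * indicator ?E z) - (2 * J12) * (fst z * snd z * indicator ?E z) + J11 * ((snd z)\<^sup>2 * indicator ?E z) \<partial>lborel)"
      by (intro Bochner_Integration.integral_cong) (simp_all add: algebra_simps)
    also have "\<dots> = J22 * J11 - (2 * J12) * J12 + J11 * J22"
      using int3 by (simp add: J11_def[symmetric] J12_def[symmetric] J22_def[symmetric])
    finally show ?thesis by (simp add: power2_eq_square)
  qed
  also have "ennreal (2 * (J11 * J22 - J12\<^sup>2)) \<le> ennreal (pi ^ 6 / 2048 * (1 / area R ^ 4))"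
  proof (rule ennreal_leI)
    have "area R ^ 4 * (J11 * J22 - J12\<^sup>2) \<le> pi ^ 6 / 4096"
      unfolding area[OF R] J11_def J12_def J22_def by (rule area_dual_inertia[OF cL convL bE])
    then show "2 * (J11 * J22 - J12\<^sup>2) \<le> pi ^ 6 / 2048 * (1 / area R ^ 4)"
      using area_pos[OF R] by (simp add: field_simps)
  qed
  also have "\<dots> = ennreal (pi ^ 6 / 2048) * ennreal (1 / area R ^ 4)"
    using area_pos[OF R] by (intro ennreal_mult) auto
  finally show ?thesis .
qed

text \<open>The factor pi^2/2 comes from \<open>emeasure_D\<close>, 2 pi from
  \<open>polar_mean_sec_moment\<close>, pi/2 from the disc moment and pi^6/2048 from the planar
  bound. Solving for the square of \<open>polar_mean\<close> leaves (2/pi^2)(2 pi)(2/pi)(pi^6/2048)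
  = pi^4/256.\<close>

theorem polar_mean_le_area_mean:
  "polar_mean\<^sup>2 \<le> ennreal (pi ^ 4 / 256) * (\<integral>\<^sup>+R. ennreal (1 / area R ^ 4) \<partial>rot_haar)"
proof -
  let ?Y = "\<integral>\<^sup>+R. ennreal (1 / wid R ^ 4) * sec_moment R \<partial>rot_haar"
  let ?B = "\<integral>\<^sup>+R. ennreal (1 / area R ^ 4) \<partial>rot_haar"
  have one: "ennreal (2 / pi\<^sup>2) * ennreal (pi\<^sup>2 / 2) = 1" "ennreal (2 / pi) * ennreal (pi / 2) = 1"
    by (subst ennreal_mult[symmetric]; simp)+
  have Y: "?Y * ennreal (pi / 2) \<le> ennreal (pi ^ 6 / 2048) * ?B"
  proof -
    have "?Y * ennreal (pi / 2) = (\<integral>\<^sup>+R. sec_det R \<partial>rot_haar)" by (rule sec_moment_sec_det)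
    also have "\<dots> \<le> (\<integral>\<^sup>+R. ennreal (pi ^ 6 / 2048) * ennreal (1 / area R ^ 4) \<partial>rot_haar)"
      by (rule nn_integral_mono_AE, use AE_rot_haar in eventually_elim) (rule sec_det_le)
    also have "\<dots> = ennreal (pi ^ 6 / 2048) * ?B" by (rule nn_integral_cmult) measurable
    finally show ?thesis .
  qed
  have "polar_mean\<^sup>2 = ennreal (2 / pi\<^sup>2) * (emeasure lborel D * polar_mean)"
  proof -
    have "polar_mean\<^sup>2 = (ennreal (2 / pi\<^sup>2) * ennreal (pi\<^sup>2 / 2)) * polar_mean\<^sup>2" unfolding one by simp
    then show ?thesis unfolding emeasure_D by (simp only: power2_eq_square mult_ac)
  qed
  also have "\<dots> = ennreal (2 / pi\<^sup>2) * (ennreal (2 * pi) * ((ennreal (2 / pi) * ennreal (pi / 2)) * ?Y))"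
    unfolding polar_mean_sec_moment one by simp
  also have "\<dots> = (ennreal (2 / pi\<^sup>2) * (ennreal (2 * pi) * ennreal (2 / pi))) * (?Y * ennreal (pi / 2))"
    by (simp only: mult_ac)
  also have "\<dots> \<le> (ennreal (2 / pi\<^sup>2) * (ennreal (2 * pi) * ennreal (2 / pi))) * (ennreal (pi ^ 6 / 2048) * ?B)"
    by (intro mult_left_mono Y) auto
  also have "\<dots> = (ennreal (2 / pi\<^sup>2) * (ennreal (2 * pi) * ennreal (2 / pi)) * ennreal (pi ^ 6 / 2048)) * ?B"
    by (simp only: mult.assoc)
  also have "ennreal (2 / pi\<^sup>2) * (ennreal (2 * pi) * ennreal (2 / pi)) * ennreal (pi ^ 6 / 2048) = ennreal (pi ^ 4 / 256)"
  proof -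
    have "ennreal (2 * pi) * ennreal (2 / pi) = ennreal 4" by (subst ennreal_mult[symmetric]) auto
    moreover have "ennreal (2 / pi\<^sup>2) * ennreal 4 = ennreal (8 / pi\<^sup>2)" by (subst ennreal_mult[symmetric]) auto
    moreover have "ennreal (8 / pi\<^sup>2) * ennreal (pi ^ 6 / 2048) = ennreal (pi ^ 4 / 256)"
      by (subst ennreal_mult[symmetric]) (auto simp: eval_nat_numeral)
    ultimately show ?thesis by (simp only:)
  qed
  finally show ?thesis .
qed

end

section \<open>From extended nonnegative integrals back to real ones\<close>

lemma integral_rot_haar_bounds:
  fixes f :: "real^4^4 \<Rightarrow> real"
  assumes [measurable]: "f \<in> borel_measurable borel" and lo: "0 < lo"
    and f: "\<And>R. rotation_matrix R \<Longrightarrow> lo \<le> f R \<and> f R \<le> hi"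
  shows "(\<integral>\<^sup>+R. ennreal (1 / f R ^ 4) \<partial>rot_haar) = ennreal (\<integral>R. f R powr (-4) \<partial>rot_haar)"
    and "0 < (\<integral>R. f R powr (-4) \<partial>rot_haar)"
proof -
  have powr: "f R powr (-4) = 1 / f R ^ 4" if "rotation_matrix R" for R
    using f[OF that] lo powr_numeral[of "f R" "Num.Bit0 (Num.Bit0 Num.One)"] by (simp add: powr_minus_divide)
  \<comment> \<open>The lower bound on \<open>f\<close> makes the negative power integrable, the
    upper bound keeps its integral positive.\<close>
  have bound: "1 / hi ^ 4 \<le> 1 / f R ^ 4 \<and> 1 / f R ^ 4 \<le> 1 / lo ^ 4" if "rotation_matrix R" for R
    using f[OF that] lo by (intro conjI frac_le power_mono) auto
  have hi: "hi > 0"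
  proof -
    have "rotation_matrix (mat 1 :: real^4^4)" by (simp add: rotation_matrix_def orthogonal_matrix_id)
    from f[OF this] lo show ?thesis by linarith
  qed
  have int: "integrable rot_haar (\<lambda>R. f R powr (-4))"
  proof (rule rot_haar.integrable_const_bound)
    show "AE R in rot_haar. norm (f R powr (-4)) \<le> 1 / lo ^ 4"
      using AE_rot_haar by eventually_elim (use bound powr in auto)
  qed measurable
  have "(\<integral>\<^sup>+R. ennreal (1 / f R ^ 4) \<partial>rot_haar) = (\<integral>\<^sup>+R. ennreal (f R powr (-4)) \<partial>rot_haar)"
    by (rule nn_integral_cong_AE, use AE_rot_haar in eventually_elim) (simp add: powr)
  also have "\<dots> = ennreal (\<integral>R. f R powr (-4) \<partial>rot_haar)"
    by (rule nn_integral_eq_integral[OF int]) simp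
  finally show "(\<integral>\<^sup>+R. ennreal (1 / f R ^ 4) \<partial>rot_haar) = ennreal (\<integral>R. f R powr (-4) \<partial>rot_haar)" .
  have "(\<integral>R. 1 / hi ^ 4 \<partial>rot_haar) \<le> (\<integral>R. f R powr (-4) \<partial>rot_haar)"
  proof (rule integral_mono_AE[OF _ int])
    show "AE R in rot_haar. 1 / hi ^ 4 \<le> f R powr (-4)"
      using AE_rot_haar by eventually_elim (use bound powr in auto)
  qed simp
  moreover have "(\<integral>R. 1 / hi ^ 4 \<partial>rot_haar) = 1 / hi ^ 4"
    by (simp add: measure_def emeasure_rot_haar_UNIV)
  moreover have "1 / hi ^ 4 > 0" using hi by simp
  ultimately show "0 < (\<integral>R. f R powr (-4) \<partial>rot_haar)" by linarith
qed

context body4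
begin

lemma integral_proj_vol_line:
  "(\<integral>F. proj_vol F K powr p \<partial>grassmannian_measure 1) = (\<integral>R. wid R powr p \<partial>rot_haar)"
  unfolding grassmannian_measure_1 wid_def
proof (rule integral_distr)
  show "(\<lambda>R. rot_act R (span {axis 1 1})) \<in> rot_haar \<rightarrow>\<^sub>M grassmannian_borel 1"
    unfolding measurable_cong_sets[OF sets_rot_haar refl] by (rule measurable_rot_act_const[OF span_axis_in_grassmannian(1)])
  note [measurable] = measurable_proj_vol(1)[OF body(1)]
  show "(\<lambda>F. proj_vol F K powr p) \<in> borel_measurable (grassmannian_borel 1)" by measurable
qed

lemma integral_proj_vol_plane:
  "(\<integral>F. proj_vol F K powr p \<partial>grassmannian_measure 2) = (\<integral>R. area R powr p \<partial>rot_haar)"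
  unfolding grassmannian_measure_2 area_def
proof (rule integral_distr)
  show "(\<lambda>R. rot_act R (span {axis 1 1, axis 2 1})) \<in> rot_haar \<rightarrow>\<^sub>M grassmannian_borel 2"
    unfolding measurable_cong_sets[OF sets_rot_haar refl] by (rule measurable_rot_act_const[OF span_axis_in_grassmannian(2)])
  note [measurable] = measurable_proj_vol(2)[OF body(1)]
  show "(\<lambda>F. proj_vol F K powr p) \<in> borel_measurable (grassmannian_borel 2)" by measurable
qed

lemma integral_pos:
  "0 < (\<integral>R. wid R powr (-4) \<partial>rot_haar)" "0 < (\<integral>R. area R powr (-4) \<partial>rot_haar)"
proof -
  obtain lo hi where "0 < lo" "\<And>R. rotation_matrix R \<Longrightarrow> lo \<le> wid R \<and> wid R \<le> hi" using wid_bounds by blast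
  then show "0 < (\<integral>R. wid R powr (-4) \<partial>rot_haar)" by (rule integral_rot_haar_bounds(2)[OF measurable_wid])
  obtain lo hi where "0 < lo" "\<And>R. rotation_matrix R \<Longrightarrow> lo \<le> area R \<and> area R \<le> hi" using area_bounds' by blast
  then show "0 < (\<integral>R. area R powr (-4) \<partial>rot_haar)" by (rule integral_rot_haar_bounds(2)[OF measurable_area])
qed

lemma integral_wid_le_area:
  "(\<integral>R. wid R powr (-4) \<partial>rot_haar)\<^sup>2 \<le> pi ^ 4 / 256 * (\<integral>R. area R powr (-4) \<partial>rot_haar)"
proof -
  obtain lo hi where "0 < lo" "\<And>R. rotation_matrix R \<Longrightarrow> lo \<le> wid R \<and> wid R \<le> hi" using wid_bounds by blast
  then have 1: "polar_mean = ennreal (\<integral>R. wid R powr (-4) \<partial>rot_haar)"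
    unfolding polar_mean_def by (rule integral_rot_haar_bounds(1)[OF measurable_wid])
  obtain lo hi where "0 < lo" "\<And>R. rotation_matrix R \<Longrightarrow> lo \<le> area R \<and> area R \<le> hi" using area_bounds' by blast
  then have 2: "(\<integral>\<^sup>+R. ennreal (1 / area R ^ 4) \<partial>rot_haar) = ennreal (\<integral>R. area R powr (-4) \<partial>rot_haar)"
    by (rule integral_rot_haar_bounds(1)[OF measurable_area])
  have "ennreal ((\<integral>R. wid R powr (-4) \<partial>rot_haar)\<^sup>2) = polar_mean\<^sup>2"
    unfolding 1 using integral_pos by (simp add: ennreal_power)
  also have "\<dots> \<le> ennreal (pi ^ 4 / 256) * ennreal (\<integral>R. area R powr (-4) \<partial>rot_haar)"
    using polar_mean_le_area_mean unfolding 2 .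
  also have "\<dots> = ennreal (pi ^ 4 / 256 * (\<integral>R. area R powr (-4) \<partial>rot_haar))"
    using integral_pos by (intro ennreal_mult[symmetric]) auto
  finally show ?thesis
    by (rule ennreal_le_iff[THEN iffD1, rotated]) (use integral_pos in \<open>auto intro!: mult_nonneg_nonneg\<close>)
qed

end

text \<open>An inner ball gives \<open>K\<close> positive volume, and the volume of a centred ball
  is strictly increasing in the radius, so the description in \<open>volume_ball\<close> has exactly
  one solution.\<close>

lemma volume_ball_eq:
  fixes K :: "(real^4) set"
  assumes K: "convex_body K"
  obtains r where "r > 0" "volume_ball K = cball 0 r"
proof -
  have m: "measure lborel (cball (0::real^4) r) = pi\<^sup>2 / 2 * r ^ 4" if "r \<ge> 0" for r
    using that by (simp add: content_cball unit_ball_vol_4)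
  obtain c e where e: "cball c e \<subseteq> K" "e > 0" using K unfolding convex_body_def by (metis ex_in_conv mem_interior_cball)
  have "measure lborel (cball c e) \<le> measure lborel K"
    using K e by (intro measure_mono_fmeasurable) (auto simp: convex_body_def intro: fmeasurable_compact)
  moreover have "0 < measure lborel (cball c e)" using e by (simp add: content_cball_pos)
  ultimately have V: "measure lborel K > 0" by linarith
  define r where "r = root 4 (measure lborel K * 2 / pi\<^sup>2)"
  have r: "r > 0" using V by (simp add: r_def)
  have r4: "pi\<^sup>2 / 2 * r ^ 4 = measure lborel K" using V by (simp add: r_def)
  have "(THE r. 0 \<le> r \<and> measure lborel (cball (0::real^4) r) = measure lborel K) = r"
  proof (rule the_equality)
    fix s assume s: "0 \<le> s \<and> measure lborel (cball (0::real^4) s) = measure lborel K"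
    then have "s ^ 4 = r ^ 4" using m[of s] r4 by simp
    then show "s = r" using s r by (intro power_eq_imp_eq_base[of s 4 r]) auto
  next
    have "measure lborel (cball (0::real^4) r) = measure lborel K" using m[OF less_imp_le[OF r]] r4 by (rule trans)
    then show "0 \<le> r \<and> measure lborel (cball (0::real^4) r) = measure lborel K" using r by simp
  qed
  then have "volume_ball K = cball 0 r" by (simp only: volume_ball_def)
  with r show thesis by (rule that)
qed

theorem mainTheorem3:
  fixes K :: "(real^4) set"
  assumes "convex_body K"
  shows "proj_mean 1 (-4) K \<ge> proj_mean 2 (-4) K powr (1/2)"
proof -
  interpret K: body4 K using assms by unfold_locales (auto simp: convex_body_def)
  obtain r where r: "r > 0" "volume_ball K = cball 0 r" using volume_ball_eq[OF assms] .
  interpret B: body4 "cball (0::real^4) r" using r by unfold_locales auto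
  have one: "measure rot_haar UNIV = 1" by (simp add: measure_def emeasure_rot_haar_UNIV)
  have u: "norm (R *v axis 1 1) = 1" "norm (R *v axis 2 1) = 1" "(R *v axis 1 1) \<bullet> (R *v axis 2 1) = 0"
    if "rotation_matrix R" for R :: "real^4^4"
    unfolding rotation_matrix_norm[OF that] rotation_matrix_inner[OF that] by (simp_all add: norm_eq_1 inner_vec4)
  \<comment> \<open>Here the ball serves as its own inner and outer ball, so lower and upper bound
    coincide.\<close>
  have w: "B.wid R = 2 * r" if "rotation_matrix R" for R
    unfolding B.wid[OF that]
    using width_bounds[OF _ order_refl r(1) order_refl u(1)[OF that]] by (intro antisym) auto
  have a: "B.area R = pi * r\<^sup>2" if "rotation_matrix R" for R
    unfolding B.area[OF that]
    using area_bounds[OF _ order_refl r(1) order_refl u[OF that]] by (intro antisym) auto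
  have "(\<integral>R. B.wid R powr (-4) \<partial>rot_haar) = (\<integral>R. (2 * r) powr (-4) \<partial>rot_haar)"
    using AE_rot_haar by (intro integral_cong_AE) (auto elim!: eventually_mono simp: w)
  then have Iw: "(\<integral>R. B.wid R powr (-4) \<partial>rot_haar) = 1 / (2 * r) ^ 4"
    using r by (simp add: one powr_minus_divide)
  have "(\<integral>R. B.area R powr (-4) \<partial>rot_haar) = (\<integral>R. (pi * r\<^sup>2) powr (-4) \<partial>rot_haar)"
    using AE_rot_haar by (intro integral_cong_AE) (auto elim!: eventually_mono simp: a)
  then have Ia: "(\<integral>R. B.area R powr (-4) \<partial>rot_haar) = 1 / (pi * r\<^sup>2) ^ 4"
    using r by (simp add: one powr_minus_divide)
  define P where "P = (\<integral>R. K.wid R powr (-4) \<partial>rot_haar)"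
  define A where "A = (\<integral>R. K.area R powr (-4) \<partial>rot_haar)"
  have pos: "P > 0" "A > 0" using K.integral_pos by (auto simp: P_def A_def)
  \<comment> \<open>\<open>x\<close> and \<open>y\<close> are the quotients of integrals inside the
    two functionals. Because (2 r)^8 = 256 r^8 and (pi r^2)^4 = pi^4 r^8, the radius enters both
    sides of \<open>x\<^sup>2 \<le> y\<close> in the same way and cancels.\<close>
  define x where "x = P * (2 * r) ^ 4"
  define y where "y = A * (pi * r\<^sup>2) ^ 4"
  have xy: "x > 0" "y > 0" using pos r by (auto simp: x_def y_def)
  have m1: "proj_mean 1 (-4) K = x powr (- (1/4))"
    unfolding proj_mean_def r(2) K.integral_proj_vol_line B.integral_proj_vol_line Iw P_def[symmetric] x_def by simp
  have m2: "proj_mean 2 (-4) K = y powr (- (1/4))"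
    unfolding proj_mean_def r(2) K.integral_proj_vol_plane B.integral_proj_vol_plane Ia A_def[symmetric] y_def by simp
  have "P\<^sup>2 \<le> pi ^ 4 / 256 * A" using K.integral_wid_le_area by (simp add: P_def A_def)
  then have "256 * P\<^sup>2 * r ^ 8 \<le> pi ^ 4 * A * r ^ 8" using r by (intro mult_right_mono) auto
  moreover have "x\<^sup>2 = 256 * P\<^sup>2 * r ^ 8" "y = pi ^ 4 * A * r ^ 8"
    by (simp_all add: x_def y_def power_mult_distrib flip: power_mult)
  ultimately have "x\<^sup>2 \<le> y" by simp
  have "proj_mean 2 (-4) K powr (1/2) = y powr (- (1/8))" unfolding m2 by (simp add: powr_powr)
  \<comment> \<open>The exponent is negative, which reverses the inequality between
    \<open>x\<^sup>2\<close> and \<open>y\<close>.\<close>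
  also have "\<dots> \<le> (x\<^sup>2) powr (- (1/8))" using \<open>x\<^sup>2 \<le> y\<close> xy by (intro powr_mono2') auto
  also have "(x\<^sup>2) powr (- (1/8)) = x powr (- (1/4))"
    using xy by (simp add: powr_powr flip: powr_numeral)
  also have "\<dots> = proj_mean 1 (-4) K" by (rule m1[symmetric])
  finally show ?thesis .
qed

end
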